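(* Let $\Omega$ be a logarithmic starlike at infinity domain. Let $p_0\ge1$ and suppose $e^{\lambda z}\in H^{p_0}(\Omega)$ for all $\lambda\le0$. Then: (1) $\mathcal{LM}\cap\mathcal A(\Omega)$ is dense in $\mathcal A(\Omega)$ (with respect to the supremum norm on $\overline\Omega^\infty$); (2) $e^{\lambda z}\in H^p(\Omega)$ for all $\lambda\le0$ and all $p\in[1,\infty)$, and $\operatorname{span}\{e^{\lambda z}:\lambda\le0\}$ is dense in $H^p(\Omega)$ for all $p\in[1,\infty)$.
   Context: A logarithmic starlike at infinity domain is $\Omega=\{x+iy:x>\psi(y)\}$ where $\psi:\mathbb R\to\mathbb R$ is differentiable with $|\psi'|\le K$ for some $K>0$, and there exist $R>0$ and $0<a<1$ with $\psi(y)\ge -a\log|y|$ for $|y|\ge R$. (Such $\Omega$ is a Jordan domain in the Riemann sphere.) $\overline\Omega^\infty$ denotes the closure in the Riemann sphere. $\mathcal A(\Omega)$ is the algebra of functions continuous on $\overline\Omega^\infty$ (i.e. continuous on $\overline\Omega$ with a finite limit at $\infty$) and holomorphic in $\Omega$. $\mathcal{LM}$ is the set of Laplace transforms $\mathcal L\mu(z)=\int_0^{\infty}e^{-sz}\,d\mu(s)$ of compactly supported finite complex Borel measures $\mu$ on $[0,+\infty)$ (these are entire functions). For a simply connected domain $D\subsetneq\mathbb C$ and $1\le p<\infty$, $H^p(D)$ is the space of holomorphic $f$ on $D$ such that $|f|^p$ has a harmonic majorant, with the usual norm. *)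

theory Defs
  imports "HOL-Analysis.Analysis"
begin

definition log_starlike_fun :: "(real \<Rightarrow> real) \<Rightarrow> bool" where
  "log_starlike_fun \<psi> \<longleftrightarrow>
     (\<exists>K>0. \<forall>y. \<exists>d. (\<psi> has_real_derivative d) (at y) \<and> \<bar>d\<bar> \<le> K) \<and>
     (\<exists>R>0. \<exists>a. 0 < a \<and> a < 1 \<and> (\<forall>y. \<bar>y\<bar> \<ge> R \<longrightarrow> \<psi> y \<ge> - a * ln \<bar>y\<bar>))"

definition epi_domain :: "(real \<Rightarrow> real) \<Rightarrow> complex set" where
  "epi_domain \<psi> = {z. Re z > \<psi> (Im z)}"

definition disc_alg :: "complex set \<Rightarrow> (complex \<Rightarrow> complex) set" where
  "disc_alg \<Omega> = {f. continuous_on (closure \<Omega>) f \<and> f holomorphic_on \<Omega> \<and>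
      (\<exists>L. filterlim f (nhds L) (inf at_infinity (principal (closure \<Omega>))))}"

text \<open>Laplace transforms of compactly supported finite complex Borel measures on
  [0,\<infinity>). A finite complex Borel measure is represented in polar form
  h dM, with M a finite positive Borel measure and h a bounded Borel function.\<close>

definition LM :: "(complex \<Rightarrow> complex) set" where
  "LM = {g. \<exists>(M :: real measure) (h :: real \<Rightarrow> complex) T B.
       sets M = sets borel \<and> finite_measure M \<and> 0 \<le> T \<and>
       emeasure M (UNIV - {0..T}) = 0 \<and>
       h \<in> borel_measurable borel \<and> (\<forall>s. norm (h s) \<le> B) \<and>
       (\<forall>z. g z = integral\<^sup>L M (\<lambda>s. h s * exp (- (complex_of_real s) * z)))}"

definition harmonic_on :: "complex set \<Rightarrow> (complex \<Rightarrow> real) \<Rightarrow> bool" where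
  "harmonic_on S u \<longleftrightarrow> (\<forall>z\<in>S. \<exists>r>0. ball z r \<subseteq> S \<and>
      (\<exists>F. F holomorphic_on ball z r \<and> (\<forall>w\<in>ball z r. u w = Re (F w))))"

definition harm_majorants :: "complex set \<Rightarrow> real \<Rightarrow> (complex \<Rightarrow> complex) \<Rightarrow> (complex \<Rightarrow> real) set" where
  "harm_majorants D p f = {u. harmonic_on D u \<and> (\<forall>z\<in>D. norm (f z) powr p \<le> u z)}"

definition Hardy :: "complex set \<Rightarrow> real \<Rightarrow> (complex \<Rightarrow> complex) set" where
  "Hardy D p = {f. f holomorphic_on D \<and> harm_majorants D p f \<noteq> {}}"

text \<open>Usual norm: (least harmonic majorant of |f|^p evaluated at a base point z0)^(1/p).\<close>

definition Hardy_norm :: "complex set \<Rightarrow> real \<Rightarrow> complex \<Rightarrow> (complex \<Rightarrow> complex) \<Rightarrow> real" where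
  "Hardy_norm D p z0 f = (Inf ((\<lambda>u. u z0) ` harm_majorants D p f)) powr (1 / p)"

definition exp_span :: "(complex \<Rightarrow> complex) set" where
  "exp_span = {f. \<exists>n (c :: nat \<Rightarrow> complex) (l :: nat \<Rightarrow> real). (\<forall>k<n. l k \<le> 0) \<and>
       f = (\<lambda>z. \<Sum>k<n. c k * exp (complex_of_real (l k) * z))}"

end

theory Submission
  imports Defs "HOL-Complex_Analysis.Complex_Analysis" "HOL-Real_Asymp.Real_Asymp"
begin

text \<open>Call a closed space of functions on the closure of the domain admissible if it contains suitable Laplace
  transforms approximating \<open>1 / (z - w)\<close> for \<open>w\<close> far to the left; the growth condition on \<open>\<psi>\<close>,
  in the form \<open>exp (- \<psi> y) \<le> A * (1 + \<bar>y\<bar>)\<close>, is what makes these approximations uniform. Since the complement of the domain is invariant under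
  translation to the left, poles can be pushed to the right up to the boundary, and Cauchy's formula along a
  slightly shifted graph puts every function holomorphic on a larger domain \<open>Re z > \<psi> (Im z) - \<epsilon>\<close> and
  \<open>O(\<bar>z\<bar> powr -2)\<close> into the space. For (1), take the uniform limits of Laplace transforms; translation by
  \<open>\<epsilon>\<close> and a rational cutoff reduce to such functions.

  For (2), take the functions approximable by exponentials, smallness of \<open>f - g\<close> being measured by the value
  at the base point of a harmonic majorant of \<open>\<bar>f - g\<bar> powr p\<close>. A function in the Hardy space is first
  approximated by bounded ones. This needs uniform integrability of \<open>\<bar>f\<bar> powr p\<close>, which comes from
  \<open>\<bar>f\<bar> powr p \<le> \<bar>G\<bar>\<^sup>2\<close> with \<open>G\<close> in the Hardy space of exponent 2 of the disc (divide out zeros and take a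
  power). Bounded functions are dilated in the disc, then translated in the domain, then cut off.\<close>

section \<open>Harmonic majorants\<close>

text \<open>Boundary values and harmonic measure are avoided: every Hardy space estimate is carried
  by a holomorphic \<open>H\<close> with \<open>v z \<le> Re (H z)\<close>, and its size is the
  single number \<open>Re (H a)\<close>. On a simply connected domain this loses nothing against
  harmonic majorants, and such bounds can be added, scaled and pulled back along holomorphic maps.
  Only exponent 2 has explicit majorants, through Taylor coefficients on the disc; other exponents
  are reduced to it, by boundedness or by domination.

  Both density statements run through the same closed-space argument and differ only in how the
  functions \<open>laplace_beta N N (z - w)\<close> enter the space. They are Laplace transforms
  already, but for the Hardy space they must be replaced by finite exponential sums, although
  \<open>exp (- N * Re z)\<close> is unbounded when the domain reaches arbitrarily far left. This is
  where the hypothesis on exponentials enters.\<close>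

definition majorized :: "complex set \<Rightarrow> complex \<Rightarrow> (complex \<Rightarrow> real) \<Rightarrow> real \<Rightarrow> bool" where
  "majorized S a v d \<longleftrightarrow>
     (\<exists>H. H holomorphic_on S \<and> (\<forall>z\<in>S. v z \<le> Re (H z)) \<and> Re (H a) \<le> d)"

lemma majorizedI:
  assumes "H holomorphic_on S" "\<And>z. z \<in> S \<Longrightarrow> v z \<le> Re (H z)" "Re (H a) \<le> d"
  shows "majorized S a v d"
  using assms unfolding majorized_def by blast

text \<open>Subtracting an imaginary constant leaves the real part alone. The normalisation at
  \<open>a\<close> is what the growth bound for functions with nonnegative real part and the
  evaluation of the truncation factor at \<open>a\<close> rely on.\<close>

lemma majorizedE:
  assumes "majorized S a v d"
  obtains H where "H holomorphic_on S" "\<And>z. z \<in> S \<Longrightarrow> v z \<le> Re (H z)" "Re (H a) \<le> d" "Im (H a) = 0"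
proof -
  obtain H where H: "H holomorphic_on S" "\<And>z. z \<in> S \<Longrightarrow> v z \<le> Re (H z)" "Re (H a) \<le> d"
    using assms unfolding majorized_def by blast
  show thesis
    by (rule that[of "\<lambda>z. H z - \<i> * of_real (Im (H a))"])
       (use H in \<open>auto intro!: holomorphic_intros\<close>)
qed

lemma majorized_mono:
  assumes "majorized S a w c" "\<And>z. z \<in> S \<Longrightarrow> v z \<le> w z" "c \<le> d"
  shows "majorized S a v d"
  using assms unfolding majorized_def by (meson order_trans)

lemma majorized_const: "c \<le> d \<Longrightarrow> majorized S a (\<lambda>_. c) d"
  by (rule majorizedI[of "\<lambda>_. of_real c"]) auto

lemma majorized_add:
  assumes "majorized S a v c" "majorized S a w d"
  shows "majorized S a (\<lambda>z. v z + w z) (c + d)"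
proof -
  obtain H where H: "H holomorphic_on S" "\<And>z. z \<in> S \<Longrightarrow> v z \<le> Re (H z)" "Re (H a) \<le> c"
    using assms(1) by (auto simp: majorized_def)
  obtain H' where H': "H' holomorphic_on S" "\<And>z. z \<in> S \<Longrightarrow> w z \<le> Re (H' z)" "Re (H' a) \<le> d"
    using assms(2) by (auto simp: majorized_def)
  show ?thesis
    by (rule majorizedI[of "\<lambda>z. H z + H' z"])
       (use H H' in \<open>auto intro!: holomorphic_intros add_mono\<close>)
qed

lemma majorized_cmult:
  assumes "majorized S a v d" "c \<ge> 0"
  shows "majorized S a (\<lambda>z. c * v z) (c * d)"
proof -
  obtain H where H: "H holomorphic_on S" "\<And>z. z \<in> S \<Longrightarrow> v z \<le> Re (H z)" "Re (H a) \<le> d"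
    using assms(1) by (auto simp: majorized_def)
  show ?thesis
    by (rule majorizedI[of "\<lambda>z. of_real c * H z"])
       (use H assms(2) in \<open>auto intro!: holomorphic_intros mult_left_mono\<close>)
qed

text \<open>Composing \<open>H\<close> with \<open>h\<close> keeps it holomorphic; with a Riemann
  map for \<open>h\<close> this moves estimates between the disc and the domain.\<close>

lemma majorized_compose:
  assumes "majorized T (h a) v d" "h holomorphic_on S" "h ` S \<subseteq> T"
  shows "majorized S a (\<lambda>z. v (h z)) d"
proof -
  obtain H where H: "H holomorphic_on T" "\<And>z. z \<in> T \<Longrightarrow> v z \<le> Re (H z)" "Re (H (h a)) \<le> d"
    using assms(1) by (auto simp: majorized_def)
  have "H \<circ> h holomorphic_on S"
    using assms H(1) holomorphic_on_compose_gen by blast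
  then show ?thesis
    by (intro majorizedI[of "H \<circ> h"]) (use H assms in auto)
qed

text \<open>Beyond \<open>\<eta>\<close> the factor \<open>t powr (p - 2)\<close> is monotone in
  \<open>t\<close>, in a direction given by the sign of \<open>p - 2\<close>, so one of its values
  at \<open>B\<close> and \<open>\<eta>\<close> bounds it. Adding both values serves both
  signs.\<close>

lemma powr_le_square_bound:
  fixes t B p \<eta> :: real
  assumes "0 \<le> t" "t \<le> B" "0 < \<eta>" "0 < p"
  shows "t powr p \<le> \<eta> powr p + (\<eta> powr (p - 2) + B powr (p - 2)) * t\<^sup>2"
proof (cases "t \<le> \<eta>")
  case True
  then have "t powr p \<le> \<eta> powr p" using assms by (intro powr_mono2) auto
  then show ?thesis by (simp add: add_increasing2)
next
  case False
  then have t: "t > 0" "t > \<eta>" using assms by auto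
  have "t powr p = t powr (p - 2) * t\<^sup>2"
    using t by (simp add: powr_diff)
  moreover have "t powr (p - 2) \<le> \<eta> powr (p - 2) + B powr (p - 2)"
  proof (cases "p \<ge> 2")
    case True
    then have "t powr (p - 2) \<le> B powr (p - 2)" using assms t by (intro powr_mono2) auto
    then show ?thesis by (simp add: add_increasing)
  next
    case False
    then have "t powr (p - 2) \<le> \<eta> powr (p - 2)" using assms t by (intro powr_mono2') auto
    then show ?thesis by (simp add: add_increasing2)
  qed
  ultimately show ?thesis
    by (smt (verit) mult_right_mono powr_ge_zero zero_le_power2)
qed

text \<open>For functions bounded by \<open>B\<close>, smallness in square mean forces smallness in
  \<open>p\<close>-th mean. The set, the base point and the function are quantified after
  \<open>\<delta>\<close>, which depends on \<open>\<epsilon>\<close>, \<open>p\<close> and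
  \<open>B\<close> alone.\<close>

lemma majorized_powr_of_square:
  fixes B p \<epsilon> :: real
  assumes "\<epsilon> > 0" "p > 0"
  obtains \<delta> where "\<delta> > 0"
    "\<And>S a v. majorized S a (\<lambda>z. (v z)\<^sup>2) \<delta> \<Longrightarrow> (\<And>z. z \<in> S \<Longrightarrow> 0 \<le> v z \<and> v z \<le> B) \<Longrightarrow>
       majorized S a (\<lambda>z. v z powr p) \<epsilon>"
proof -
  define \<eta> where "\<eta> = (\<epsilon> / 2) powr (1 / p)"
  have \<eta>: "\<eta> > 0" "\<eta> powr p = \<epsilon> / 2" using assms by (auto simp: \<eta>_def powr_powr)
  define C where "C = \<eta> powr (p - 2) + B powr (p - 2)"
  have C: "C > 0" using \<eta> by (simp add: C_def add_pos_nonneg)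
  show thesis
  proof
    show "\<epsilon> / (2 * C) > 0" using C assms by simp
    fix S a and v :: "complex \<Rightarrow> real"
    assume *: "majorized S a (\<lambda>z. (v z)\<^sup>2) (\<epsilon> / (2 * C))" "\<And>z. z \<in> S \<Longrightarrow> 0 \<le> v z \<and> v z \<le> B"
    have "majorized S a (\<lambda>z. \<epsilon> / 2 + C * (v z)\<^sup>2) (\<epsilon> / 2 + C * (\<epsilon> / (2 * C)))"
      by (intro majorized_add majorized_cmult majorized_const *) (use C in auto)
    then show "majorized S a (\<lambda>z. v z powr p) \<epsilon>"
    proof (rule majorized_mono)
      show "v z powr p \<le> \<epsilon> / 2 + C * (v z)\<^sup>2" if "z \<in> S" for z
        using powr_le_square_bound[of "v z" B \<eta> p] *(2)[OF that] \<eta> assms by (simp add: C_def)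
      show "\<epsilon> / 2 + C * (\<epsilon> / (2 * C)) \<le> \<epsilon>" using C by simp
    qed
  qed
qed

section \<open>The Hardy space of exponent 2 on the disc\<close>

text \<open>The Cayley transform of \<open>H + 1\<close> that sends the value at 0 to 0 maps the
  disc into itself, and the Schwarz lemma bounds it by \<open>norm z\<close>. Adding 1 keeps the
  values strictly inside the right half-plane, so that \<open>H = 0\<close> is no special
  case.\<close>

lemma norm_le_of_Re_nonneg:
  assumes hol: "H holomorphic_on ball 0 1"
    and pos: "\<And>z. z \<in> ball 0 1 \<Longrightarrow> 0 \<le> Re (H z)"
    and H0: "Im (H 0) = 0" and z: "norm z < 1"
  shows "norm (H z) \<le> 2 * (Re (H 0) + 1) / (1 - norm z) + 1"
proof -
  define m where "m = Re (H 0) + 1"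
  have m: "m \<ge> 1" using pos[of 0] by (simp add: m_def)
  have H0': "H 0 + 1 = of_real m" using H0 by (simp add: m_def complex_eq_iff)
  define g where "g = (\<lambda>z. (H z + 1 - of_real m) / (H z + 1 + of_real m))"
  have ne: "H w + 1 + of_real m \<noteq> 0" if "norm w < 1" for w
  proof -
    have "Re (H w + 1 + of_real m) > 0" using pos[of w] that m by simp
    then show ?thesis by (metis less_irrefl zero_complex.simps(1))
  qed
  have "norm (g z) \<le> norm z"
  proof (rule Schwarz_Lemma(1))
    show "g holomorphic_on ball 0 1"
      unfolding g_def by (intro holomorphic_intros hol) (use ne in auto)
    show "g 0 = 0" by (simp add: g_def H0')
    show "norm (g w) < 1" if "norm w < 1" for w
    proof -
      have "Re (H w) \<ge> 0" using pos[of w] that by simp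
      then have "(Re (H w) + 1 - m)\<^sup>2 < (Re (H w) + 1 + m)\<^sup>2"
        using m by (intro power2_strict_mono) auto
      then have "norm (H w + 1 - of_real m) ^ 2 < norm (H w + 1 + of_real m) ^ 2"
        by (simp add: cmod_power2)
      then have "norm (H w + 1 - of_real m) < norm (H w + 1 + of_real m)"
        by (rule power_less_imp_less_base) auto
      then show ?thesis using ne[OF that] by (simp add: g_def norm_divide pos_divide_less_eq)
    qed
  qed (use z in auto)
  then have g: "norm (g z) \<le> norm z" "norm (g z) < 1" using z by auto
  have "(H z + 1) * (1 - g z) = of_real m * (1 + g z)"
    using ne[OF z] by (simp add: g_def field_simps)
  then have "norm (H z + 1) * norm (1 - g z) = m * norm (1 + g z)"
    using m by (metis abs_of_nonneg norm_mult norm_of_real order_trans zero_le_one)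
  also have "\<dots> \<le> m * 2"
    using g norm_triangle_ineq[of 1 "g z"] m by (intro mult_left_mono) auto
  finally have A: "norm (H z + 1) * norm (1 - g z) \<le> 2 * m" by simp
  have B: "1 - norm z \<le> norm (1 - g z)"
    using g norm_triangle_ineq2[of 1 "g z"] by simp
  have "norm (H z + 1) * (1 - norm z) \<le> 2 * m"
    using mult_left_mono[OF B, of "norm (H z + 1)"] A by auto
  then have "norm (H z + 1) \<le> 2 * m / (1 - norm z)"
    using z by (simp add: field_simps)
  moreover have "norm (H z) \<le> norm (H z + 1) + 1"
    using norm_triangle_ineq4[of "H z + 1" 1] by simp
  ultimately show ?thesis by (simp add: m_def)
qed

lemma compact_subset_ball_radius:
  fixes K :: "complex set"
  assumes K: "compact K" "K \<subseteq> ball 0 1"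
  obtains \<rho> where "\<rho> < 1" "\<And>z. z \<in> K \<Longrightarrow> norm z \<le> \<rho>"
proof (cases "K = {}")
  case False
  then obtain x where "x \<in> K" "\<And>z. z \<in> K \<Longrightarrow> norm z \<le> norm x"
    using continuous_attains_sup[OF K(1) False, of norm] by (auto intro: continuous_intros)
  then show thesis using that[of "norm x"] K by auto
qed (use that[of 0] in auto)

text \<open>Compactness in the manner of Harnack: nonnegative real parts and bounded values at 0
  bound the functions on every compact set.\<close>

lemma Montel_Re_nonneg:
  fixes H :: "nat \<Rightarrow> complex \<Rightarrow> complex"
  assumes hol: "\<And>n. H n holomorphic_on ball 0 1"
    and pos: "\<And>n z. z \<in> ball 0 1 \<Longrightarrow> 0 \<le> Re (H n z)"
    and H0: "\<And>n. Im (H n 0) = 0" "\<And>n. Re (H n 0) \<le> m"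
  obtains G r where "G holomorphic_on ball 0 1" "strict_mono (r :: nat \<Rightarrow> nat)"
    "\<And>z. z \<in> ball 0 1 \<Longrightarrow> (\<lambda>n. H (r n) z) \<longlonglongrightarrow> G z"
proof (rule Montel[of "ball 0 1" "range H" H])
  fix K :: "complex set"
  assume K: "compact K" "K \<subseteq> ball 0 1"
  obtain \<rho> where \<rho>: "\<rho> < 1" "\<And>z. z \<in> K \<Longrightarrow> norm z \<le> \<rho>"
    using compact_subset_ball_radius[OF K] by metis
  show "\<exists>B. \<forall>h\<in>range H. \<forall>z\<in>K. norm (h z) \<le> B"
  proof (intro exI ballI)
    fix h z assume "h \<in> range H" "z \<in> K"
    then obtain n where n: "h = H n" by auto
    have m: "0 \<le> Re (H n 0)" using pos by simp
    have "norm (H n z) \<le> 2 * (Re (H n 0) + 1) / (1 - norm z) + 1"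
      using \<open>z \<in> K\<close> K by (intro norm_le_of_Re_nonneg hol pos H0) auto
    also have "\<dots> \<le> 2 * (m + 1) / (1 - \<rho>) + 1"
      using \<rho> \<open>z \<in> K\<close> H0(2)[of n] m by (intro add_right_mono frac_le) auto
    finally show "norm (h z) \<le> 2 * (m + 1) / (1 - \<rho>) + 1" by (simp add: n)
  qed
qed (use assms in auto)

text \<open>Induction on the degree: if \<open>F z = b + z * F1 z\<close> and \<open>\<bar>F1\<bar>\<^sup>2 \<le> Re H1\<close>, then on the unit disc
  \<open>\<bar>F\<bar>\<^sup>2 \<le> \<bar>b\<bar>\<^sup>2 + 2 Re (cnj b * z * F1) + \<bar>F1\<bar>\<^sup>2 \<le> Re (\<bar>b\<bar>\<^sup>2 + 2 * cnj b * z * F1 + H1)\<close>.\<close>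

lemma square_majorant_poly:
  "\<exists>H. H holomorphic_on UNIV \<and> H 0 = of_real (\<Sum>k<N. (norm (a k))\<^sup>2) \<and>
     (\<forall>z. norm z \<le> 1 \<longrightarrow> (norm (\<Sum>k<N. a k * z ^ k))\<^sup>2 \<le> Re (H z))"
proof (induction N arbitrary: a)
  case 0
  show ?case by (rule exI[of _ "\<lambda>_. 0"]) auto
next
  case (Suc N)
  define F where "F = (\<lambda>z. \<Sum>k<N. a (Suc k) * z ^ k)"
  obtain H where H: "H holomorphic_on UNIV" "H 0 = of_real (\<Sum>k<N. (norm (a (Suc k)))\<^sup>2)"
     "\<And>z. norm z \<le> 1 \<Longrightarrow> (norm (F z))\<^sup>2 \<le> Re (H z)"
    using Suc[of "\<lambda>k. a (Suc k)"] by (auto simp: F_def)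
  have F: "(\<Sum>k<Suc N. a k * z ^ k) = a 0 + z * F z" for z
    by (simp add: sum.lessThan_Suc_shift F_def sum_distrib_left algebra_simps del: sum.lessThan_Suc)
  define G where "G = (\<lambda>z. of_real ((norm (a 0))\<^sup>2) + 2 * cnj (a 0) * z * F z + H z)"
  show ?case
  proof (intro exI conjI allI impI)
    show "G holomorphic_on UNIV"
      unfolding G_def F_def by (intro holomorphic_intros H)
    show "G 0 = of_real (\<Sum>k<Suc N. (norm (a k))\<^sup>2)"
      by (simp add: G_def H(2) sum.lessThan_Suc_shift del: sum.lessThan_Suc)
    fix z :: complex assume z: "norm z \<le> 1"
    have "(norm (a 0 + z * F z))\<^sup>2 = (norm (a 0))\<^sup>2 + 2 * Re (cnj (a 0) * (z * F z)) + (norm (z * F z))\<^sup>2"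
      unfolding cmod_power2 by (simp add: power2_eq_square algebra_simps)
    also have "(norm (z * F z))\<^sup>2 \<le> (norm (F z))\<^sup>2"
      using z by (intro power_mono) (auto simp: norm_mult mult_left_le_one_le)
    also have "(norm (F z))\<^sup>2 \<le> Re (H z)" using H(3) z by blast
    finally show "(norm (\<Sum>k<Suc N. a k * z ^ k))\<^sup>2 \<le> Re (G z)"
      unfolding F G_def by (simp add: algebra_simps)
  qed
qed

text \<open>The polynomial majorants of the partial sums have values at 0 bounded by
  \<open>m\<close>, so a subsequence of them converges, and both the inequality and the value at 0
  pass to the limit.\<close>

lemma square_majorant_series:
  assumes F: "\<And>z. z \<in> ball 0 1 \<Longrightarrow> (\<lambda>k. a k * z ^ k) sums F z"
    and a: "\<And>N. (\<Sum>k<N. (norm (a k))\<^sup>2) \<le> m"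
  shows "majorized (ball 0 1) 0 (\<lambda>z. (norm (F z))\<^sup>2) m"
proof -
  have "\<exists>H. H holomorphic_on UNIV \<and> H 0 = of_real (\<Sum>k<N. (norm (a k))\<^sup>2) \<and>
     (\<forall>z. norm z \<le> 1 \<longrightarrow> (norm (\<Sum>k<N. a k * z ^ k))\<^sup>2 \<le> Re (H z))" for N
    by (rule square_majorant_poly)
  then obtain H where H: "\<And>N. H N holomorphic_on UNIV"
    "\<And>N. H N 0 = of_real (\<Sum>k<N. (norm (a k))\<^sup>2)"
    "\<And>N z. norm z \<le> 1 \<Longrightarrow> (norm (\<Sum>k<N. a k * z ^ k))\<^sup>2 \<le> Re (H N z)"
    by metis
  obtain G r where G: "G holomorphic_on ball 0 1" "strict_mono (r :: nat \<Rightarrow> nat)"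
    "\<And>z. z \<in> ball 0 1 \<Longrightarrow> (\<lambda>n. H (r n) z) \<longlonglongrightarrow> G z"
  proof (rule Montel_Re_nonneg[of H m])
    show "H n holomorphic_on ball 0 1" for n using H(1) holomorphic_on_subset by blast
    show "0 \<le> Re (H n z)" if "z \<in> ball 0 1" for n z
      using order_trans[OF zero_le_power2 H(3)[of z n]] that by simp
    show "Im (H n 0) = 0" "Re (H n 0) \<le> m" for n using H(2) a by auto
  qed auto
  show ?thesis
  proof (rule majorizedI[OF G(1)])
    fix z :: complex assume z: "z \<in> ball 0 1"
    have "(\<lambda>n. (norm (\<Sum>k<r n. a k * z ^ k))\<^sup>2) \<longlonglongrightarrow> (norm (F z))\<^sup>2"
      using LIMSEQ_subseq_LIMSEQ[OF F[OF z, unfolded sums_def] G(2)]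
      by (intro tendsto_intros) (simp add: o_def)
    moreover have "(\<lambda>n. Re (H (r n) z)) \<longlonglongrightarrow> Re (G z)"
      using G(3)[OF z] by (intro tendsto_intros)
    ultimately show "(norm (F z))\<^sup>2 \<le> Re (G z)"
      by (rule LIMSEQ_le) (use z H(3) in auto)
  next
    have "(\<lambda>n. Re (H (r n) 0)) \<longlonglongrightarrow> Re (G 0)"
      using G(3)[of 0] by (intro tendsto_intros) auto
    then show "Re (G 0) \<le> m"
      by (rule LIMSEQ_le_const2) (use H(2) a in auto)
  qed
qed

text \<open>On the circle, \<open>cnj w ^ n\<close> equals \<open>r ^ (2 * n) / w ^ n\<close>, so
  this is Cauchy's formula for the \<open>n\<close>-th derivative up to a constant factor.\<close>

lemma circle_mean_coeff:
  assumes F: "F holomorphic_on ball 0 R" and r: "0 < r" "r < R"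
  shows "((\<lambda>t. F (of_real r * cis t) * cnj (of_real r * cis t) ^ n) has_integral
           of_real (2 * pi) * ((deriv ^^ n) F 0 / fact n) * of_real (r ^ (2 * n))) {0..2 * pi}"
proof -
  have "cball 0 r \<subseteq> ball (0::complex) R" "ball 0 r \<subseteq> ball (0::complex) R" using r by auto
  then have "continuous_on (cball 0 r) F" "F holomorphic_on ball 0 r"
    using F holomorphic_on_subset holomorphic_on_imp_continuous_on by blast+
  then have "((\<lambda>u. F u / (u - 0) ^ (Suc n)) has_contour_integral
          ((2 * pi * \<i>) / (fact n) * (deriv ^^ n) F 0)) (circlepath 0 r)"
    by (rule Cauchy_has_contour_integral_higher_derivative_circlepath) (use r in auto)
  then have *: "((\<lambda>t. F (0 + r * cis t) / (0 + r * cis t - 0) ^ (Suc n) * r * \<i> * cis t) has_integral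
       ((2 * pi * \<i>) / (fact n) * (deriv ^^ n) F 0)) {0..2 * pi}"
    unfolding circlepath_def by (subst (asm) has_contour_integral_part_circlepath_iff) auto
  have eq: "F (0 + r * cis t) / (0 + r * cis t - 0) ^ (Suc n) * r * \<i> * cis t * (of_real (r ^ (2 * n)) / \<i>)
       = F (of_real r * cis t) * cnj (of_real r * cis t) ^ n" for t
  proof -
    have "(of_real r * cis t) ^ n * cnj (of_real r * cis t) ^ n = of_real (r ^ (2 * n))"
      unfolding power_mult_distrib [symmetric] complex_norm_square [symmetric]
      by (simp add: norm_mult power_mult)
    moreover have "(of_real r * cis t) ^ n \<noteq> 0" using r by simp
    ultimately show ?thesis using r by (simp add: field_simps)
  qed
  show ?thesis
    using has_integral_mult_left[OF *, of "of_real (r ^ (2 * n)) / \<i>"] unfolding eq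
    by (simp add: field_simps)
qed

lemma circle_mean_monomials:
  assumes r: "0 < r"
  shows "((\<lambda>t. (of_real r * cis t) ^ m * cnj (of_real r * cis t) ^ n) has_integral
           (if m = n then of_real (2 * pi * r ^ (2 * n)) else 0)) {0..2 * pi}"
proof -
  have "(deriv ^^ n) (\<lambda>w::complex. w ^ m) 0 / fact n = (if m = n then 1 else 0)"
  proof -
    have "(deriv ^^ n) (\<lambda>w::complex. w ^ m) 0 = pochhammer (of_nat (Suc m - n)) n * 0 ^ (m - n)"
      using higher_deriv_power[of n 0 m "0::complex"] by simp
    then show ?thesis
      by (cases "m < n"; cases "m = n")
         (auto simp: pochhammer_fact [symmetric] pochhammer_0_left power_0_left)
  qed
  moreover have "(\<lambda>w. w ^ m) holomorphic_on ball 0 (r + 1)"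
    by (intro holomorphic_intros)
  ultimately show ?thesis
    using circle_mean_coeff[of "\<lambda>w. w ^ m" "r + 1" r n] r by (auto split: if_splits)
qed

text \<open>Integrate \<open>0 \<le> (norm (F - S))\<^sup>2\<close> over the circle,
  \<open>S\<close> being the Taylor polynomial. Only \<open>F * cnj S\<close> and
  \<open>S * cnj S\<close> have to be integrated, both by finite sums, so no series is integrated.
  The bound is asked for on the circle only, because the zero-free function built later is
  comparable with the given one just there.\<close>

lemma Bessel_coeff_le:
  assumes F: "F holomorphic_on ball 0 R" and H: "H holomorphic_on ball 0 R" and r: "0 < r" "r < R"
    and le: "\<And>z. norm z = r \<Longrightarrow> (norm (F z))\<^sup>2 \<le> Re (H z)"
  shows "(\<Sum>n<N. (norm ((deriv ^^ n) F 0 / fact n * of_real r ^ n))\<^sup>2) \<le> Re (H 0)"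
proof -
  define a where "a = (\<lambda>n. (deriv ^^ n) F 0 / fact n)"
  define c where "c = (\<lambda>t. of_real r * cis t)"
  define S where "S = (\<lambda>z. \<Sum>n<N. a n * z ^ n)"
  define s where "s = (\<Sum>n<N. (norm (a n))\<^sup>2 * r ^ (2 * n))"
  have sc: "(\<Sum>n<N. cnj (a n) * (of_real (2 * pi) * a n * of_real (r ^ (2 * n)))) = of_real (2 * pi * s)"
  proof -
    have "(complex_of_real (cmod w))\<^sup>2 = w * cnj w" for w
      by (metis complex_norm_square of_real_power)
    then show ?thesis
      by (simp add: s_def sum_distrib_left mult_ac)
  qed
  have FS: "((\<lambda>t. F (c t) * cnj (S (c t))) has_integral of_real (2 * pi * s)) {0..2 * pi}"
  proof -
    have "((\<lambda>t. \<Sum>n<N. cnj (a n) * (F (c t) * cnj (c t) ^ n)) has_integral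
       (\<Sum>n<N. cnj (a n) * (of_real (2 * pi) * a n * of_real (r ^ (2 * n))))) {0..2 * pi}"
      unfolding a_def c_def
      by (intro has_integral_sum has_integral_mult_right circle_mean_coeff[OF F r]) auto
    then show ?thesis unfolding sc S_def by (simp add: sum_distrib_left mult_ac)
  qed
  have SS: "((\<lambda>t. S (c t) * cnj (S (c t))) has_integral of_real (2 * pi * s)) {0..2 * pi}"
  proof -
    have "((\<lambda>t. \<Sum>n<N. cnj (a n) * (\<Sum>m<N. a m * (c t ^ m * cnj (c t) ^ n))) has_integral
       (\<Sum>n<N. cnj (a n) * (\<Sum>m<N. a m * (if m = n then of_real (2 * pi * r ^ (2 * n)) else 0)))) {0..2 * pi}"
      unfolding c_def
      by (intro has_integral_sum has_integral_mult_right circle_mean_monomials[OF r(1)]) auto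
    also have "(\<Sum>n<N. cnj (a n) * (\<Sum>m<N. a m * (if m = n then of_real (2 * pi * r ^ (2 * n)) else 0)))
      = of_real (2 * pi * s)"
      unfolding sc [symmetric]
      by (intro sum.cong refl) (auto simp: if_distrib sum.delta' mult_ac cong: if_cong)
    finally show ?thesis unfolding S_def
      by (simp add: sum_distrib_left sum_distrib_right mult_ac)
  qed
  have HH: "((\<lambda>t. Re (H (c t))) has_integral 2 * pi * Re (H 0)) {0..2 * pi}"
    using has_integral_Re[OF circle_mean_coeff[OF H r, of 0]] by (simp add: c_def)
  have "((\<lambda>t. 2 * Re (F (c t) * cnj (S (c t))) - Re (S (c t) * cnj (S (c t)))) has_integral
       2 * (2 * pi * s) - 2 * pi * s) {0..2 * pi}"
    using has_integral_Re[OF FS] has_integral_Re[OF SS]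
    by (intro has_integral_diff has_integral_mult_right) auto
  then have "2 * (2 * pi * s) - 2 * pi * s \<le> 2 * pi * Re (H 0)"
  proof (rule has_integral_le[OF _ HH])
    fix t
    have "0 \<le> (norm (F (c t) - S (c t)))\<^sup>2" by simp
    also have "\<dots> = (norm (F (c t)))\<^sup>2 - (2 * Re (F (c t) * cnj (S (c t))) - Re (S (c t) * cnj (S (c t))))"
      unfolding cmod_power2 by (simp add: power2_eq_square algebra_simps)
    also have "(norm (F (c t)))\<^sup>2 \<le> Re (H (c t))"
      by (rule le) (use r in \<open>simp add: c_def norm_mult\<close>)
    finally show "2 * Re (F (c t) * cnj (S (c t))) - Re (S (c t) * cnj (S (c t))) \<le> Re (H (c t))" by simp
  qed
  then have "s \<le> Re (H 0)" by (simp add: algebra_simps)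
  also have "s = (\<Sum>n<N. (norm (a n * of_real r ^ n))\<^sup>2)"
    unfolding s_def using r by (intro sum.cong) (auto simp: norm_mult norm_power power_mult_distrib power_mult [symmetric] mult.commute)
  finally show ?thesis by (simp add: a_def)
qed

text \<open>Bessel's inequality with the radius tending to 1. Together with
  \<open>square_majorant_series\<close> it makes majorization with value \<open>m\<close> equivalent
  to the bound \<open>m\<close> on all partial sums of squared coefficients.\<close>

lemma square_majorized_imp_coeff_le:
  assumes F: "F holomorphic_on ball 0 1" and m: "majorized (ball 0 1) 0 (\<lambda>z. (norm (F z))\<^sup>2) m"
  shows "(\<Sum>n<N. (norm ((deriv ^^ n) F 0 / fact n))\<^sup>2) \<le> m"
proof -
  obtain H where H: "H holomorphic_on ball 0 1" "\<And>z. z \<in> ball 0 1 \<Longrightarrow> (norm (F z))\<^sup>2 \<le> Re (H z)" "Re (H 0) \<le> m"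
    using m by (auto simp: majorized_def)
  have ev: "eventually (\<lambda>r. (\<Sum>n<N. (norm ((deriv ^^ n) F 0 / fact n * of_real r ^ n))\<^sup>2) \<le> m) (at_left (1::real))"
  proof -
    have "eventually (\<lambda>r. r \<in> {0<..<1}) (at_left (1::real))"
      by (rule eventually_at_leftI[of 0]) auto
    then show ?thesis
    proof eventually_elim
      case (elim r)
      then show ?case
        using Bessel_coeff_le[OF F H(1), of r N] H by auto
    qed
  qed
  have "((\<lambda>r. (\<Sum>n<N. (norm ((deriv ^^ n) F 0 / fact n * of_real r ^ n))\<^sup>2)) \<longlongrightarrow>
      (\<Sum>n<N. (norm ((deriv ^^ n) F 0 / fact n * of_real 1 ^ n))\<^sup>2)) (at_left 1)"
    by (intro tendsto_intros)
  then show ?thesis using tendsto_upperbound[OF _ ev] by simp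
qed

text \<open>The difference has coefficients \<open>a n * (1 - R ^ n)\<close>: the tail beyond
  \<open>K\<close> is small whatever \<open>R\<close> is, and the first \<open>K\<close> terms are
  small once \<open>R\<close> is close to 1.\<close>

lemma square_majorized_dilation:
  assumes F: "F holomorphic_on ball 0 1" and m: "majorized (ball 0 1) 0 (\<lambda>z. (norm (F z))\<^sup>2) m"
    and \<delta>: "\<delta> > 0"
  obtains R where "0 < R" "R < 1"
    "majorized (ball 0 1) 0 (\<lambda>z. (norm (F z - F (of_real R * z)))\<^sup>2) \<delta>"
proof -
  define a where "a = (\<lambda>n. (deriv ^^ n) F 0 / fact n)"
  have a: "(\<Sum>n<N. (norm (a n))\<^sup>2) \<le> m" for N
    using square_majorized_imp_coeff_le[OF F m] by (simp add: a_def)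
  have F_sums: "(\<lambda>n. a n * z ^ n) sums F z" if "z \<in> ball 0 1" for z
    using holomorphic_power_series[OF F that] by (simp add: a_def)
  have m0: "0 \<le> m" using a[of 0] by simp
  have summ: "summable (\<lambda>n. (norm (a n))\<^sup>2)"
    by (rule bounded_imp_summable[where B = m])
       (use a in \<open>auto simp: lessThan_Suc_atMost [symmetric] simp del: sum.lessThan_Suc\<close>)
  obtain K where K: "\<And>M N. K \<le> M \<Longrightarrow> norm (\<Sum>n=M..<N. (norm (a n))\<^sup>2) < \<delta> / 2"
    using summ[unfolded summable_Cauchy] \<delta> by (meson half_gt_zero)
  have "((\<lambda>R::real. m * (1 - R ^ K)) \<longlongrightarrow> m * (1 - 1 ^ K)) (at_left 1)"
    by (intro tendsto_intros)
  then have "eventually (\<lambda>R::real. m * (1 - R ^ K) < \<delta> / 2) (at_left 1)"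
    using \<delta> by (intro order_tendstoD(2)) auto
  moreover have "eventually (\<lambda>r. r \<in> {0<..<1}) (at_left (1::real))"
    by (rule eventually_at_leftI[of 0]) auto
  ultimately have "eventually (\<lambda>R::real. m * (1 - R ^ K) < \<delta> / 2 \<and> R \<in> {0<..<1}) (at_left 1)"
    by (rule eventually_conj)
  then obtain R :: real where R: "m * (1 - R ^ K) < \<delta> / 2" "0 < R" "R < 1"
    using eventually_happens[of _ "at_left (1::real)"] by auto
  define b where "b = (\<lambda>n. a n * (1 - of_real R ^ n))"
  have b1: "(norm (b n))\<^sup>2 \<le> (norm (a n))\<^sup>2 * (1 - R ^ n)" for n
  proof -
    have "norm (1 - complex_of_real R ^ n) = 1 - R ^ n"
      using R by (metis abs_of_nonneg diff_ge_0_iff_ge less_eq_real_def norm_of_real of_real_1 of_real_diff of_real_power power_le_one)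
    moreover have "(1 - R ^ n)\<^sup>2 \<le> 1 - R ^ n"
      using R by (simp add: power2_eq_square mult_left_le_one_le power_le_one)
    ultimately show ?thesis
      by (simp add: b_def norm_mult power_mult_distrib mult_left_mono)
  qed
  have b: "(\<Sum>n<N. (norm (b n))\<^sup>2) \<le> \<delta>" for N
  proof -
    have "(norm (b n))\<^sup>2 \<le> (if n < K then (norm (a n))\<^sup>2 * (1 - R ^ K) else (norm (a n))\<^sup>2)" for n
    proof (cases "n < K")
      case True
      then have "1 - R ^ n \<le> 1 - R ^ K" using R by (simp add: power_decreasing)
      then show ?thesis using True b1[of n] by (simp add: mult_left_mono order_trans)
    next
      case False
      then show ?thesis using b1[of n] R
        by (smt (verit) mult_left_le power_le_one zero_le_power zero_le_power2)
    qed
    then have "(\<Sum>n<N. (norm (b n))\<^sup>2) \<le> (\<Sum>n<N. if n < K then (norm (a n))\<^sup>2 * (1 - R ^ K) else (norm (a n))\<^sup>2)"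
      by (intro sum_mono)
    \<comment> \<open>Enlarging the range to \<open>K + N\<close> permits the split at
      \<open>K\<close> without comparing \<open>N\<close> with \<open>K\<close>.\<close>
    also have "\<dots> \<le> (\<Sum>n<K+N. if n < K then (norm (a n))\<^sup>2 * (1 - R ^ K) else (norm (a n))\<^sup>2)"
      by (intro sum_mono2) (use R in \<open>auto simp: power_le_one\<close>)
    also have "\<dots> = (\<Sum>n<K. (norm (a n))\<^sup>2 * (1 - R ^ K)) + (\<Sum>n=K..<K+N. (norm (a n))\<^sup>2)"
    proof -
      have "(\<Sum>n<K+N. h n) = (\<Sum>n<K. h n) + (\<Sum>n=K..<K+N. h n)" for h :: "nat \<Rightarrow> real"
        using sum.atLeastLessThan_concat[of 0 K "K+N" h] by (simp add: lessThan_atLeast0)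
      then show ?thesis by simp
    qed
    also have "\<dots> \<le> m * (1 - R ^ K) + \<delta> / 2"
      unfolding sum_distrib_right [symmetric]
      using a[of K] K[of K "K+N"] R
      by (intro add_mono mult_right_mono) (auto simp: power_le_one)
    finally show ?thesis using R by simp
  qed
  show thesis
  proof (rule that[OF R(2,3)], rule square_majorant_series[OF _ b])
    fix z :: complex assume z: "z \<in> ball 0 1"
    have z': "of_real R * z \<in> ball 0 1"
      using z R mult_left_le_one_le[of "norm z" R] by (simp add: norm_mult)
    show "(\<lambda>n. b n * z ^ n) sums (F z - F (of_real R * z))"
      using sums_diff[OF F_sums[OF z] F_sums[OF z']]
      by (simp add: b_def algebra_simps power_mult_distrib)
  qed
qed

section \<open>Domination by the square of a function without zeros\<close>

text \<open>The right-hand side vanishes for \<open>norm z = r\<close>, so the Blaschke factor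
  \<open>r * (z - a) / (r\<^sup>2 - cnj a * z)\<close> has modulus 1 on that circle. For points
  inside, the same identity measures how far its modulus stays below 1.\<close>

lemma Blaschke_identity:
  fixes a z :: complex and r :: real
  shows "(norm (of_real (r\<^sup>2) - cnj a * z))\<^sup>2 - r\<^sup>2 * (norm (z - a))\<^sup>2
    = (r\<^sup>2 - (norm a)\<^sup>2) * (r\<^sup>2 - (norm z)\<^sup>2)"
  unfolding cmod_power2 by (simp add: power2_eq_square algebra_simps)

text \<open>Dividing \<open>f\<close> by a Blaschke factor of the disc of radius \<open>r\<close> keeps the bound \<open>M\<close> on the circle and
  multiplies \<open>\<bar>f w\<bar>\<^sup>2\<close> by at least \<open>1 / \<kappa>\<close>. By the maximum principle this can happen at most \<open>n\<close> times,
  which makes the induction terminate without any reference to multiplicities of zeros.\<close>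

lemma divide_out_zeros:
  assumes r0: "0 < r0" "r0 < r" "r < R" "R * r0 \<le> r\<^sup>2"
    and \<kappa>: "\<kappa> = 1 - (r\<^sup>2 - r0\<^sup>2)\<^sup>2 / (r\<^sup>2 + r0\<^sup>2)\<^sup>2"
    and w: "norm w \<le> r0"
  shows "\<lbrakk>f holomorphic_on ball 0 R; \<And>z. norm z < R \<Longrightarrow> f z = 0 \<Longrightarrow> norm z \<le> r0;
     \<And>z. norm z = r \<Longrightarrow> norm (f z) \<le> M; (norm (f w))\<^sup>2 > M\<^sup>2 * \<kappa> ^ n\<rbrakk> \<Longrightarrow>
     \<exists>g. g holomorphic_on ball 0 R \<and> (\<forall>z\<in>ball 0 R. g z \<noteq> 0) \<and>
       (\<forall>z. norm z = r \<longrightarrow> norm (g z) = norm (f z)) \<and>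
       (\<forall>z. norm z \<le> r \<longrightarrow> norm (f z) \<le> norm (g z))"
proof (induction n arbitrary: f)
  case 0
  \<comment> \<open>The maximum principle contradicts the strict inequality assumed for
    \<open>n = 0\<close>.\<close>
  have "norm (f w) \<le> M"
  proof (rule maximum_modulus_frontier[of f "ball 0 r"])
    have "cball 0 r \<subseteq> ball (0::complex) R" using r0 by auto
    then show "f holomorphic_on interior (ball 0 r)" "continuous_on (closure (ball 0 r)) f"
      using 0(1) r0 holomorphic_on_subset[OF 0(1)] holomorphic_on_imp_continuous_on
      by (auto simp: subset_eq closure_ball)
    show "norm (f z) \<le> M" if "z \<in> frontier (ball 0 r)" for z
      using that 0(3) r0 by (auto simp: frontier_ball)
  qed (use w r0 in auto)
  then have "(norm (f w))\<^sup>2 \<le> M\<^sup>2" by (intro power_mono) auto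
  then show ?case using 0 by simp
next
  case (Suc n)
  show ?case
  proof (cases "\<exists>a. norm a < R \<and> f a = 0")
    case False
    then show ?thesis using Suc by (intro exI[of _ f]) auto
  next
    case True
    then obtain a where a: "norm a < R" "f a = 0" by blast
    then have ar: "norm a \<le> r0" using Suc by blast
    define k where "k = (\<lambda>z. if z = a then deriv f a else (f z - f a) / (z - a))"
    have k: "k holomorphic_on ball 0 R"
      unfolding k_def by (rule pole_lemma_open[OF Suc.prems(1)]) auto
    have fk: "f z = (z - a) * k z" for z using a by (simp add: k_def)
    \<comment> \<open>This is \<open>f\<close> divided by the Blaschke factor of \<open>a\<close>,
      written through the quotient \<open>k\<close> so that it is holomorphic at \<open>a\<close> as
      well.\<close>
    define g where "g = (\<lambda>z. k z * ((of_real (r\<^sup>2) - cnj a * z) / of_real r))"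
    have g: "g holomorphic_on ball 0 R"
      unfolding g_def by (intro holomorphic_intros k) (use r0 in auto)
    have id: "r\<^sup>2 * (norm (z - a))\<^sup>2 \<le> (norm (of_real (r\<^sup>2) - cnj a * z))\<^sup>2" if "norm z \<le> r" for z
    proof -
      have "(r\<^sup>2 - (norm a)\<^sup>2) * (r\<^sup>2 - (norm z)\<^sup>2) \<ge> 0"
        using that ar r0 by (intro mult_nonneg_nonneg) (auto intro!: power_mono)
      then show ?thesis using Blaschke_identity[of r a z] by simp
    qed
    have fg: "(norm (f z))\<^sup>2 * (norm (of_real (r\<^sup>2) - cnj a * z))\<^sup>2 = (norm (g z))\<^sup>2 * (r\<^sup>2 * (norm (z - a))\<^sup>2)" for z
      using r0 unfolding g_def fk
      by (simp add: norm_mult norm_divide power_mult_distrib power_divide)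
    \<comment> \<open>The condition \<open>R * r0 \<le> r\<^sup>2\<close> puts the zero of this
      factor, the reflection of \<open>a\<close> in the circle, outside the disc of radius
      \<open>R\<close>; so \<open>g\<close> acquires no new zero there.\<close>
    have ne: "of_real (r\<^sup>2) - cnj a * z \<noteq> 0" if "norm z < R" for z
    proof -
      have "norm (cnj a * z) \<le> r0 * norm z"
        using ar by (simp add: norm_mult mult_right_mono)
      also have "\<dots> < r0 * R" using that r0 by simp
      also have "\<dots> \<le> r\<^sup>2" using r0 by (simp add: mult.commute)
      also have "r\<^sup>2 = norm (complex_of_real (r\<^sup>2))" by (simp add: norm_power)
      finally show ?thesis by (metis eq_iff_diff_eq_0 less_irrefl)
    qed
    have le: "norm (f z) \<le> norm (g z)" if "norm z \<le> r" for z
    proof -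
      have "(norm (f z))\<^sup>2 * (norm (of_real (r\<^sup>2) - cnj a * z))\<^sup>2
          \<le> (norm (g z))\<^sup>2 * (norm (of_real (r\<^sup>2) - cnj a * z))\<^sup>2"
        unfolding fg by (intro mult_left_mono id that) auto
      moreover have "(norm (of_real (r\<^sup>2) - cnj a * z))\<^sup>2 > 0"
        using ne[of z] that r0 by simp
      ultimately have "(norm (f z))\<^sup>2 \<le> (norm (g z))\<^sup>2" by (rule mult_right_le_imp_le)
      then show ?thesis by (rule power2_le_imp_le) auto
    qed
    have eq: "norm (g z) = norm (f z)" if "norm z = r" for z
    proof -
      have A: "r\<^sup>2 * (norm (z - a))\<^sup>2 = (norm (of_real (r\<^sup>2) - cnj a * z))\<^sup>2"
        using Blaschke_identity[of r a z] that by simp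
      have "norm (of_real (r\<^sup>2) - cnj a * z) \<noteq> 0"
        using ne[of z] that r0 by simp
      then have "(norm (g z))\<^sup>2 = (norm (f z))\<^sup>2"
        using fg[of z] unfolding A by simp
      then show ?thesis by (rule power2_eq_imp_eq) auto
    qed
    \<comment> \<open>Since \<open>a\<close> and \<open>w\<close> both have modulus at most
      \<open>r0\<close>, the constant \<open>\<kappa>\<close> bounds the squared modulus of the
      Blaschke factor at \<open>w\<close>.\<close>
    have \<kappa>g: "(norm (f w))\<^sup>2 \<le> \<kappa> * (norm (g w))\<^sup>2"
    proof -
      define D where "D = (norm (of_real (r\<^sup>2) - cnj a * w))\<^sup>2"
      have D0: "D > 0" using ne[of w] w r0 by (simp add: D_def)
      have rr: "r0\<^sup>2 < r\<^sup>2" using r0 by (intro power_strict_mono) auto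
      have "norm (of_real (r\<^sup>2) - cnj a * w) \<le> r\<^sup>2 + norm a * norm w"
        using norm_triangle_ineq4[of "of_real (r\<^sup>2)" "cnj a * w"] by (simp add: norm_mult norm_power)
      also have "\<dots> \<le> r\<^sup>2 + r0\<^sup>2"
        unfolding power2_eq_square[of r0] using ar w r0 by (intro add_left_mono mult_mono) auto
      finally have D1: "D \<le> (r\<^sup>2 + r0\<^sup>2)\<^sup>2"
        unfolding D_def by (intro power_mono) auto
      have "(r\<^sup>2 - r0\<^sup>2)\<^sup>2 \<le> (r\<^sup>2 - (norm a)\<^sup>2) * (r\<^sup>2 - (norm w)\<^sup>2)"
        unfolding power2_eq_square[of "r\<^sup>2 - r0\<^sup>2"]
        using ar w r0 rr by (intro mult_mono diff_left_mono power_mono) (auto intro!: power_mono)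
      then have "r\<^sup>2 * (norm (w - a))\<^sup>2 \<le> D - (r\<^sup>2 - r0\<^sup>2)\<^sup>2"
        using Blaschke_identity[of r a w] by (simp add: D_def)
      also have "\<dots> \<le> D - (r\<^sup>2 - r0\<^sup>2)\<^sup>2 * (D / (r\<^sup>2 + r0\<^sup>2)\<^sup>2)"
        using D1 r0 by (intro diff_left_mono mult_left_le) (auto simp: divide_le_eq)
      also have "\<dots> = \<kappa> * D" by (simp add: \<kappa> algebra_simps)
      finally have "(norm (f w))\<^sup>2 * D \<le> (norm (g w))\<^sup>2 * (\<kappa> * D)"
        unfolding D_def fg by (intro mult_left_mono) auto
      then show ?thesis using D0 by (simp add: mult.commute mult.left_commute)
    qed
    have \<kappa>0: "\<kappa> > 0"
    proof -
      have rr: "r0\<^sup>2 < r\<^sup>2" "0 < r0\<^sup>2" using r0 by (auto intro: power_strict_mono)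
      have "(r\<^sup>2 - r0\<^sup>2)\<^sup>2 < (r\<^sup>2 + r0\<^sup>2)\<^sup>2"
        using rr by (intro power_strict_mono) auto
      then show ?thesis using rr by (simp add: \<kappa> divide_less_eq_1)
    qed
    have "\<exists>h. h holomorphic_on ball 0 R \<and> (\<forall>z\<in>ball 0 R. h z \<noteq> 0) \<and>
       (\<forall>z. norm z = r \<longrightarrow> norm (h z) = norm (g z)) \<and>
       (\<forall>z. norm z \<le> r \<longrightarrow> norm (g z) \<le> norm (h z))"
    proof (rule Suc.IH[OF g])
      show "norm z \<le> r0" if "norm z < R" "g z = 0" for z
      proof -
        have "k z = 0" using that ne[of z] r0 by (auto simp: g_def)
        then show ?thesis using Suc.prems(2) fk that by auto
      qed
      show "norm (g z) \<le> M" if "norm z = r" for z using eq Suc.prems(3) that by simp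
      have "M\<^sup>2 * \<kappa> ^ n * \<kappa> < \<kappa> * (norm (g w))\<^sup>2"
        using Suc.prems(4) \<kappa>g by (simp add: mult_ac)
      then show "M\<^sup>2 * \<kappa> ^ n < (norm (g w))\<^sup>2" using \<kappa>0 by (simp add: mult.commute)
    qed
    then show ?thesis using eq le by (metis order_trans)
  qed
qed

text \<open>Once the zeros are divided out, the quotient \<open>g\<close> is an exponential and has
  a holomorphic power \<open>E\<close> of exponent \<open>p / 2\<close>. On the circle of radius
  \<open>r\<close> the squared modulus of \<open>E\<close> equals \<open>norm (f z) powr p\<close>,
  hence lies below \<open>Re (H z)\<close>, and Bessel's inequality on this circle controls the
  coefficients of \<open>E\<close>.\<close>

lemma power_dominated_by_square_dilated:
  assumes f: "f holomorphic_on ball 0 1" and p: "p > 0"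
    and m: "majorized (ball 0 1) 0 (\<lambda>z. norm (f z) powr p) m"
    and nz: "z0 \<in> ball 0 1" "f z0 \<noteq> 0" and s: "s < 1"
  obtains r G where "s < r" "r < 1" "G holomorphic_on ball 0 1"
    "\<And>z. z \<in> ball 0 1 \<Longrightarrow> norm (f (of_real r * z)) powr p \<le> (norm (G z))\<^sup>2"
    "majorized (ball 0 1) 0 (\<lambda>z. (norm (G z))\<^sup>2) m"
proof -
  obtain H where H: "H holomorphic_on ball 0 1" "\<And>z. z \<in> ball 0 1 \<Longrightarrow> norm (f z) powr p \<le> Re (H z)" "Re (H 0) \<le> m"
    using m by (auto simp: majorized_def)
  define r0 where "r0 = max (max s (norm z0)) (1/2)"
  have r0: "s \<le> r0" "norm z0 \<le> r0" "0 < r0" "r0 < 1" using s nz by (auto simp: r0_def)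
  define q where "q = (1 + r0) / 2"
  have q: "r0 < q" "q < 1" using r0 by (auto simp: q_def)
  have "\<not> f constant_on ball 0 1 \<or> (\<forall>z\<in>ball 0 1. f z \<noteq> 0)"
    using nz unfolding constant_on_def by metis
  then have fin: "finite {z \<in> cball 0 q. f z = 0}"
  proof
    assume "\<not> f constant_on ball 0 1"
    then show ?thesis
      by (intro holomorphic_compact_finite_zeros[OF f]) (use q in auto)
  next
    assume *: "\<forall>z\<in>ball 0 1. f z \<noteq> 0"
    have "{z \<in> cball 0 q. f z = 0} = {}" using * q by auto
    then show ?thesis by (metis finite.emptyI)
  qed
  \<comment> \<open>Finitely many zeros lie in \<open>cball 0 q\<close>, so there is a gap beyond
    \<open>r0\<close>: with the minimum \<open>R\<close> of this set, no zero has modulus strictly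
    between \<open>r0\<close> and \<open>R\<close>.\<close>
  define X where "X = insert q (norm ` {z \<in> cball 0 q. f z = 0 \<and> r0 < norm z})"
  have X: "finite X" "X \<noteq> {}" unfolding X_def by (auto intro!: finite_imageI finite_subset[OF _ fin])
  define R where "R = Min X"
  have R: "r0 < R" "R \<le> q" using X q by (auto simp: R_def X_def)
  have zeros: "norm z \<le> r0" if "norm z < R" "f z = 0" for z
  proof (rule ccontr)
    assume "\<not> norm z \<le> r0"
    then have "norm z \<in> X" using that R by (auto simp: X_def)
    then show False using that X by (auto simp: R_def)
  qed
  \<comment> \<open>The geometric mean meets the condition \<open>R * r0 \<le> r\<^sup>2\<close> of
    \<open>divide_out_zeros\<close> with equality.\<close>
  define r where "r = sqrt (R * r0)"
  have r2: "r\<^sup>2 = R * r0" using R r0 by (simp add: r_def)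
  have r: "r0 < r" "r < R"
    unfolding r_def using R r0
    by (auto intro!: real_less_rsqrt real_less_lsqrt simp: power2_eq_square)
  have fR: "f holomorphic_on ball 0 R" "H holomorphic_on ball 0 R"
    using f H(1) R q by (auto intro: holomorphic_on_subset)
  define \<kappa> where "\<kappa> = 1 - (r\<^sup>2 - r0\<^sup>2)\<^sup>2 / (r\<^sup>2 + r0\<^sup>2)\<^sup>2"
  have "compact (sphere (0::complex) r)" "continuous_on (sphere 0 r) f"
    using holomorphic_on_imp_continuous_on[OF f] r R q by (auto intro: continuous_on_subset)
  then have "bounded (f ` sphere 0 r)" by (intro compact_imp_bounded compact_continuous_image)
  then obtain M where M: "\<And>z. norm z = r \<Longrightarrow> norm (f z) \<le> M" by (fastforce simp: bounded_iff)
  have rr: "r0\<^sup>2 < r\<^sup>2" using r r0 by (intro power_strict_mono) auto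
  have "\<kappa> < 1" "0 \<le> \<kappa>"
    using rr r0 by (auto simp: \<kappa>_def divide_le_eq_1 intro!: power_mono add_pos_pos)
  then have "(\<lambda>n. M\<^sup>2 * \<kappa> ^ n) \<longlonglongrightarrow> M\<^sup>2 * 0"
    by (intro tendsto_intros LIMSEQ_realpow_zero)
  \<comment> \<open>As \<open>f z0\<close> is nonzero, some number \<open>n\<close> of divisions
    exceeds what the maximum principle allows; \<open>z0\<close> is the point \<open>w\<close> of
    \<open>divide_out_zeros\<close>.\<close>
  then have "eventually (\<lambda>n. M\<^sup>2 * \<kappa> ^ n < (norm (f z0))\<^sup>2) sequentially"
    using nz by (intro order_tendstoD(2)) auto
  then obtain n where n: "M\<^sup>2 * \<kappa> ^ n < (norm (f z0))\<^sup>2"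
    by (auto simp: eventually_sequentially)
  obtain g where g: "g holomorphic_on ball 0 R" "\<And>z. z \<in> ball 0 R \<Longrightarrow> g z \<noteq> 0"
    "\<And>z. norm z = r \<Longrightarrow> norm (g z) = norm (f z)" "\<And>z. norm z \<le> r \<Longrightarrow> norm (f z) \<le> norm (g z)"
    using divide_out_zeros[of r0 r R \<kappa> z0 f M n] r0 r r2 \<kappa>_def fR zeros M n by auto
  obtain k where k: "k holomorphic_on ball 0 R" "\<And>z. z \<in> ball 0 R \<Longrightarrow> g z = exp (k z)"
    using contractible_imp_holomorphic_log[OF g(1) convex_imp_contractible[OF convex_ball] g(2)] by metis
  define E where "E = (\<lambda>z. exp (of_real (p / 2) * k z))"
  have E: "E holomorphic_on ball 0 R" unfolding E_def by (intro holomorphic_intros k)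
  have Eg: "(norm (E z))\<^sup>2 = norm (g z) powr p" if "z \<in> ball 0 R" for z
    using k(2)[OF that] by (simp add: E_def powr_def exp_double [symmetric])
  define a where "a = (\<lambda>n. (deriv ^^ n) E 0 / fact n * of_real r ^ n)"
  have a: "(\<Sum>n<N. (norm (a n))\<^sup>2) \<le> m" for N
  proof -
    have "(\<Sum>n<N. (norm (a n))\<^sup>2) \<le> Re (H 0)"
      unfolding a_def
    proof (rule Bessel_coeff_le[OF E fR(2)])
      show "(norm (E z))\<^sup>2 \<le> Re (H z)" if "norm z = r" for z
        using Eg[of z] g(3)[of z] H(2)[of z] that r R q by auto
    qed (use r r0 in auto)
    then show ?thesis using H by simp
  qed
  have dil: "of_real r * z \<in> ball 0 R" "norm (of_real r * z) \<le> r" if "z \<in> ball 0 1" for z :: complex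
  proof -
    have "norm (of_real r * z) \<le> r" using that r r0 by (simp add: norm_mult mult_left_le)
    then show "of_real r * z \<in> ball 0 R" "norm (of_real r * z) \<le> r" using r by auto
  qed
  show thesis
  proof (rule that[of r "\<lambda>z. E (of_real r * z)"])
    show "(\<lambda>z. E (of_real r * z)) holomorphic_on ball 0 1"
      using holomorphic_on_compose_gen[OF _ E, of "\<lambda>z. of_real r * z" "ball 0 1"]
        image_subsetI[of "ball 0 1" "\<lambda>z. of_real r * z", OF dil(1)]
      by (auto simp: o_def intro!: holomorphic_intros)
    show "norm (f (of_real r * z)) powr p \<le> (norm (E (of_real r * z)))\<^sup>2" if "z \<in> ball 0 1" for z
      unfolding Eg[OF dil(1)[OF that]] using g(4) dil[OF that] p by (intro powr_mono2) auto
    show "majorized (ball 0 1) 0 (\<lambda>z. (norm (E (of_real r * z)))\<^sup>2) m"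
    proof (rule square_majorant_series[OF _ a])
      show "(\<lambda>n. a n * z ^ n) sums E (of_real r * z)" if "z \<in> ball 0 1" for z
        using holomorphic_power_series[OF E dil(1)[OF that]]
        by (simp add: a_def power_mult_distrib mult_ac)
    qed
  qed (use r r0 R q in auto)
qed

text \<open>The functions and their majorants are both locally bounded, so nested subsequences
  converge and the inequality survives with the same \<open>m\<close>.\<close>

lemma square_majorized_normal:
  fixes F :: "nat \<Rightarrow> complex \<Rightarrow> complex"
  assumes F: "\<And>n. F n holomorphic_on ball 0 1"
    and m: "\<And>n. majorized (ball 0 1) 0 (\<lambda>z. (norm (F n z))\<^sup>2) m"
  obtains G r where "G holomorphic_on ball 0 1" "strict_mono (r :: nat \<Rightarrow> nat)"
    "\<And>z. z \<in> ball 0 1 \<Longrightarrow> (\<lambda>n. F (r n) z) \<longlonglongrightarrow> G z"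
    "majorized (ball 0 1) 0 (\<lambda>z. (norm (G z))\<^sup>2) m"
proof -
  have "\<exists>H. H holomorphic_on ball 0 1 \<and> (\<forall>z\<in>ball 0 1. (norm (F n z))\<^sup>2 \<le> Re (H z)) \<and>
      Re (H 0) \<le> m \<and> Im (H 0) = 0" for n
    by (rule majorizedE[OF m[of n]]) blast
  then obtain H where H: "\<And>n. H n holomorphic_on ball 0 1"
    "\<And>n z. z \<in> ball 0 1 \<Longrightarrow> (norm (F n z))\<^sup>2 \<le> Re (H n z)" "\<And>n. Re (H n 0) \<le> m" "\<And>n. Im (H n 0) = 0"
    by metis
  have pos: "0 \<le> Re (H n z)" if "z \<in> ball 0 1" for n z
    using order_trans[OF zero_le_power2 H(2)[OF that]] .
  have m0: "0 \<le> m" using pos[of 0 0] H(3)[of 0] by simp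
  obtain K r where K: "K holomorphic_on ball 0 1" "strict_mono (r :: nat \<Rightarrow> nat)"
    "\<And>z. z \<in> ball 0 1 \<Longrightarrow> (\<lambda>n. H (r n) z) \<longlonglongrightarrow> K z"
    by (rule Montel_Re_nonneg[of H m]) (use H pos in auto)
  obtain G t where G: "G holomorphic_on ball 0 1" "strict_mono (t :: nat \<Rightarrow> nat)"
    "\<And>z. z \<in> ball 0 1 \<Longrightarrow> (\<lambda>n. F (r (t n)) z) \<longlonglongrightarrow> G z"
  proof (rule Montel[of "ball 0 1" "range F" "\<lambda>n. F (r n)"])
    fix C :: "complex set"
    assume C: "compact C" "C \<subseteq> ball 0 1"
    obtain \<rho> where \<rho>: "\<rho> < 1" "\<And>z. z \<in> C \<Longrightarrow> norm z \<le> \<rho>"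
      using compact_subset_ball_radius[OF C] by metis
    show "\<exists>B. \<forall>h\<in>range F. \<forall>z\<in>C. norm (h z) \<le> B"
    proof (intro exI ballI)
      fix h z assume "h \<in> range F" "z \<in> C"
      then obtain n where n: "h = F n" by auto
      have z: "z \<in> ball 0 1" using C \<open>z \<in> C\<close> by auto
      have "(norm (F n z))\<^sup>2 \<le> norm (H n z)"
        using H(2)[OF z, of n] complex_Re_le_cmod[of "H n z"] by simp
      also have "norm (H n z) \<le> 2 * (Re (H n 0) + 1) / (1 - norm z) + 1"
        using z by (intro norm_le_of_Re_nonneg H pos) auto
      also have "\<dots> \<le> 2 * (m + 1) / (1 - \<rho>) + 1"
        using \<rho> \<open>z \<in> C\<close> H(3)[of n] m0 by (intro add_right_mono frac_le) auto
      finally show "norm (h z) \<le> sqrt (2 * (m + 1) / (1 - \<rho>) + 1)"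
        unfolding n by (rule real_le_rsqrt)
    qed
  qed (use F in auto)
  show thesis
  proof (rule that[of G "r \<circ> t"])
    show "majorized (ball 0 1) 0 (\<lambda>z. (norm (G z))\<^sup>2) m"
    proof (rule majorizedI[OF K(1)])
      fix z :: complex assume z: "z \<in> ball 0 1"
      have "(\<lambda>n. (norm (F (r (t n)) z))\<^sup>2) \<longlonglongrightarrow> (norm (G z))\<^sup>2"
        using G(3)[OF z] by (intro tendsto_intros)
      moreover have "(\<lambda>n. Re (H (r (t n)) z)) \<longlonglongrightarrow> Re (K z)"
        using LIMSEQ_subseq_LIMSEQ[OF K(3)[OF z] G(2)] by (intro tendsto_intros) (simp add: o_def)
      ultimately show "(norm (G z))\<^sup>2 \<le> Re (K z)"
        by (rule LIMSEQ_le) (use z H in auto)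
    next
      have "(\<lambda>n. Re (H (r n) 0)) \<longlonglongrightarrow> Re (K 0)"
        using K(3)[of 0] by (intro tendsto_intros) auto
      then show "Re (K 0) \<le> m"
        by (rule LIMSEQ_le_const2) (use H in auto)
    qed
  qed (use G K in \<open>auto intro: strict_mono_o\<close>)
qed

text \<open>The functions dominating the dilations of \<open>f\<close> share the bound
  \<open>m\<close>; a limit along radii tending to 1 removes the dilation.\<close>

lemma power_dominated_by_square:
  assumes f: "f holomorphic_on ball 0 1" and p: "p > 0"
    and m: "majorized (ball 0 1) 0 (\<lambda>z. norm (f z) powr p) m"
  obtains G where "G holomorphic_on ball 0 1"
    "\<And>z. z \<in> ball 0 1 \<Longrightarrow> norm (f z) powr p \<le> (norm (G z))\<^sup>2"
    "majorized (ball 0 1) 0 (\<lambda>z. (norm (G z))\<^sup>2) m"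
proof (cases "\<exists>z0\<in>ball 0 1. f z0 \<noteq> 0")
  case False
  then show thesis
    using that[of "\<lambda>_. 0"] majorized_mono[OF m, of "\<lambda>_. 0" m] p by auto
next
  case True
  then obtain z0 where z0: "z0 \<in> ball 0 1" "f z0 \<noteq> 0" by blast
  have "\<exists>r G. 1 - inverse (Suc n) < r \<and> r < 1 \<and> G holomorphic_on ball 0 1 \<and>
     (\<forall>z\<in>ball 0 1. norm (f (of_real r * z)) powr p \<le> (norm (G z))\<^sup>2) \<and>
     majorized (ball 0 1) 0 (\<lambda>z. (norm (G z))\<^sup>2) m" for n :: nat
    by (rule power_dominated_by_square_dilated[OF f p m z0, of "1 - inverse (Suc n)"]) (simp, blast)
  then obtain r F where F: "\<And>n. 1 - inverse (Suc n) < r n" "\<And>n. r n < 1"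
    "\<And>n. F n holomorphic_on ball 0 1"
    "\<And>n z. z \<in> ball 0 1 \<Longrightarrow> norm (f (of_real (r n) * z)) powr p \<le> (norm (F n z))\<^sup>2"
    "\<And>n. majorized (ball 0 1) 0 (\<lambda>z. (norm (F n z))\<^sup>2) m"
    by metis
  have r: "r \<longlonglongrightarrow> 1"
  proof (rule tendsto_sandwich[where f = "\<lambda>n. 1 - inverse (real (Suc n))" and h = "\<lambda>_. 1"])
    show "(\<lambda>n. 1 - inverse (real (Suc n))) \<longlonglongrightarrow> 1"
      using tendsto_diff[OF tendsto_const LIMSEQ_inverse_real_of_nat, of 1] by simp
  qed (use F in \<open>auto intro!: always_eventually less_imp_le simp del: of_nat_Suc\<close>)
  obtain G t where G: "G holomorphic_on ball 0 1" "strict_mono (t :: nat \<Rightarrow> nat)"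
    "\<And>z. z \<in> ball 0 1 \<Longrightarrow> (\<lambda>n. F (t n) z) \<longlonglongrightarrow> G z"
    "majorized (ball 0 1) 0 (\<lambda>z. (norm (G z))\<^sup>2) m"
    by (rule square_majorized_normal[of F m, OF F(3,5)]) blast
  show thesis
  proof (rule that[OF G(1) _ G(4)])
    fix z :: complex assume z: "z \<in> ball 0 1"
    have "(\<lambda>n. of_real (r (t n)) * z) \<longlonglongrightarrow> of_real 1 * z"
      using LIMSEQ_subseq_LIMSEQ[OF r G(2)] by (intro tendsto_intros) (simp add: o_def)
    moreover have "isCont f z"
      using holomorphic_on_imp_continuous_on[OF f] z by (simp add: continuous_on_eq_continuous_at)
    ultimately have "(\<lambda>n. f (of_real (r (t n)) * z)) \<longlonglongrightarrow> f z"
      using isCont_tendsto_compose by fastforce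
    then have "(\<lambda>n. norm (f (of_real (r (t n)) * z)) powr p) \<longlonglongrightarrow> norm (f z) powr p"
      using p by (intro tendsto_powr' tendsto_intros) auto
    moreover have "(\<lambda>n. (norm (F (t n) z))\<^sup>2) \<longlonglongrightarrow> (norm (G z))\<^sup>2"
      using G(3)[OF z] by (intro tendsto_intros)
    ultimately show "norm (f z) powr p \<le> (norm (G z))\<^sup>2"
      by (rule LIMSEQ_le) (use z F in auto)
  qed
qed

section \<open>Domains above a Lipschitz graph\<close>

locale lipschitz_graph =
  fixes \<psi> :: "real \<Rightarrow> real" and K :: real
  assumes lip: "\<And>x y. \<bar>\<psi> x - \<psi> y\<bar> \<le> K * \<bar>x - y\<bar>" and K_pos: "0 < K"
begin

lemma continuous_on_psi: "continuous_on A \<psi>"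
proof (rule continuous_on_subset)
  show "continuous_on UNIV \<psi>"
  proof (rule continuous_onI)
    fix x \<epsilon> :: real assume "\<epsilon> > 0"
    show "\<exists>d>0. \<forall>x'\<in>UNIV. dist x' x < d \<longrightarrow> dist (\<psi> x') (\<psi> x) \<le> \<epsilon>"
    proof (intro exI[of _ "\<epsilon> / K"] conjI ballI impI)
      fix x' assume "dist x' x < \<epsilon> / K"
      then have "K * \<bar>x' - x\<bar> \<le> \<epsilon>" using K_pos by (simp add: dist_real_def field_simps)
      then show "dist (\<psi> x') (\<psi> x) \<le> \<epsilon>" using lip[of x' x] by (simp add: dist_real_def)
    qed (use K_pos \<open>\<epsilon> > 0\<close> in auto)
  qed
qed auto

lemma continuous_on_psi_Im [continuous_intros]: "continuous_on A (\<lambda>z. \<psi> (Im z))"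
  by (rule continuous_on_compose2[OF continuous_on_psi[of UNIV]]) (auto intro: continuous_intros)

lemma open_epi_domain: "open (epi_domain \<psi>)"
  unfolding epi_domain_def by (intro open_Collect_less continuous_intros)

lemma epi_domain_le_of_closure: "z \<in> closure (epi_domain \<psi>) \<Longrightarrow> \<psi> (Im z) \<le> Re z"
proof -
  have "closed {z. \<psi> (Im z) \<le> Re z}" by (intro closed_Collect_le continuous_intros)
  moreover have "epi_domain \<psi> \<subseteq> {z. \<psi> (Im z) \<le> Re z}" by (auto simp: epi_domain_def)
  ultimately have "closure (epi_domain \<psi>) \<subseteq> {z. \<psi> (Im z) \<le> Re z}" by (rule closure_minimal[rotated])
  then show "z \<in> closure (epi_domain \<psi>) \<Longrightarrow> \<psi> (Im z) \<le> Re z" by auto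
qed

lemma simply_connected_epi_domain: "simply_connected (epi_domain \<psi>)"
proof -
  have "{z::complex. Re z > 0} homeomorphic epi_domain \<psi>"
    unfolding homeomorphic_minimal
  proof (intro exI conjI ballI)
    show "continuous_on {z. Re z > 0} (\<lambda>z. z + of_real (\<psi> (Im z)))"
      "continuous_on (epi_domain \<psi>) (\<lambda>z. z - of_real (\<psi> (Im z)))"
      by (intro continuous_intros)+
  qed (auto simp: epi_domain_def)
  moreover have "simply_connected {z::complex. Re z > 0}"
    by (intro convex_imp_simply_connected convex_halfspace_Re_gt)
  ultimately show ?thesis using homeomorphic_simply_connected by blast
qed

text \<open>By the Lipschitz bound, a horizontal gap \<open>\<eta>\<close> below the graph is at
  most \<open>1 + K\<close> times the Euclidean distance.\<close>

lemma dist_from_below: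
  assumes "\<psi> (Im z) \<le> Re z" "Re w \<le> \<psi> (Im w) - \<eta>"
  shows "\<eta> / (1 + K) \<le> norm (z - w)"
proof -
  have "\<eta> \<le> Re (z - w) + \<bar>\<psi> (Im w) - \<psi> (Im z)\<bar>" using assms by auto
  also have "\<dots> \<le> norm (z - w) + K * norm (z - w)"
    using lip[of "Im w" "Im z"] complex_Re_le_cmod[of "z - w"] abs_Im_le_cmod[of "z - w"] K_pos
    by (intro add_mono) (auto intro!: order_trans[OF lip] mult_left_mono simp: abs_minus_commute)
  finally show ?thesis using K_pos by (simp add: field_simps)
qed

text \<open>In this locale \<open>\<psi>\<close> is merely Lipschitz, while the contour of Cauchy's
  formula should have a continuous tangent. The contour is the moving average of
  \<open>\<psi>\<close>, a difference quotient of its primitive \<open>P\<close>, lowered by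
  \<open>\<epsilon> / 2\<close>; its derivative is a difference quotient of \<open>\<psi>\<close>,
  so the constant \<open>K\<close> is kept.\<close>

lemma smooth_graph_below:
  assumes "\<epsilon> > 0"
  obtains g g' where "\<And>y. (g has_real_derivative g' y) (at y)" "continuous_on UNIV g'"
    "\<And>y. \<bar>g' y\<bar> \<le> K" "\<And>y. \<psi> y - \<epsilon> < g y" "\<And>y. g y \<le> \<psi> y - \<epsilon> / 4"
proof -
  \<comment> \<open>With this length the averaging moves the graph by at most
    \<open>\<epsilon> / 4\<close>.\<close>
  define \<delta> where "\<delta> = \<epsilon> / (4 * K)"
  have \<delta>: "\<delta> > 0" "K * \<delta> = \<epsilon> / 4" using assms K_pos by (auto simp: \<delta>_def)
  obtain P where P: "\<And>x. (P has_real_derivative \<psi> x) (at x)"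
  proof -
    have "isCont \<psi> x" for x
      using continuous_on_psi[of UNIV] by (simp add: continuous_on_eq_continuous_at)
    then obtain P where "\<And>x. (P has_vector_derivative \<psi> x) (at x)"
      using einterval_antiderivative[of "-\<infinity>" "\<infinity>" \<psi>] by auto
    then show thesis using that by (auto simp: has_real_derivative_iff_has_vector_derivative)
  qed
  define g where "g = (\<lambda>y. (P (y + \<delta>) - P y) / \<delta> - \<epsilon> / 2)"
  define g' where "g' = (\<lambda>y. (\<psi> (y + \<delta>) - \<psi> y) / \<delta>)"
  have near: "\<bar>g y + \<epsilon> / 2 - \<psi> y\<bar> \<le> \<epsilon> / 4" for y
  proof -
    obtain x where x: "y < x" "x < y + \<delta>" "P (y + \<delta>) - P y = (y + \<delta> - y) * \<psi> x"
      using MVT2[of y "y + \<delta>" P \<psi>] P \<delta> by auto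
    have "\<bar>\<psi> x - \<psi> y\<bar> \<le> K * \<delta>"
      using x K_pos by (intro order_trans[OF lip] mult_left_mono) auto
    then show ?thesis using x \<delta> by (simp add: g_def)
  qed
  show thesis
  proof
    show "(g has_real_derivative g' y) (at y)" for y
    proof -
      have "((\<lambda>y. P (y + \<delta>)) has_real_derivative \<psi> (y + \<delta>)) (at y)"
        using P[of "y + \<delta>"] by (simp add: DERIV_shift)
      from DERIV_diff[OF DERIV_cdivide[OF DERIV_diff[OF this P]] DERIV_const] show ?thesis
        unfolding g_def g'_def by simp
    qed
    show "continuous_on UNIV g'"
      unfolding g'_def using \<delta>
      by (intro continuous_intros continuous_on_compose2[OF continuous_on_psi[of UNIV]]) auto
    show "\<bar>g' y\<bar> \<le> K" for y
      using lip[of "y + \<delta>" y] \<delta> by (simp add: g'_def field_simps)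
    show "\<psi> y - \<epsilon> < g y" "g y \<le> \<psi> y - \<epsilon> / 4" for y
      using near[of y] assms by linarith+
  qed
qed

lemma lipschitz_graph_shift: "lipschitz_graph (\<lambda>y. \<psi> y - c) K"
  by unfold_locales (use lip K_pos in auto)

end

section \<open>Uniformly closed spaces of functions\<close>

text \<open>The last clause makes values off \<open>S\<close> irrelevant: a function that agrees on
  \<open>S\<close> with a member is a member. So total functions can stand for functions on
  \<open>S\<close>.\<close>

definition uniform_subspace :: "complex set \<Rightarrow> (complex \<Rightarrow> complex) set \<Rightarrow> bool" where
  "uniform_subspace S V \<longleftrightarrow> (\<lambda>_. 0) \<in> V \<and> (\<forall>f\<in>V. \<forall>g\<in>V. (\<lambda>z. f z + g z) \<in> V) \<and>
     (\<forall>f\<in>V. \<forall>c. (\<lambda>z. c * f z) \<in> V) \<and>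
     (\<forall>f. (\<forall>\<epsilon>>0. \<exists>g\<in>V. \<forall>z\<in>S. norm (f z - g z) \<le> \<epsilon>) \<longrightarrow> f \<in> V)"

lemma uniform_subspace_add: "uniform_subspace S V \<Longrightarrow> f \<in> V \<Longrightarrow> g \<in> V \<Longrightarrow> (\<lambda>z. f z + g z) \<in> V"
  and uniform_subspace_cmult: "uniform_subspace S V \<Longrightarrow> f \<in> V \<Longrightarrow> (\<lambda>z. c * f z) \<in> V"
  and uniform_subspace_zero: "uniform_subspace S V \<Longrightarrow> (\<lambda>z. 0) \<in> V"
  by (auto simp: uniform_subspace_def)

lemma uniform_subspace_limit:
  assumes "uniform_subspace S V" "\<And>n. g n \<in> V" "e \<longlonglongrightarrow> 0"
    "\<And>n z. z \<in> S \<Longrightarrow> norm (f z - g n z) \<le> e n"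
  shows "f \<in> V"
proof -
  have "\<exists>g\<in>V. \<forall>z\<in>S. norm (f z - g z) \<le> \<epsilon>" if \<epsilon>: "\<epsilon> > 0" for \<epsilon>
  proof -
    obtain n where "e n < \<epsilon>"
      using order_tendstoD(2)[OF assms(3) \<epsilon>] by (auto simp: eventually_sequentially)
    then show ?thesis using assms(2,4) by (meson less_imp_le order_trans)
  qed
  then show ?thesis using assms(1) by (auto simp: uniform_subspace_def)
qed

lemma uniform_subspace_sum:
  assumes "uniform_subspace S V" "\<And>i. i \<in> I \<Longrightarrow> f i \<in> V"
  shows "(\<lambda>z. \<Sum>i\<in>I. f i z) \<in> V"
  using assms(2)
proof (induction I rule: infinite_finite_induct)
  case (insert i I)
  then show ?case using uniform_subspace_add[OF assms(1), of "f i" "\<lambda>z. \<Sum>i\<in>I. f i z"] by simp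
qed (use uniform_subspace_zero[OF assms(1)] in auto)

lemma integral_eq_sum_partition:
  fixes f :: "real \<Rightarrow> complex" and t :: "nat \<Rightarrow> real"
  assumes "mono t" "continuous_on {t 0..t n} f"
  shows "(\<Sum>j<n. integral {t j..t (Suc j)} f) = integral {t 0..t n} f"
  using assms(2)
proof (induction n)
  case (Suc n)
  have le: "t 0 \<le> t n" "t n \<le> t (Suc n)" using assms(1) by (auto simp: mono_def)
  have "continuous_on {t 0..t n} f" using Suc.prems le by (auto intro: continuous_on_subset)
  then show ?case
    using Suc Henstock_Kurzweil_Integration.integral_combine[OF le integrable_continuous_real[OF Suc.prems]] by simp
qed auto

text \<open>The weight is integrated exactly over each cell, so the error sees only the oscillation
  of \<open>k\<close>, and the sum is a linear combination of values of \<open>k\<close>. It serves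
  both for Cauchy kernels along the contour and for exponentials.\<close>

lemma weighted_riemann_sum:
  fixes c k :: "real \<Rightarrow> complex" and t :: "nat \<Rightarrow> real"
  assumes t: "mono t" and c: "continuous_on {t 0..t n} c" and k: "continuous_on {t 0..t n} k"
    and B: "\<And>y. y \<in> {t 0..t n} \<Longrightarrow> norm (c y) \<le> B"
    and e: "\<And>j y. j < n \<Longrightarrow> y \<in> {t j..t (Suc j)} \<Longrightarrow> norm (k y - k (t j)) \<le> e"
  shows "norm (integral {t 0..t n} (\<lambda>y. c y * k y) - (\<Sum>j<n. integral {t j..t (Suc j)} c * k (t j)))
     \<le> B * (t n - t 0) * e"
proof -
  have sub: "{t j..t (Suc j)} \<subseteq> {t 0..t n}" if "j < n" for j
    using t that by (auto simp: mono_def)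
  have "integral {t 0..t n} (\<lambda>y. c y * k y) = (\<Sum>j<n. integral {t j..t (Suc j)} (\<lambda>y. c y * k y))"
    by (rule integral_eq_sum_partition[symmetric, OF t]) (intro continuous_intros c k)
  then have "integral {t 0..t n} (\<lambda>y. c y * k y) - (\<Sum>j<n. integral {t j..t (Suc j)} c * k (t j))
     = (\<Sum>j<n. integral {t j..t (Suc j)} (\<lambda>y. c y * k y) - integral {t j..t (Suc j)} c * k (t j))"
    by (simp add: sum_subtractf)
  also have "\<dots> = (\<Sum>j<n. integral {t j..t (Suc j)} (\<lambda>y. c y * (k y - k (t j))))"
  proof (intro sum.cong refl)
    fix j assume "j \<in> {..<n}"
    then have cont: "continuous_on {t j..t (Suc j)} c" "continuous_on {t j..t (Suc j)} k"
      using sub[of j] continuous_on_subset[OF c] continuous_on_subset[OF k] by auto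
    have "integral {t j..t (Suc j)} (\<lambda>y. c y * (k y - k (t j)))
      = integral {t j..t (Suc j)} (\<lambda>y. c y * k y - c y * k (t j))"
      by (simp add: algebra_simps)
    also have "\<dots> = integral {t j..t (Suc j)} (\<lambda>y. c y * k y) - integral {t j..t (Suc j)} (\<lambda>y. c y * k (t j))"
      by (intro Henstock_Kurzweil_Integration.integral_diff integrable_continuous_real continuous_intros cont)
    finally show "integral {t j..t (Suc j)} (\<lambda>y. c y * k y) - integral {t j..t (Suc j)} c * k (t j)
      = integral {t j..t (Suc j)} (\<lambda>y. c y * (k y - k (t j)))"
      by simp
  qed
  also have "norm \<dots> \<le> (\<Sum>j<n. B * e * (t (Suc j) - t j))"
  proof (rule sum_norm_le)
    fix j assume "j \<in> {..<n}"
    then have j: "j < n" by simp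
    have tj: "t j \<le> t (Suc j)" using t by (simp add: mono_def)
    show "norm (integral {t j..t (Suc j)} (\<lambda>y. c y * (k y - k (t j)))) \<le> B * e * (t (Suc j) - t j)"
    proof (rule integral_bound[OF tj])
      show "continuous_on {t j..t (Suc j)} (\<lambda>y. c y * (k y - k (t j)))"
        using sub[OF j] c k by (intro continuous_intros) (auto intro: continuous_on_subset)
      fix y assume y: "y \<in> {t j..t (Suc j)}"
      then have "norm (c y) \<le> B" "norm (k y - k (t j)) \<le> e" using sub[OF j] B e j by auto
      then show "norm (c y * (k y - k (t j))) \<le> B * e"
        unfolding norm_mult by (intro mult_mono) (auto intro: order_trans[OF norm_ge_zero])
    qed
  qed
  also have "\<dots> = B * e * (t n - t 0)"
    by (simp add: sum_distrib_left [symmetric] sum_lessThan_telescope)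
  finally show ?thesis by (simp add: mult_ac)
qed

definition grid :: "real \<Rightarrow> real \<Rightarrow> nat \<Rightarrow> nat \<Rightarrow> real" where
  "grid a b n j = a + real j * ((b - a) / real n)"

lemma grid_props:
  assumes "a \<le> b" "n > 0"
  shows "mono (grid a b n)" "grid a b n 0 = a" "grid a b n n = b"
    "grid a b n (Suc j) - grid a b n j = (b - a) / real n"
    "j \<le> n \<Longrightarrow> grid a b n j \<in> {a..b}"
proof -
  show mono: "mono (grid a b n)" unfolding grid_def mono_def
    using assms by (auto intro!: divide_right_mono mult_right_mono)
  show 0: "grid a b n 0 = a" "grid a b n n = b" using assms by (auto simp: grid_def)
  show "grid a b n (Suc j) - grid a b n j = (b - a) / real n"
  proof -
    define d where "d = (b - a) / real n"
    show ?thesis by (simp add: grid_def d_def [symmetric] algebra_simps)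
  qed
  show "grid a b n j \<in> {a..b}" if "j \<le> n"
    using monoD[OF mono, of 0 j] monoD[OF mono that] 0 by simp
qed

text \<open>The Lipschitz constant \<open>L\<close> does not depend on \<open>z\<close>, so the
  Riemann sums, which are members, converge uniformly on \<open>S\<close>.\<close>

lemma uniform_subspace_integral:
  fixes k :: "real \<Rightarrow> complex \<Rightarrow> complex"
  assumes V: "uniform_subspace S V" and ab: "a \<le> b" and c: "continuous_on {a..b} c"
    and k: "\<And>y. y \<in> {a..b} \<Longrightarrow> k y \<in> V"
    and kc: "\<And>z. z \<in> S \<Longrightarrow> continuous_on {a..b} (\<lambda>y. k y z)"
    and unif: "\<And>y y' z. \<lbrakk>y \<in> {a..b}; y' \<in> {a..b}; z \<in> S\<rbrakk> \<Longrightarrow> norm (k y z - k y' z) \<le> L * \<bar>y - y'\<bar>"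
    and L: "0 \<le> L"
  shows "(\<lambda>z. integral {a..b} (\<lambda>y. c y * k y z)) \<in> V"
proof -
  have "bounded (c ` {a..b})" by (intro compact_imp_bounded compact_continuous_image c) auto
  then obtain B where B: "\<And>y. y \<in> {a..b} \<Longrightarrow> norm (c y) \<le> B" by (fastforce simp: bounded_iff)
  define t where "t = (\<lambda>n. grid a b (Suc n))"
  define g where "g = (\<lambda>n z. \<Sum>j<Suc n. integral {t n j..t n (Suc j)} c * k (t n j) z)"
  show ?thesis
  proof (rule uniform_subspace_limit[OF V])
    show "g n \<in> V" for n
      unfolding g_def using grid_props(5)[OF ab, of "Suc n"] k
      by (intro uniform_subspace_sum[OF V] uniform_subspace_cmult[OF V]) (auto simp: t_def)
    have "(\<lambda>n. B * (b - a) * (L * (b - a)) * inverse (real (Suc n))) \<longlonglongrightarrow> B * (b - a) * (L * (b - a)) * 0"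
      by (intro tendsto_mult tendsto_const LIMSEQ_inverse_real_of_nat)
    then show "(\<lambda>n. B * (b - a) * (L * ((b - a) / real (Suc n)))) \<longlonglongrightarrow> 0"
      by (simp add: divide_inverse mult_ac)
    fix n z assume z: "z \<in> S"
    have ends: "t n 0 = a" "t n (Suc n) = b" "mono (t n)"
      using grid_props[OF ab, of "Suc n"] by (auto simp: t_def)
    have "norm (integral {t n 0..t n (Suc n)} (\<lambda>y. c y * k y z) - (\<Sum>j<Suc n. integral {t n j..t n (Suc j)} c * k (t n j) z))
     \<le> B * (t n (Suc n) - t n 0) * (L * ((b - a) / real (Suc n)))"
    proof (rule weighted_riemann_sum[OF ends(3)])
      show "continuous_on {t n 0..t n (Suc n)} c" "continuous_on {t n 0..t n (Suc n)} (\<lambda>y. k y z)"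
        unfolding ends using c kc[OF z] by auto
      show "norm (c y) \<le> B" if "y \<in> {t n 0..t n (Suc n)}" for y using B that ends by auto
      fix j y assume j: "j < Suc n" and y: "y \<in> {t n j..t n (Suc j)}"
      have mem: "t n j \<in> {a..b}" "t n (Suc j) \<in> {a..b}" and d: "t n (Suc j) - t n j = (b - a) / real (Suc n)"
        using j grid_props(4,5)[OF ab, of "Suc n"] by (auto simp: t_def simp del: of_nat_Suc)
      have "norm (k y z - k (t n j) z) \<le> L * \<bar>y - t n j\<bar>"
        using mem y z by (intro unif) auto
      also have "\<dots> \<le> L * ((b - a) / real (Suc n))"
        using y d L by (intro mult_left_mono) auto
      finally show "norm (k y z - k (t n j) z) \<le> L * ((b - a) / real (Suc n))" .
    qed
    then show "norm (integral {a..b} (\<lambda>y. c y * k y z) - g n z) \<le> B * (b - a) * (L * ((b - a) / real (Suc n)))"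
      unfolding ends g_def .
  qed
qed

section \<open>Laplace transforms approximating the Cauchy kernel\<close>

text \<open>For \<open>m = N\<close> the density \<open>(1 - s / N) ^ N\<close> tends to \<open>exp (- s)\<close>, so the transform should tend to
  \<open>1 / (z + 1)\<close>. It vanishes to order \<open>N\<close> at \<open>s = N\<close>, which compensates the growth of \<open>exp (- N * z)\<close>
  wherever \<open>exp (- Re z) \<le> \<bar>z\<bar> / 2\<close>.\<close>

definition laplace_beta :: "nat \<Rightarrow> nat \<Rightarrow> complex \<Rightarrow> complex" where
  "laplace_beta N m z = integral {0..real N} (\<lambda>s. of_real ((1 - s / real N) ^ m) * exp (- of_real s * z))"

lemma laplace_beta_0:
  assumes "N > 0" "z \<noteq> 0"
  shows "z * laplace_beta N 0 z = 1 - exp (- of_nat N * z)"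
proof -
  have "((\<lambda>s. z * exp (- of_real s * z)) has_integral (- exp (- of_real (real N) * z) - (- exp (- of_real 0 * z)))) {0..real N}"
  proof (rule fundamental_theorem_of_calculus)
    fix s
    have "((\<lambda>w. - exp (- w * z)) has_field_derivative z * exp (- of_real s * z)) (at (of_real s))"
      by (auto intro!: derivative_eq_intros)
    from has_vector_derivative_real_field[OF this]
    show "((\<lambda>s. - exp (- of_real s * z)) has_vector_derivative z * exp (- of_real s * z)) (at s within {0..real N})"
      by (simp add: o_def)
  qed auto
  then have "integral {0..real N} (\<lambda>s. z * exp (- of_real s * z)) = 1 - exp (- of_nat N * z)"
    by (auto dest: integral_unique)
  then show ?thesis by (simp add: laplace_beta_def)
qed

lemma laplace_beta_integrable:
  fixes z :: complex
  assumes "N > 0"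
  shows "(\<lambda>s. of_real ((1 - s / real N) ^ m) * exp (- of_real s * z)) integrable_on {0..real N}"
  using assms by (intro integrable_continuous_real continuous_intros) auto

text \<open>Integration by parts: the boundary term at \<open>s = N\<close> vanishes thanks to the
  positive power, and the one at \<open>s = 0\<close> is the 1.\<close>

lemma laplace_beta_Suc:
  assumes "N > 0"
  shows "z * laplace_beta N (Suc m) z = 1 - of_real (real (Suc m) / real N) * laplace_beta N m z"
proof -
  define g' where "g' = (\<lambda>s. of_real (real (Suc m) / real N) * (of_real ((1 - s / real N) ^ m) * exp (- of_real s * z))
     + z * (of_real ((1 - s / real N) ^ Suc m) * exp (- of_real s * z)))"
  have "(g' has_integral
     (- (of_real ((1 - real N / real N) ^ Suc m) * exp (- of_real (real N) * z))
      - (- (of_real ((1 - 0 / real N) ^ Suc m) * exp (- of_real 0 * z))))) {0..real N}"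
  proof (rule fundamental_theorem_of_calculus)
    fix s :: real
    have "((\<lambda>w. - ((1 - w / of_nat N) ^ Suc m * exp (- w * z))) has_field_derivative
       (of_nat (Suc m) / of_nat N * ((1 - of_real s / of_nat N) ^ m * exp (- of_real s * z))
     + z * ((1 - of_real s / of_nat N) ^ Suc m * exp (- of_real s * z)))) (at (of_real s))"
    proof -
      have "((\<lambda>w. (1 - w / of_nat N) ^ Suc m) has_field_derivative
          of_nat (Suc m) * (1 - complex_of_real s / of_nat N) ^ m * (- 1 / of_nat N)) (at (of_real s))"
        using assms by (auto intro!: derivative_eq_intros simp del: power_Suc)
      moreover have "((\<lambda>w. exp (- w * z)) has_field_derivative - z * exp (- of_real s * z)) (at (of_real s))"
        by (auto intro!: derivative_eq_intros)
      ultimately have "((\<lambda>w. - ((1 - w / of_nat N) ^ Suc m * exp (- w * z))) has_field_derivative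
         - (of_nat (Suc m) * (1 - complex_of_real s / of_nat N) ^ m * (- 1 / of_nat N) * exp (- of_real s * z)
           + - z * exp (- of_real s * z) * (1 - of_real s / of_nat N) ^ Suc m)) (at (of_real s))"
        by (intro DERIV_minus DERIV_mult)
      then show ?thesis
        by (rule DERIV_cong) (simp add: mult_ac del: power_Suc of_nat_Suc)
    qed
    from has_vector_derivative_real_field[OF this]
    show "((\<lambda>s. - (of_real ((1 - s / real N) ^ Suc m) * exp (- of_real s * z))) has_vector_derivative g' s) (at s within {0..real N})"
      unfolding g'_def by (simp add: o_def)
  qed auto
  then have "integral {0..real N} g' = 1" using assms by (auto dest: integral_unique)
  moreover have "integral {0..real N} g' = of_real (real (Suc m) / real N) * laplace_beta N m z + z * laplace_beta N (Suc m) z"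
    unfolding g'_def laplace_beta_def
    by (subst Henstock_Kurzweil_Integration.integral_add)
       (intro integrable_on_mult_right laplace_beta_integrable[OF assms] | simp del: of_real_power power_Suc)+
  ultimately show ?thesis by (simp add: algebra_simps)
qed

context
  fixes N :: nat and z :: complex
  assumes N: "N > 0" and z2: "2 \<le> norm z" and ez: "exp (- Re z) \<le> norm z / 2"
begin

lemma norm_laplace_beta_0: "norm (laplace_beta N 0 z) \<le> (1 + (norm z / 2) ^ N) / norm z"
proof -
  have z0: "z \<noteq> 0" using z2 by auto
  have "norm z * norm (laplace_beta N 0 z) = norm (1 - exp (- of_nat N * z))"
    unfolding laplace_beta_0[OF N z0, symmetric] by (simp add: norm_mult)
  also have "\<dots> \<le> 1 + exp (- Re z) ^ N"
    using norm_triangle_ineq4[of 1 "exp (- of_nat N * z)"]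
    by (simp add: exp_of_nat_mult [symmetric])
  also have "\<dots> \<le> 1 + (norm z / 2) ^ N"
    using ez by (intro add_left_mono power_mono) auto
  finally show ?thesis using z0 by (simp add: field_simps)
qed

text \<open>The limit \<open>r = 1 / (z + 1)\<close> satisfies \<open>z * r = 1 - r\<close>, so it
  solves the recursion up to the defect \<open>1 - t\<close>. Each step divides the error by
  \<open>norm z \<ge> 2\<close>; hence \<open>N\<close> steps beat the initial size
  \<open>(norm z / 2) ^ N\<close>, while the defects shrink as \<open>m\<close> approaches
  \<open>N\<close>.\<close>

lemma norm_laplace_beta_diff:
  "norm (laplace_beta N N z - 1 / (z + 1)) \<le> 1 / real N + 3 * (1/2) ^ N"
proof -
  have zr: "norm z > 0" using z2 by linarith
  have z1: "z + 1 \<noteq> 0"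
  proof
    assume "z + 1 = 0"
    then have "z = - 1" by (simp add: eq_neg_iff_add_eq_0)
    then show False using z2 by simp
  qed
  define r where "r = 1 / (z + 1)"
  have r1: "norm r \<le> 1"
    using norm_triangle_ineq4[of "z + 1" 1] z2 z1 by (simp add: r_def norm_divide divide_le_eq)
  have zr': "z * r = 1 - r" using z1 by (simp add: r_def field_simps)
  define e where "e = (\<lambda>m. laplace_beta N m z - r)"
  have bound: "norm (e m) \<le> norm (e 0) / norm z ^ m + (real N - real m + 1) / real N" if "m \<le> N" for m
    using that
  proof (induction m)
    case 0
    then show ?case using N by simp
  next
    case (Suc m)
    define t where "t = real (Suc m) / real N"
    have t: "0 \<le> t" "t \<le> 1" using Suc.prems N by (auto simp: t_def)
    have rec: "z * laplace_beta N (Suc m) z = 1 - of_real t * laplace_beta N m z"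
      unfolding t_def by (rule laplace_beta_Suc[OF N])
    have "z * e (Suc m) = - of_real t * e m + (1 - of_real t) * r"
      unfolding e_def right_diff_distrib rec zr' by (simp add: algebra_simps)
    then have "norm z * norm (e (Suc m)) = norm (- of_real t * e m + (1 - of_real t) * r)"
      by (metis norm_mult)
    also have "\<dots> \<le> t * norm (e m) + (1 - t) * norm r"
    proof -
      have "norm (1 - complex_of_real t) = 1 - t" using t
        by (metis abs_of_nonneg diff_ge_0_iff_ge norm_of_real of_real_1 of_real_diff)
      then show ?thesis using t
        by (intro order_trans[OF norm_triangle_ineq]) (simp add: norm_mult)
    qed
    also have "\<dots> \<le> norm (e m) + (1 - t)"
      using t r1 by (intro add_mono mult_left_le_one_le mult_left_le) auto
    finally have "norm (e (Suc m)) \<le> (norm (e m) + (1 - t)) / norm z"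
      using zr by (simp add: field_simps)
    also have "\<dots> \<le> (norm (e 0) / norm z ^ m + (real N - real m + 1) / real N + (1 - t)) / norm z"
      using Suc zr by (intro divide_right_mono) auto
    also have "\<dots> = norm (e 0) / norm z ^ Suc m + ((real N - real m + 1) / real N + (1 - t)) / norm z"
      by (simp add: add_divide_distrib mult.commute)
    also have "((real N - real m + 1) / real N + (1 - t)) / norm z \<le> ((real N - real m + 1) / real N + (1 - t)) / 2"
      using z2 t Suc.prems by (intro divide_left_mono) auto
    \<comment> \<open>As \<open>1 - t = (N - m - 1) / N\<close>, halving the bracket gives exactly
      \<open>(N - m) / N\<close>: the bound reproduces itself.\<close>
    also have "\<dots> = (real N - real (Suc m) + 1) / real N"
      using N by (simp add: t_def field_simps)
    finally show ?case by simp
  qed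
  have e0: "norm (e 0) \<le> 2 + (norm z / 2) ^ N"
  proof -
    have "norm (laplace_beta N 0 z) \<le> 1 + (norm z / 2) ^ N"
    proof -
      have "(1 + (norm z / 2) ^ N) / norm z \<le> (1 + (norm z / 2) ^ N) / 1"
        using z2 zr by (intro divide_left_mono) auto
      then show ?thesis using norm_laplace_beta_0 by simp
    qed
    then show ?thesis
      using norm_triangle_ineq4[of "laplace_beta N 0 z" r] r1 by (simp add: e_def)
  qed
  have "norm (e N) \<le> norm (e 0) / norm z ^ N + 1 / real N" using bound[of N] by simp
  also have "norm (e 0) / norm z ^ N \<le> (2 + (norm z / 2) ^ N) / norm z ^ N"
    using e0 by (intro divide_right_mono) auto
  also have "\<dots> = 2 / norm z ^ N + (1/2) ^ N"
    using zr by (simp add: add_divide_distrib power_divide)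
  also have "2 / norm z ^ N \<le> 2 / 2 ^ N"
    using z2 by (intro divide_left_mono power_mono mult_pos_pos) (use zr in auto)
  finally show ?thesis by (simp add: e_def r_def power_divide)
qed

text \<open>The same recursion, now keeping the decay in \<open>z\<close>: the exponent of
  \<open>norm z\<close> falls by one at each step, and the last step leaves one division by
  \<open>norm z\<close>. This gives the limit 0 at infinity needed for the disc algebra.\<close>

lemma norm_laplace_beta_le: "norm (laplace_beta N N z) \<le> 4 / norm z"
proof -
  have zr: "norm z > 0" using z2 by linarith
  obtain n where n: "N = Suc n" using N by (cases N) auto
  have bound: "norm (laplace_beta N m z) \<le> 2 + norm z ^ (n - m)" if "m \<le> n" for m
    using that
  proof (induction m)
    case 0
    have "norm (laplace_beta N 0 z) \<le> 1 / norm z + (norm z / 2) ^ N / norm z"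
      using norm_laplace_beta_0 by (simp add: add_divide_distrib)
    also have "(norm z / 2) ^ N / norm z \<le> norm z ^ n"
    proof -
      have "(norm z / 2) ^ N / norm z = norm z ^ n * (1/2) ^ N"
        using zr by (simp add: n power_divide)
      also have "\<dots> \<le> norm z ^ n * 1" by (intro mult_left_mono power_le_one) auto
      finally show ?thesis by simp
    qed
    also have "1 / norm z \<le> 2" using z2 zr by (simp add: divide_le_eq)
    finally show ?case by simp
  next
    case (Suc m)
    have t: "real (Suc m) / real N \<le> 1" using Suc.prems by (simp add: n)
    have "norm z * norm (laplace_beta N (Suc m) z) = norm (1 - of_real (real (Suc m) / real N) * laplace_beta N m z)"
      unfolding laplace_beta_Suc[OF N, symmetric] by (simp add: norm_mult)
    also have "\<dots> \<le> 1 + real (Suc m) / real N * norm (laplace_beta N m z)"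
      by (intro order_trans[OF norm_triangle_ineq4]) (simp add: norm_mult norm_divide del: of_nat_Suc)
    also have "\<dots> \<le> 1 + norm (laplace_beta N m z)"
      using t by (intro add_left_mono mult_left_le_one_le) auto
    also have "\<dots> \<le> 3 + norm z ^ (n - m)" using Suc by simp
    also have "n - m = Suc (n - Suc m)" using Suc.prems by simp
    finally have "norm (laplace_beta N (Suc m) z) \<le> (3 + norm z * norm z ^ (n - Suc m)) / norm z"
      using zr by (simp add: field_simps)
    also have "\<dots> = 3 / norm z + norm z ^ (n - Suc m)"
      using zr by (simp add: add_divide_distrib)
    also have "3 / norm z \<le> 2" using z2 zr by (simp add: divide_le_eq)
    finally show ?case by simp
  qed
  have "norm z * norm (laplace_beta N N z) = norm (1 - of_real (real (Suc n) / real N) * laplace_beta N n z)"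
    unfolding n laplace_beta_Suc[OF N[unfolded n], symmetric] by (simp add: norm_mult)
  also have "\<dots> \<le> 1 + norm (laplace_beta N n z)"
    by (intro order_trans[OF norm_triangle_ineq4]) (simp add: n del: of_nat_Suc)
  also have "\<dots> \<le> 4" using bound[of n] by simp
  finally show ?thesis using zr by (simp add: field_simps)
qed

end

section \<open>Logarithmic growth of the graph and shifts far to the left\<close>

locale log_graph = lipschitz_graph +
  fixes A :: real
  assumes A: "1 \<le> A" and growth: "\<And>y. exp (- \<psi> y) \<le> A * (1 + \<bar>y\<bar>)"
begin

text \<open>Here \<open>\<zeta>\<close> is \<open>z - w\<close> for a point \<open>w\<close> with
  real part \<open>- M\<close> and imaginary part \<open>\<eta>\<close>. The first two conclusions
  are the hypotheses of the kernel estimates; the third keeps \<open>\<zeta>\<close> in a sector of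
  half-angle 2 pi / 3, as the cutoff and the square root require. The summand 4 in the bound on
  \<open>M\<close> yields a factor \<open>exp (- 4)\<close>, and the tangent bound for the logarithm
  then gives \<open>Re \<zeta> \<ge> 3 - t / 2\<close>.\<close>

lemma far_left:
  assumes z: "\<psi> (Im z) \<le> Re z" and M: "ln (A * (1 + \<bar>\<eta>\<bar>)) + 4 \<le> M"
  defines "\<zeta> \<equiv> z + of_real M - \<i> * of_real \<eta>"
  shows "2 \<le> norm \<zeta>" "exp (- Re \<zeta>) \<le> norm \<zeta> / 2" "- (norm \<zeta> / 2) \<le> Re \<zeta>"
proof -
  define t where "t = \<bar>Im \<zeta>\<bar>"
  have pos: "0 < A * (1 + \<bar>\<eta>\<bar>)" using A by (intro mult_pos_pos) auto
  have "exp (- Re z) \<le> exp (- \<psi> (Im z))" using z by simp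
  also have "\<dots> \<le> A * (1 + \<bar>Im z\<bar>)" by (rule growth)
  also have "\<dots> \<le> A * ((1 + \<bar>\<eta>\<bar>) * (1 + t))"
  proof (rule mult_left_mono)
    have "\<bar>Im z\<bar> \<le> t + \<bar>\<eta>\<bar>" by (simp add: t_def \<zeta>_def)
    also have "1 + (t + \<bar>\<eta>\<bar>) \<le> (1 + \<bar>\<eta>\<bar>) * (1 + t)" by (simp add: t_def algebra_simps)
    finally show "1 + \<bar>Im z\<bar> \<le> (1 + \<bar>\<eta>\<bar>) * (1 + t)" by simp
  qed (use A in auto)
  finally have "exp (- Re z) * exp (- M) \<le> (A * (1 + \<bar>\<eta>\<bar>) * (1 + t)) * exp (- M)"
    by (intro mult_right_mono) (auto simp: mult.assoc)
  also have "\<dots> \<le> (A * (1 + \<bar>\<eta>\<bar>) * (1 + t)) * exp (- ln (A * (1 + \<bar>\<eta>\<bar>)) - 4)"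
    using M A by (intro mult_left_mono) (auto simp: t_def)
  also have "\<dots> = (1 + t) * exp (- 4)"
  proof -
    have "(q * (1 + t)) * exp (- ln q - 4) = (1 + t) * exp (- 4)" if "q > 0" for q :: real
      using that by (simp add: exp_diff exp_minus divide_simps)
    from this[OF pos] show ?thesis .
  qed
  finally have e: "exp (- Re \<zeta>) \<le> (1 + t) * exp (- 4)"
    by (simp add: \<zeta>_def exp_diff exp_minus divide_simps exp_add)
  have "- Re \<zeta> \<le> ln ((1 + t) * exp (- 4))"
    using e by (subst ln_ge_iff) (auto simp: t_def intro!: mult_pos_pos)
  also have "\<dots> = ln ((1 + t) / 2) + ln 2 - 4"
    by (subst ln_mult_pos) (auto simp: t_def ln_div)
  also have "ln ((1 + t) / 2) \<le> (1 + t) / 2 - 1"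
    by (intro ln_le_minus_one) (auto simp: t_def)
  also have "ln (2::real) \<le> 1" using ln_le_minus_one[of "2::real"] by simp
  finally have x: "Re \<zeta> \<ge> 3 - t / 2" by (simp add: field_simps)
  have t: "t \<le> norm \<zeta>" unfolding t_def by (rule abs_Im_le_cmod)
  show "- (norm \<zeta> / 2) \<le> Re \<zeta>" using x t by linarith
  show n2: "2 \<le> norm \<zeta>"
  proof (cases "t \<ge> 2")
    case False
    then have "2 \<le> Re \<zeta>" using x by simp
    then show ?thesis using complex_Re_le_cmod[of \<zeta>] by linarith
  qed (use t in auto)
  have "5 \<le> exp (4::real)" using exp_ge_add_one_self[of "4::real"] by simp
  then have "exp (- 4 :: real) \<le> 1 / 5" by (simp add: exp_minus field_simps)
  then have "(1 + t) * exp (- 4) \<le> (1 + norm \<zeta>) * (1 / 5)"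
    using t by (intro mult_mono) (auto simp: t_def)
  also have "\<dots> \<le> norm \<zeta> / 2" using n2 by simp
  finally show "exp (- Re \<zeta>) \<le> norm \<zeta> / 2" using e by linarith
qed

end

section \<open>Pushing poles\<close>

lemma norm_power_diff_le:
  fixes a b :: complex
  assumes "norm a \<le> D" "norm b \<le> D" "1 \<le> D"
  shows "norm (a ^ k - b ^ k) \<le> real k * D ^ k * norm (a - b)"
proof (induction k)
  case (Suc k)
  have "a ^ Suc k - b ^ Suc k = a * (a ^ k - b ^ k) + (a - b) * b ^ k" by (simp add: algebra_simps)
  also have "norm \<dots> \<le> D * (real k * D ^ k * norm (a - b)) + norm (a - b) * D ^ k"
    using assms Suc
    by (intro order_trans[OF norm_triangle_ineq] add_mono)
       (auto simp: norm_mult norm_power intro!: mult_mono power_mono)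
  also have "norm (a - b) * D ^ k \<le> norm (a - b) * D ^ Suc k"
    using assms by (intro mult_left_mono power_increasing) auto
  finally show ?case by (simp add: algebra_simps)
qed auto

text \<open>Differentiation with respect to the pole: the derivative of the \<open>m\<close>-th
  power in \<open>b\<close> is \<open>m\<close> times the power of order \<open>m + 1\<close>. The
  difference quotients use only poles \<open>b - h i\<close>, which remain to the left of
  \<open>b0\<close>.\<close>

lemma uniform_subspace_inverse_power:
  assumes V: "uniform_subspace S V" and d: "d > 0"
    and far: "\<And>b z. b \<le> b0 \<Longrightarrow> z \<in> S \<Longrightarrow> d \<le> norm (z - Complex b \<eta>)"
    and base: "\<And>b. b \<le> b0 \<Longrightarrow> (\<lambda>z. 1 / (z - Complex b \<eta>)) \<in> V"
  shows "b \<le> b0 \<Longrightarrow> (\<lambda>z. (1 / (z - Complex b \<eta>)) ^ Suc n) \<in> V"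
proof (induction n arbitrary: b)
  case 0
  then show ?case using base by simp
next
  case (Suc n)
  define m where "m = Suc n"
  define D where "D = max 1 (1 / d)"
  define h where "h = (\<lambda>i. inverse (real (Suc i)))"
  have h: "h i > 0" for i by (simp add: h_def)
  define B where "B = (\<lambda>z. 1 / (z - Complex b \<eta>))"
  define A where "A = (\<lambda>i z. 1 / (z - Complex (b - h i) \<eta>))"
  have D: "D \<ge> 1" "1 / d \<le> D" by (auto simp: D_def)
  have bnd: "norm (1 / (z - Complex b' \<eta>)) \<le> D" if "b' \<le> b0" "z \<in> S" for b' z
  proof -
    have "norm (1 / (z - Complex b' \<eta>)) \<le> 1 / d"
      using far[OF that] d by (simp add: norm_divide frac_le)
    then show ?thesis using D by simp
  qed
  have bA: "b - h i \<le> b0" for i using Suc.prems h[of i] by linarith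
  define g where "g = (\<lambda>i z. (1 / of_real (real m * h i)) * (B z ^ m + (- 1) * A i z ^ m))"
  show ?case
  proof (rule uniform_subspace_limit[OF V, of g])
    show "g i \<in> V" for i
      unfolding g_def
      by (intro uniform_subspace_cmult[OF V] uniform_subspace_add[OF V])
         (use Suc.IH[OF Suc.prems] Suc.IH[OF bA] in \<open>auto simp: A_def B_def m_def simp del: power_Suc\<close>)
    have "(\<lambda>i. real m * D ^ (2 * m + 2) * h i) \<longlonglongrightarrow> real m * D ^ (2 * m + 2) * 0"
      unfolding h_def by (intro tendsto_mult tendsto_const LIMSEQ_inverse_real_of_nat)
    then show "(\<lambda>i. real m * D ^ (2 * m + 2) * h i) \<longlonglongrightarrow> 0" by simp
    fix i z assume z: "z \<in> S"
    have nz: "z - Complex b \<eta> \<noteq> 0" "z - Complex (b - h i) \<eta> \<noteq> 0"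
      using far[OF Suc.prems z] far[OF bA z, of i] d by (auto simp del: right_minus_eq)
    have BA: "B z - A i z = of_real (h i) * A i z * B z"
    proof -
      have "Complex b \<eta> - Complex (b - h i) \<eta> = of_real (h i)" by (simp add: complex_eq_iff)
      then have "(z - Complex (b - h i) \<eta>) - (z - Complex b \<eta>) = of_real (h i)" by (simp add: algebra_simps)
      then show ?thesis unfolding A_def B_def using nz by (simp add: divide_simps)
    qed
    have nB: "norm (B z) \<le> D" "norm (A i z) \<le> D" using bnd[OF Suc.prems z] bnd[OF bA z] by (auto simp: A_def B_def)
    have nBA: "norm (A i z - B z) \<le> h i * D ^ 2"
    proof -
      have "norm (A i z - B z) = h i * (norm (A i z) * norm (B z))"
        using BA h[of i] by (simp add: norm_minus_commute norm_mult)
      also have "\<dots> \<le> h i * (D * D)" using nB h[of i] D by (intro mult_left_mono mult_mono) auto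
      finally show ?thesis by (simp add: power2_eq_square)
    qed
    have hm: "complex_of_real (h i) \<noteq> 0" "(of_nat m :: complex) \<noteq> 0" using h[of i] by (auto simp: m_def simp del: of_nat_Suc)
    have "B z ^ m - A i z ^ m = (B z - A i z) * (\<Sum>j<m. A i z ^ (m - Suc j) * B z ^ j)"
      by (rule diff_power_eq_sum[of "B z" n "A i z", folded m_def, THEN trans])
         (simp add: m_def power_Suc mult.commute)
    also have "\<dots> = of_real (h i) * (\<Sum>j<m. A i z ^ (m - j) * B z ^ Suc j)"
    proof -
      have "A i z * B z * (\<Sum>j<m. A i z ^ (m - Suc j) * B z ^ j) = (\<Sum>j<m. A i z ^ (m - j) * B z ^ Suc j)"
        unfolding sum_distrib_left
        by (intro sum.cong refl) (simp add: Suc_diff_Suc[symmetric] mult_ac flip: power_Suc)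
      then show ?thesis unfolding BA by (simp add: mult.assoc)
    qed
    finally have "of_nat m * g i z = (\<Sum>j<m. A i z ^ (m - j) * B z ^ Suc j)"
      using hm by (simp add: g_def)
    moreover have "of_nat m * B z ^ Suc m = (\<Sum>j<m. B z ^ (m - j) * B z ^ Suc j)"
    proof -
      have "(\<Sum>j<m. B z ^ (m - j) * B z ^ Suc j) = (\<Sum>j<m. B z ^ Suc m)"
        by (intro sum.cong refl) (simp only: power_add [symmetric], simp)
      then show ?thesis by simp
    qed
    ultimately have "of_nat m * (B z ^ Suc m - g i z) = (\<Sum>j<m. (B z ^ (m - j) - A i z ^ (m - j)) * B z ^ Suc j)"
      by (simp add: right_diff_distrib left_diff_distrib sum_subtractf)
    also have "norm \<dots> \<le> (\<Sum>j<m. real m * D ^ (2 * m + 2) * h i)"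
    proof (rule sum_norm_le)
      fix j assume "j \<in> {..<m}"
      then have j: "j < m" by simp
      have "norm ((B z ^ (m - j) - A i z ^ (m - j)) * B z ^ Suc j)
        \<le> (real (m - j) * D ^ (m - j) * norm (A i z - B z)) * D ^ Suc j"
        unfolding norm_mult norm_power
        using norm_power_diff_le[OF nB D(1), of "m - j"] nB D(1)
        by (intro mult_mono power_mono) (auto simp: norm_minus_commute intro!: mult_nonneg_nonneg)
      also have "\<dots> \<le> (real m * D ^ m * (h i * D ^ 2)) * D ^ m"
        using j D h[of i] nBA
        by (intro mult_mono power_increasing) (auto intro!: mult_nonneg_nonneg)
      also have "\<dots> = real m * D ^ (2 * m + 2) * h i" by (simp add: power_add mult_2 power2_eq_square)
      finally show "norm ((B z ^ (m - j) - A i z ^ (m - j)) * B z ^ Suc j) \<le> real m * D ^ (2 * m + 2) * h i" .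
    qed
    also have "\<dots> = real m * (real m * D ^ (2 * m + 2) * h i)" by simp
    finally have "real m * norm (B z ^ Suc m - g i z) \<le> real m * (real m * D ^ (2 * m + 2) * h i)"
      by (simp add: norm_mult)
    then show "norm ((1 / (z - Complex b \<eta>)) ^ Suc (Suc n) - g i z) \<le> real m * D ^ (2 * m + 2) * h i"
      by (simp add: m_def B_def del: power_Suc of_nat_Suc)
  qed
qed

text \<open>Geometric series in \<open>(w' - w) / (z - w)\<close>, whose modulus is at most 1/2 for
  all \<open>z \<in> S\<close>.\<close>

lemma uniform_subspace_shift_pole:
  assumes V: "uniform_subspace S V" and d: "d > 0"
    and far: "\<And>z. z \<in> S \<Longrightarrow> d \<le> norm (z - w)"
    and pow: "\<And>n. (\<lambda>z. (1 / (z - w)) ^ Suc n) \<in> V"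
    and w': "norm (w' - w) \<le> d / 2"
  shows "(\<lambda>z. 1 / (z - w')) \<in> V"
proof (rule uniform_subspace_limit[OF V, of "\<lambda>n z. \<Sum>k<n. (w' - w) ^ k * (1 / (z - w)) ^ Suc k"])
  show "(\<lambda>z. \<Sum>k<n. (w' - w) ^ k * (1 / (z - w)) ^ Suc k) \<in> V" for n
    by (intro uniform_subspace_sum[OF V] uniform_subspace_cmult[OF V] pow)
  have "(\<lambda>n. (1/2) ^ n * (2 / d)) \<longlonglongrightarrow> 0 * (2 / d)"
    by (intro tendsto_mult LIMSEQ_realpow_zero tendsto_const) auto
  then show "(\<lambda>n. (1/2) ^ n * (2 / d)) \<longlonglongrightarrow> 0" by simp
  fix n z assume z: "z \<in> S"
  define u where "u = (w' - w) / (z - w)"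
  have nz: "z - w \<noteq> 0" using far[OF z] d by auto
  have lo: "d / 2 \<le> norm (z - w')"
    using norm_triangle_ineq[of "z - w'" "w' - w"] far[OF z] w' by simp
  then have nz': "z - w' \<noteq> 0" using d by auto
  have u: "norm u \<le> 1 / 2"
    using w' far[OF z] d by (simp add: u_def norm_divide divide_le_eq)
  have u1: "1 - u \<noteq> 0" using u by auto
  have e1: "(z - w) * (1 - u) = z - w'" using nz by (simp add: u_def field_simps)
  have "(\<Sum>k<n. (w' - w) ^ k * (1 / (z - w)) ^ Suc k) = (\<Sum>k<n. u ^ k) / (z - w)"
    unfolding u_def by (simp add: sum_divide_distrib power_divide mult_ac)
  also have "\<dots> = (1 - u ^ n) / (1 - u) / (z - w)"
    using u1 sum_gp_strict[of u n] by simp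
  also have "\<dots> = (1 - u ^ n) / (z - w')" by (simp add: mult.commute flip: e1)
  finally have "1 / (z - w') - (\<Sum>k<n. (w' - w) ^ k * (1 / (z - w)) ^ Suc k) = u ^ n * (1 / (z - w'))"
    using nz' by (simp add: field_simps)
  also have "norm \<dots> \<le> (1/2) ^ n * (2 / d)"
  proof -
    have "norm (1 / (z - w')) \<le> 1 / (d / 2)"
      using lo d unfolding norm_divide norm_one by (intro divide_left_mono) (auto intro!: mult_pos_pos)
    then show ?thesis
      unfolding norm_mult norm_power using u by (intro mult_mono power_mono) auto
  qed
  finally show "norm (1 / (z - w') - (\<Sum>k<n. (w' - w) ^ k * (1 / (z - w)) ^ Suc k)) \<le> (1/2) ^ n * (2 / d)" .
qed

context log_graph
begin

text \<open>The pole moves along the horizontal line through \<open>w\<close>. Up to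
  \<open>w\<close> this line keeps distance at least \<open>d\<close> from the closed domain, so
  every move may advance by \<open>d / 2\<close> with the same \<open>d\<close>, and finitely many
  moves reach \<open>w\<close>.\<close>

lemma Cauchy_kernel_in_uniform_subspace:
  assumes V: "uniform_subspace (closure (epi_domain \<psi>)) V"
    and base: "\<And>N w. N > 0 \<Longrightarrow> Re w \<le> - ln (A * (1 + \<bar>Im w\<bar>)) - 4 \<Longrightarrow> (\<lambda>z. laplace_beta N N (z - w)) \<in> V"
    and w: "Re w < \<psi> (Im w)"
  shows "(\<lambda>z. 1 / (z - w)) \<in> V"
proof -
  define \<eta> where "\<eta> = Im w"
  define d where "d = (\<psi> \<eta> - Re w) / (1 + K)"
  have d: "d > 0" using w K_pos by (simp add: d_def \<eta>_def)
  have far: "d \<le> norm (z - Complex b \<eta>)" if "b \<le> Re w" "z \<in> closure (epi_domain \<psi>)" for b z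
    using dist_from_below[OF epi_domain_le_of_closure[OF that(2)], of "Complex b \<eta>" "\<psi> \<eta> - Re w"] that
    by (simp add: d_def)
  \<comment> \<open>Since \<open>laplace_beta\<close> approximates \<open>1 / (z + 1)\<close>, the
    pole \<open>b\<close> comes from the shift by \<open>b + 1\<close>; hence 5 instead of the 4 in
    \<open>base\<close>.\<close>
  define b0 where "b0 = - ln (A * (1 + \<bar>\<eta>\<bar>)) - 5"
  have left: "(\<lambda>z. 1 / (z - Complex b \<eta>)) \<in> V" if "b \<le> b0" for b
  proof (rule uniform_subspace_limit[OF V, of "\<lambda>n z. laplace_beta (Suc n) (Suc n) (z - Complex (b + 1) \<eta>)"])
    show "(\<lambda>z. laplace_beta (Suc n) (Suc n) (z - Complex (b + 1) \<eta>)) \<in> V" for n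
      using that by (intro base) (auto simp: b0_def)
    have "(\<lambda>n. inverse (real (Suc n)) + 3 * (1/2) ^ Suc n) \<longlonglongrightarrow> 0 + 3 * 0"
      by (intro tendsto_add tendsto_mult tendsto_const LIMSEQ_inverse_real_of_nat
            LIMSEQ_Suc[OF LIMSEQ_realpow_zero]) auto
    then show "(\<lambda>n. 1 / real (Suc n) + 3 * (1/2) ^ Suc n) \<longlonglongrightarrow> 0"
      by (simp add: inverse_eq_divide)
    fix n z assume z: "z \<in> closure (epi_domain \<psi>)"
    define \<zeta> where "\<zeta> = z - Complex (b + 1) \<eta>"
    have eq: "\<zeta> = z + of_real (- b - 1) - \<i> * of_real \<eta>"
      by (simp add: \<zeta>_def complex_eq_iff)
    have M: "ln (A * (1 + \<bar>\<eta>\<bar>)) + 4 \<le> - b - 1" using that by (simp add: b0_def)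
    have "z - Complex b \<eta> = \<zeta> + 1" by (simp add: \<zeta>_def complex_eq_iff)
    then show "norm (1 / (z - Complex b \<eta>) - laplace_beta (Suc n) (Suc n) (z - Complex (b + 1) \<eta>))
       \<le> 1 / real (Suc n) + 3 * (1/2) ^ Suc n"
      using norm_laplace_beta_diff[of "Suc n" \<zeta>]
        far_left(1,2)[OF epi_domain_le_of_closure[OF z] M, folded eq]
      by (simp add: norm_minus_commute \<zeta>_def [symmetric] del: of_nat_Suc power_Suc)
  qed
  have "(\<lambda>z. 1 / (z - Complex b \<eta>)) \<in> V" if "b \<le> min (Re w) (b0 + real n * (d / 2))" for n b
    using that
  proof (induction n arbitrary: b)
    case 0
    then show ?case using left by simp
  next
    case (Suc n)
    define c where "c = min (Re w) (b0 + real n * (d / 2))"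
    show ?case
    proof (cases "b \<le> c")
      case True
      then show ?thesis using Suc.IH by (simp add: c_def)
    next
      case False
      have pow: "(\<lambda>z. (1 / (z - Complex c \<eta>)) ^ Suc k) \<in> V" for k
      proof (rule uniform_subspace_inverse_power[OF V d, of c \<eta>])
        show "d \<le> norm (z - Complex b \<eta>)" if "b \<le> c" "z \<in> closure (epi_domain \<psi>)" for b z
          using far that by (simp add: c_def)
        show "(\<lambda>z. 1 / (z - Complex b \<eta>)) \<in> V" if "b \<le> c" for b
          using Suc.IH that by (simp add: c_def)
      qed auto
      show ?thesis
      proof (rule uniform_subspace_shift_pole[OF V d _ pow])
        show "d \<le> norm (z - Complex c \<eta>)" if "z \<in> closure (epi_domain \<psi>)" for z
          using far that by (simp add: c_def)
        have "Complex b \<eta> - Complex c \<eta> = of_real (b - c)" by (simp add: complex_eq_iff)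
        moreover have "\<bar>b - c\<bar> \<le> d / 2"
        proof -
          define X where "X = b0 + real n * (d / 2)"
          have "b \<le> Re w" "b \<le> X + d / 2" using Suc.prems by (auto simp: X_def algebra_simps add_divide_distrib)
          moreover have "c = Re w \<or> c = X" by (auto simp: c_def X_def min_def)
          ultimately show ?thesis using False d by linarith
        qed
        ultimately show "norm (Complex b \<eta> - Complex c \<eta>) \<le> d / 2" by (metis norm_of_real)
      qed
    qed
  qed
  moreover obtain n where "real n * (d / 2) \<ge> Re w - b0"
    using d by (metis half_gt_zero reals_Archimedean3 less_imp_le)
  ultimately have "(\<lambda>z. 1 / (z - Complex (Re w) \<eta>)) \<in> V"
    by (metis add_le_cancel_left diff_add_cancel min.boundedI order_refl add.commute)
  then show ?thesis by (simp add: \<eta>_def)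
qed

end

section \<open>Cauchy's formula along the graph\<close>

context lipschitz_graph
begin

text \<open>The integrand splits into a removable part \<open>G\<close>, with primitive
  \<open>P\<close> on the simply connected set, and a pure pole integrated by a logarithm, so the
  integral is a difference of endpoint values. These are compared through \<open>Q\<close> along a
  detour to the right of \<open>z\<close>: its three segments have length of order \<open>R\<close>,
  and the derivative of \<open>Q\<close> there is of order 1 over the cube of
  \<open>R\<close>.\<close>

lemma Cauchy_integral_graph:
  assumes F: "F holomorphic_on epi_domain (\<lambda>y. \<psi> y - \<epsilon>)"
    and bnd: "\<And>\<zeta>. \<zeta> \<in> epi_domain (\<lambda>y. \<psi> y - \<epsilon>) \<Longrightarrow> norm (F \<zeta>) * (norm \<zeta>)\<^sup>2 \<le> C"
    and g: "\<And>y. (g has_real_derivative g' y) (at y)" "\<And>y y'. \<bar>g y - g y'\<bar> \<le> K * \<bar>y - y'\<bar>"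
    and g_lo: "\<And>y. \<psi> y - \<epsilon> < g y"
    and z: "g (Im z) < Re z"
  shows "(\<lambda>n. integral {- real n..real n} (\<lambda>y. F (Complex (g y) y) * Complex (g' y) 1 * (1 / (z - Complex (g y) y))))
    \<longlonglongrightarrow> 2 * of_real pi * \<i> * F z"
proof -
  define S where "S = epi_domain (\<lambda>y. \<psi> y - \<epsilon>)"
  interpret S: lipschitz_graph "\<lambda>y. \<psi> y - \<epsilon>" K by (rule lipschitz_graph_shift)
  have S: "open S" "simply_connected S"
    unfolding S_def by (rule S.open_epi_domain S.simply_connected_epi_domain)+
  have memS: "\<zeta> \<in> S" if "g (Im \<zeta>) \<le> Re \<zeta>" for \<zeta>
    using that g_lo[of "Im \<zeta>"] by (simp add: S_def epi_domain_def)
  have zS: "z \<in> S" using memS z by simp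
  define G where "G = (\<lambda>\<zeta>. if \<zeta> = z then deriv F z else (F \<zeta> - F z) / (\<zeta> - z))"
  have "G holomorphic_on S"
    unfolding G_def by (rule pole_lemma_open) (use F S in \<open>auto simp: S_def\<close>)
  then obtain P where P: "\<And>\<zeta>. \<zeta> \<in> S \<Longrightarrow> (P has_field_derivative G \<zeta>) (at \<zeta>)"
    using S simply_connected_eq_global_primitive[OF S(1)] by metis
  define \<gamma> where "\<gamma> = (\<lambda>y. Complex (g y) y)"
  define \<gamma>' where "\<gamma>' = (\<lambda>y. Complex (g' y) 1)"
  have \<gamma>_deriv: "(\<gamma> has_vector_derivative \<gamma>' y) (at y)" for y
  proof -
    have "((\<lambda>y. of_real (g y) + \<i> * of_real y) has_vector_derivative (of_real (g' y) + \<i> * of_real 1)) (at y)"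
      using g(1)[of y]
      by (intro has_vector_derivative_add has_vector_derivative_mult_right has_vector_derivative_of_real)
         (auto simp: has_real_derivative_iff_has_vector_derivative)
    moreover have "of_real (g y) + \<i> * of_real y = \<gamma> y" for y by (simp add: \<gamma>_def complex_eq_iff)
    moreover have "of_real (g' y) + \<i> * of_real 1 = \<gamma>' y" by (simp add: \<gamma>'_def complex_eq_iff)
    ultimately show ?thesis by simp
  qed
  have \<gamma>S: "\<gamma> y \<in> S" for y by (intro memS) (simp add: \<gamma>_def)
  have \<gamma>_ne: "\<gamma> y \<noteq> z" for y using z by (auto simp: \<gamma>_def)
  have slit: "z - \<gamma> y \<notin> \<real>\<^sub>\<le>\<^sub>0" for y
    using z by (auto simp: complex_nonpos_Reals_iff \<gamma>_def)
  define J where "J = (\<lambda>R. integral {- R..R} (\<lambda>y. F (\<gamma> y) * \<gamma>' y * (1 / (z - \<gamma> y))))"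
  have J: "J R = (- P (\<gamma> R) - F z * Ln (z - \<gamma> R)) - (- P (\<gamma> (- R)) - F z * Ln (z - \<gamma> (- R)))"
    if "R \<ge> 0" for R
    unfolding J_def
  proof (rule integral_unique, rule fundamental_theorem_of_calculus)
    fix y
    have D: "((\<lambda>w. - P w - F z * Ln (z - w)) has_field_derivative (- G (\<gamma> y) - F z * (- 1 / (z - \<gamma> y)))) (at (\<gamma> y))"
      using slit[of y] by (auto intro!: derivative_eq_intros P[OF \<gamma>S] simp: divide_inverse mult.commute)
    have "((\<lambda>y. - P (\<gamma> y) - F z * Ln (z - \<gamma> y)) has_vector_derivative (\<gamma>' y * (- G (\<gamma> y) - F z * (- 1 / (z - \<gamma> y))))) (at y)"
      using field_vector_diff_chain_at[OF \<gamma>_deriv D] by (simp add: o_def)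
    moreover have "\<gamma>' y * (- G (\<gamma> y) - F z * (- 1 / (z - \<gamma> y))) = F (\<gamma> y) * \<gamma>' y * (1 / (z - \<gamma> y))"
      using \<gamma>_ne[of y] by (simp add: G_def divide_simps) (simp add: algebra_simps)
    ultimately show "((\<lambda>y. - P (\<gamma> y) - F z * Ln (z - \<gamma> y)) has_vector_derivative F (\<gamma> y) * \<gamma>' y * (1 / (z - \<gamma> y))) (at y within {- R..R})"
      by (simp add: has_vector_derivative_at_within)
  qed (use that in auto)
  \<comment> \<open>The cut of \<open>Ln (\<zeta> - z)\<close> runs to the left of \<open>z\<close>,
    away from the detour. The contour itself passes to the left of \<open>z\<close> and therefore
    uses \<open>Ln (z - \<zeta>)\<close>, cut to the right.\<close>
  define Q where "Q = (\<lambda>\<zeta>. P \<zeta> + F z * Ln (\<zeta> - z))"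
  have Q_deriv: "(Q has_field_derivative F \<zeta> / (\<zeta> - z)) (at \<zeta>)" if "\<zeta> \<in> S" "\<zeta> - z \<notin> \<real>\<^sub>\<le>\<^sub>0" for \<zeta>
  proof -
    have ne: "\<zeta> \<noteq> z" using that(2) by auto
    have "(Q has_field_derivative (G \<zeta> + F z * (1 / (\<zeta> - z)))) (at \<zeta>)"
      unfolding Q_def using that by (auto intro!: derivative_eq_intros P simp: divide_inverse mult.commute)
    moreover have "G \<zeta> + F z * (1 / (\<zeta> - z)) = F \<zeta> / (\<zeta> - z)"
      using ne by (simp add: G_def divide_simps)
    ultimately show ?thesis by simp
  qed
  have C: "C \<ge> 0" using bnd[OF zS[unfolded S_def]] by (meson mult_nonneg_nonneg norm_ge_zero order_trans zero_le_power2)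
  define c where "c = \<bar>g 0\<bar> + \<bar>Re z\<bar> + K + 1"
  have c: "c > 0" using K_pos by (simp add: c_def)
  have main: "norm (J R - 2 * of_real pi * \<i> * F z) \<le> 12 * C * c / R\<^sup>2" if R: "R \<ge> 2 * \<bar>Im z\<bar> + 1" for R
  proof -
    have R1: "R \<ge> 1" "R > 0" "R \<ge> 0" using R by auto
    \<comment> \<open>Linear in \<open>R\<close>, to the right of the contour at all heights up to
      \<open>R\<close>, and at least \<open>R\<close> to the right of \<open>z\<close>.\<close>
    define X where "X = \<bar>g 0\<bar> + \<bar>Re z\<bar> + (K + 1) * R"
    have Xc: "X \<le> c * R"
      using R1 mult_left_mono[OF R1(1), of "\<bar>g 0\<bar> + \<bar>Re z\<bar>"] by (simp add: X_def c_def algebra_simps)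
    have Xg: "g y \<le> X" "\<bar>g y\<bar> \<le> X" if "\<bar>y\<bar> \<le> R" for y
    proof -
      have "\<bar>g y\<bar> \<le> \<bar>g 0\<bar> + K * \<bar>y\<bar>" using g(2)[of y 0] by simp
      also have "\<dots> \<le> \<bar>g 0\<bar> + K * R" using that K_pos by (intro add_left_mono mult_left_mono) auto
      also have "\<dots> \<le> X" using R1 by (simp add: X_def algebra_simps)
      finally show "\<bar>g y\<bar> \<le> X" .
      then show "g y \<le> X" by simp
    qed
    have KR: "0 \<le> K * R" using R1 K_pos by simp
    have "Re z \<le> \<bar>Re z\<bar>" "0 \<le> \<bar>g 0\<bar>" "X = \<bar>g 0\<bar> + \<bar>Re z\<bar> + (K * R + R)"
      by (auto simp: X_def algebra_simps)
    then have XR: "X - Re z \<ge> R" "X \<ge> R" using KR by linarith+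
    have small: "norm (F \<zeta> / (\<zeta> - z)) \<le> 2 * C / R ^ 3"
      if "\<zeta> \<in> S" "R \<le> norm \<zeta>" "R / 2 \<le> norm (\<zeta> - z)" for \<zeta>
    proof -
      have "norm (F \<zeta>) * R\<^sup>2 \<le> norm (F \<zeta>) * (norm \<zeta>)\<^sup>2"
        using that R1 by (intro mult_left_mono power_mono) auto
      also have "\<dots> \<le> C" using that(1) bnd by (simp add: S_def)
      finally have "norm (F \<zeta>) \<le> C / R\<^sup>2" using R1 by (simp add: field_simps)
      then have "norm (F \<zeta>) / norm (\<zeta> - z) \<le> (C / R\<^sup>2) / (R / 2)"
        using that R1 C by (intro frac_le) auto
      also have "\<dots> = 2 * C / R ^ 3" using R1 by (simp add: power3_eq_cube power2_eq_square)
      finally show ?thesis by (simp add: norm_divide)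
    qed
    have seg: "norm (Q a - Q b) \<le> 2 * C / R ^ 3 * norm (a - b)"
      if T: "convex T" "a \<in> T" "b \<in> T"
        and TP: "\<And>\<zeta>. \<zeta> \<in> T \<Longrightarrow> \<zeta> \<in> S \<and> \<zeta> - z \<notin> \<real>\<^sub>\<le>\<^sub>0 \<and> R \<le> norm \<zeta> \<and> R / 2 \<le> norm (\<zeta> - z)" for T a b
      using T(1)
    proof (rule field_differentiable_bound)
      show "(Q has_field_derivative F \<zeta> / (\<zeta> - z)) (at \<zeta> within T)" if "\<zeta> \<in> T" for \<zeta>
        using Q_deriv TP[OF that] has_field_derivative_at_within by blast
      show "norm (F \<zeta> / (\<zeta> - z)) \<le> 2 * C / R ^ 3" if "\<zeta> \<in> T" for \<zeta>
        using small TP[OF that] by blast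
    qed (use T in auto)
    define X' where "X' = 2 * X"
    have hor: "norm (Q (\<gamma> y) - Q (Complex X y)) \<le> 2 * C / R ^ 3 * X'" if y: "y = R \<or> y = - R" for y
    proof -
      have yR: "\<bar>y\<bar> = R" using y R1 by auto
      have "norm (Q (\<gamma> y) - Q (Complex X y)) \<le> 2 * C / R ^ 3 * norm (\<gamma> y - Complex X y)"
      proof (rule seg[of "{\<zeta>. Im \<zeta> \<ge> y} \<inter> {\<zeta>. Im \<zeta> \<le> y} \<inter> {\<zeta>. Re \<zeta> \<ge> g y}"])
        show "convex ({\<zeta>. Im \<zeta> \<ge> y} \<inter> {\<zeta>. Im \<zeta> \<le> y} \<inter> {\<zeta>. Re \<zeta> \<ge> g y})"
          by (intro convex_Int convex_halfspace_Re_ge convex_halfspace_Im_ge convex_halfspace_Im_le)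
        fix \<zeta> assume \<zeta>: "\<zeta> \<in> {\<zeta>. Im \<zeta> \<ge> y} \<inter> {\<zeta>. Im \<zeta> \<le> y} \<inter> {\<zeta>. Re \<zeta> \<ge> g y}"
        then have "Im \<zeta> = y" by auto
        have "\<zeta> \<in> S" using \<zeta> \<open>Im \<zeta> = y\<close> by (intro memS) auto
        moreover have "Im (\<zeta> - z) \<noteq> 0" using \<open>Im \<zeta> = y\<close> R yR by auto
        then have "\<zeta> - z \<notin> \<real>\<^sub>\<le>\<^sub>0" by (auto simp: complex_nonpos_Reals_iff)
        moreover have "R \<le> norm \<zeta>" using abs_Im_le_cmod[of \<zeta>] \<open>Im \<zeta> = y\<close> yR by simp
        moreover have "R / 2 \<le> norm (\<zeta> - z)"
          using abs_Im_le_cmod[of "\<zeta> - z"] \<open>Im \<zeta> = y\<close> yR R by auto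
        ultimately show "\<zeta> \<in> S \<and> \<zeta> - z \<notin> \<real>\<^sub>\<le>\<^sub>0 \<and> R \<le> norm \<zeta> \<and> R / 2 \<le> norm (\<zeta> - z)" by blast
      qed (use Xg[of y] yR in \<open>auto simp: \<gamma>_def\<close>)
      also have "\<dots> \<le> 2 * C / R ^ 3 * X'"
      proof (rule mult_left_mono)
        have "\<gamma> y - Complex X y = of_real (g y - X)" by (simp add: \<gamma>_def complex_eq_iff)
        then have "norm (\<gamma> y - Complex X y) = \<bar>g y - X\<bar>" by (metis norm_of_real)
        then show "norm (\<gamma> y - Complex X y) \<le> X'" using Xg[of y] yR by (simp add: X'_def)
      qed (use C R1 in auto)
      finally show ?thesis .
    qed
    have ver: "norm (Q (Complex X R) - Q (Complex X (- R))) \<le> 2 * C / R ^ 3 * X'"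
    proof -
      have "norm (Q (Complex X R) - Q (Complex X (- R))) \<le> 2 * C / R ^ 3 * norm (Complex X R - Complex X (- R))"
      proof (rule seg[of "{\<zeta>. Re \<zeta> \<ge> X} \<inter> {\<zeta>. Re \<zeta> \<le> X} \<inter> ({\<zeta>. Im \<zeta> \<ge> - R} \<inter> {\<zeta>. Im \<zeta> \<le> R})"])
        show "convex ({\<zeta>. Re \<zeta> \<ge> X} \<inter> {\<zeta>. Re \<zeta> \<le> X} \<inter> ({\<zeta>. Im \<zeta> \<ge> - R} \<inter> {\<zeta>. Im \<zeta> \<le> R}))"
          by (intro convex_Int convex_halfspace_Im_ge convex_halfspace_Im_le convex_halfspace_Re_ge convex_halfspace_Re_le)
        fix \<zeta> assume \<zeta>: "\<zeta> \<in> {\<zeta>. Re \<zeta> \<ge> X} \<inter> {\<zeta>. Re \<zeta> \<le> X} \<inter> ({\<zeta>. Im \<zeta> \<ge> - R} \<inter> {\<zeta>. Im \<zeta> \<le> R})"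
        have "\<bar>Im \<zeta>\<bar> \<le> R" using \<zeta> by auto
        then have "\<zeta> \<in> S" using \<zeta> Xg(1)[of "Im \<zeta>"] by (intro memS) auto
        moreover have "Re (\<zeta> - z) \<ge> R" using \<zeta> XR by auto
        moreover from this have "\<zeta> - z \<notin> \<real>\<^sub>\<le>\<^sub>0" using R1 by (auto simp: complex_nonpos_Reals_iff)
        moreover have "R \<le> norm \<zeta>" using complex_Re_le_cmod[of \<zeta>] \<zeta> XR by simp
        ultimately show "\<zeta> \<in> S \<and> \<zeta> - z \<notin> \<real>\<^sub>\<le>\<^sub>0 \<and> R \<le> norm \<zeta> \<and> R / 2 \<le> norm (\<zeta> - z)"
          using complex_Re_le_cmod[of "\<zeta> - z"] R1 by auto
      qed (use R1 in auto)
      also have "\<dots> \<le> 2 * C / R ^ 3 * X'"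
      proof (rule mult_left_mono)
        have "Complex X R - Complex X (- R) = \<i> * of_real (2 * R)" by (simp add: complex_eq_iff)
        then have "norm (Complex X R - Complex X (- R)) = 2 * R" using R1 by (simp add: norm_mult)
        then show "norm (Complex X R - Complex X (- R)) \<le> X'" using XR by (simp add: X'_def)
      qed (use C R1 in auto)
      finally show ?thesis .
    qed
    \<comment> \<open>The two branches of the logarithm differ by i pi, with opposite signs at the
      two ends; together this is the factor 2 pi i of Cauchy's formula.\<close>
    have up: "Ln (z - \<gamma> R) = Ln (\<gamma> R - z) - \<i> * of_real pi"
    proof -
      have "Im (\<gamma> R - z) > 0" using R by (simp add: \<gamma>_def) 
      then show ?thesis using Ln_minus[of "\<gamma> R - z"] \<gamma>_ne[of R] by auto
    qed
    have dn: "Ln (z - \<gamma> (- R)) = Ln (\<gamma> (- R) - z) + \<i> * of_real pi"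
    proof -
      have "Im (\<gamma> (- R) - z) < 0" using R by (simp add: \<gamma>_def)
      then show ?thesis using Ln_minus[of "\<gamma> (- R) - z"] \<gamma>_ne[of "- R"] by auto
    qed
    have "J R - 2 * of_real pi * \<i> * F z = Q (\<gamma> (- R)) - Q (\<gamma> R)"
      unfolding J[OF R1(3)] up dn Q_def by (simp add: algebra_simps)
    also have "\<dots> = (Q (\<gamma> (- R)) - Q (Complex X (- R))) - (Q (Complex X R) - Q (Complex X (- R)))
        - (Q (\<gamma> R) - Q (Complex X R))" by simp
    also have "norm \<dots> \<le> 2 * C / R ^ 3 * X' + 2 * C / R ^ 3 * X' + 2 * C / R ^ 3 * X'"
      by (intro order_trans[OF norm_triangle_ineq4] add_mono hor ver) auto
    also have "\<dots> = 12 * C * X / R ^ 3" by (simp add: X'_def)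
    also have "\<dots> \<le> 12 * C * (c * R) / R ^ 3"
      using Xc C R1 by (intro divide_right_mono mult_left_mono) auto
    also have "\<dots> = 12 * C * c / R\<^sup>2" using R1 by (simp add: power3_eq_cube power2_eq_square)
    finally show ?thesis .
  qed
  have "(\<lambda>n. J (real n)) \<longlonglongrightarrow> 2 * of_real pi * \<i> * F z"
  proof (rule Lim_null [THEN iffD2], rule Lim_null_comparison)
    show "\<forall>\<^sub>F n in sequentially. norm (J (real n) - 2 * of_real pi * \<i> * F z) \<le> 12 * C * c / (real n)\<^sup>2"
      using eventually_ge_at_top[of "nat \<lceil>2 * \<bar>Im z\<bar> + 1\<rceil>"]
    proof eventually_elim
      case (elim n)
      then have "real n \<ge> 2 * \<bar>Im z\<bar> + 1" by linarith
      then show ?case by (rule main)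
    qed
    show "(\<lambda>n. 12 * C * c / (real n)\<^sup>2) \<longlonglongrightarrow> 0" by real_asymp
  qed
  then show ?thesis by (simp add: J_def \<gamma>_def \<gamma>'_def)
qed

end

lemma integral_inverse_square:
  assumes "0 < a" "a \<le> b"
  shows "((\<lambda>y::real. c / y\<^sup>2) has_integral (c / a - c / b)) {a..b}"
    "((\<lambda>y::real. c / y\<^sup>2) has_integral (c / a - c / b)) {-b..-a}"
proof -
  have "((\<lambda>y::real. c / y\<^sup>2) has_integral (- (c / b) - - (c / a))) {a..b}"
    using assms
    by (intro fundamental_theorem_of_calculus)
       (auto intro!: derivative_eq_intros simp flip: has_real_derivative_iff_has_vector_derivative simp: power2_eq_square)
  then show 1: "((\<lambda>y::real. c / y\<^sup>2) has_integral (c / a - c / b)) {a..b}" by simp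
  show "((\<lambda>y::real. c / y\<^sup>2) has_integral (c / a - c / b)) {-b..-a}"
    using has_integral_reflect_lemma_real[OF 1] by simp
qed

context log_graph
begin

text \<open>The truncated Cauchy integrals lie in \<open>V\<close> because they are integrals of
  kernels in \<open>V\<close>. Quadratic decay of \<open>F\<close> makes their tails at most
  \<open>2 * D / n\<close>, uniformly in \<open>z\<close> since the contour keeps distance
  \<open>d\<close> from the closed domain, so they converge uniformly to a multiple of
  \<open>F\<close>.\<close>

lemma in_uniform_subspace:
  assumes V: "uniform_subspace (closure (epi_domain \<psi>)) V"
    and base: "\<And>N w. N > 0 \<Longrightarrow> Re w \<le> - ln (A * (1 + \<bar>Im w\<bar>)) - 4 \<Longrightarrow> (\<lambda>z. laplace_beta N N (z - w)) \<in> V"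
    and \<epsilon>: "\<epsilon> > 0"
    and F: "F holomorphic_on epi_domain (\<lambda>y. \<psi> y - \<epsilon>)"
    and bnd: "\<And>\<zeta>. \<zeta> \<in> epi_domain (\<lambda>y. \<psi> y - \<epsilon>) \<Longrightarrow> norm (F \<zeta>) * (norm \<zeta>)\<^sup>2 \<le> C"
  shows "F \<in> V"
proof -
  obtain g g' where g: "\<And>y. (g has_real_derivative g' y) (at y)" and g'_cont: "continuous_on UNIV g'"
    and g'_le: "\<And>y. \<bar>g' y\<bar> \<le> K" and g_lo: "\<And>y. \<psi> y - \<epsilon> < g y" and g_hi: "\<And>y. g y \<le> \<psi> y - \<epsilon> / 4"
    using smooth_graph_below[OF \<epsilon>] by metis
  have g_lip: "\<bar>g y - g y'\<bar> \<le> K * \<bar>y - y'\<bar>" for y y'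
    using field_differentiable_bound[of UNIV g g' K y y'] g g'_le by simp
  have g_cont: "continuous_on T g" for T
    using g by (meson DERIV_continuous continuous_at_imp_continuous_on)
  define \<gamma> where "\<gamma> = (\<lambda>y. Complex (g y) y)"
  define c where "c = (\<lambda>y. F (\<gamma> y) * Complex (g' y) 1)"
  define d where "d = \<epsilon> / 4 / (1 + K)"
  have d: "d > 0" using \<epsilon> K_pos by (simp add: d_def)
  define J where "J = (\<lambda>n z. integral {- real n..real n} (\<lambda>y. c y * (1 / (z - \<gamma> y))))"
  have \<gamma>S: "\<gamma> y \<in> epi_domain (\<lambda>y. \<psi> y - \<epsilon>)" for y
    using g_lo by (simp add: \<gamma>_def epi_domain_def)
  have \<gamma>_cont: "continuous_on T \<gamma>" for T
    unfolding \<gamma>_def Complex_eq by (intro continuous_intros g_cont)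
  have c_cont: "continuous_on T c" for T
    unfolding c_def Complex_eq
    by (intro continuous_intros continuous_on_compose2[OF holomorphic_on_imp_continuous_on[OF F] \<gamma>_cont]
          continuous_on_subset[OF g'_cont]) (use \<gamma>S in auto)
  have far: "d \<le> norm (z - \<gamma> y)" if "z \<in> closure (epi_domain \<psi>)" for z y
    unfolding d_def by (rule dist_from_below[OF epi_domain_le_of_closure[OF that]])
      (use g_hi[of y] in \<open>simp add: \<gamma>_def\<close>)
  have k_cont: "continuous_on T (\<lambda>y. 1 / (z - \<gamma> y))" if "z \<in> closure (epi_domain \<psi>)" for z T
  proof -
    have "z - \<gamma> y \<noteq> 0" for y using far[OF that, of y] d by auto
    then show ?thesis by (intro continuous_intros \<gamma>_cont) auto
  qed
  have JV: "J n \<in> V" for n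
    unfolding J_def
  proof (rule uniform_subspace_integral[OF V _ c_cont, where L = "(K + 1) / d\<^sup>2"])
    show "(\<lambda>z. 1 / (z - \<gamma> y)) \<in> V" for y
      by (rule Cauchy_kernel_in_uniform_subspace[OF V base])
         (use g_hi[of y] \<epsilon> in \<open>auto simp: \<gamma>_def\<close>)
    fix y y' z assume z: "z \<in> closure (epi_domain \<psi>)"
    have nz: "z - \<gamma> y \<noteq> 0" "z - \<gamma> y' \<noteq> 0" using far[OF z, of y] far[OF z, of y'] d by auto
    have "norm (\<gamma> y - \<gamma> y') \<le> \<bar>Re (\<gamma> y - \<gamma> y')\<bar> + \<bar>Im (\<gamma> y - \<gamma> y')\<bar>" by (rule cmod_le)
    also have "\<dots> \<le> (K + 1) * \<bar>y - y'\<bar>" using g_lip[of y y'] by (simp add: \<gamma>_def algebra_simps)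
    finally have l: "norm (\<gamma> y - \<gamma> y') \<le> (K + 1) * \<bar>y - y'\<bar>" .
    have "1 / (z - \<gamma> y) - 1 / (z - \<gamma> y') = (\<gamma> y - \<gamma> y') / ((z - \<gamma> y) * (z - \<gamma> y'))"
      using nz by (simp add: divide_simps)
    also have "norm \<dots> \<le> (K + 1) * \<bar>y - y'\<bar> / (d * d)"
      unfolding norm_divide norm_mult using l far[OF z] d K_pos
      by (intro frac_le mult_mono) auto
    finally show "norm (1 / (z - \<gamma> y) - 1 / (z - \<gamma> y')) \<le> (K + 1) / d\<^sup>2 * \<bar>y - y'\<bar>"
      by (simp add: power2_eq_square)
  qed (use k_cont K_pos in auto)
  define D where "D = C * (K + 1) / d"
  have c_le: "norm (c y * (1 / (z - \<gamma> y))) \<le> D / y\<^sup>2" if "z \<in> closure (epi_domain \<psi>)" "y \<noteq> 0" for z y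
  proof -
    have "norm (F (\<gamma> y)) * y\<^sup>2 \<le> norm (F (\<gamma> y)) * (norm (\<gamma> y))\<^sup>2"
      using power_mono[OF abs_Im_le_cmod[of "\<gamma> y"], of 2] by (intro mult_left_mono) (auto simp: \<gamma>_def)
    also have "\<dots> \<le> C" by (rule bnd[OF \<gamma>S])
    finally have 1: "norm (F (\<gamma> y)) \<le> C / y\<^sup>2" using that by (simp add: field_simps)
    have 2: "norm (Complex (g' y) 1) \<le> K + 1"
      using cmod_le[of "Complex (g' y) 1"] g'_le[of y] by simp
    have 3: "norm (1 / (z - \<gamma> y)) \<le> 1 / d"
      using far[OF that(1)] d unfolding norm_divide norm_one by (intro frac_le) auto
    have "norm (c y * (1 / (z - \<gamma> y))) \<le> (C / y\<^sup>2) * (K + 1) * (1 / d)"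
      unfolding c_def norm_mult
      by (intro mult_mono 1 2 3 mult_nonneg_nonneg order_trans[OF norm_ge_zero 1]) (use K_pos in auto)
    then show ?thesis by (simp add: D_def mult_ac)
  qed
  have tail: "norm (J m z - J n z) \<le> 2 * D / real n"
    if z: "z \<in> closure (epi_domain \<psi>)" and mn: "0 < n" "n \<le> m" for m n z
  proof -
    define h where "h = (\<lambda>y. c y * (1 / (z - \<gamma> y)))"
    have hi: "h integrable_on {a..b}" for a b
      unfolding h_def by (intro integrable_continuous_real continuous_intros c_cont k_cont z)
    have D0: "D \<ge> 0" using order_trans[OF norm_ge_zero c_le[OF z, of 1]] by simp
    have n: "0 < real n" "real n \<le> real m" using mn by auto
    have "integral {-real m..real m} h = integral {-real m..-real n} h + integral {-real n..real m} h"
      by (rule Henstock_Kurzweil_Integration.integral_combine[symmetric, OF _ _ hi]) (use n in auto)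
    also have "integral {-real n..real m} h = integral {-real n..real n} h + integral {real n..real m} h"
      by (rule Henstock_Kurzweil_Integration.integral_combine[symmetric, OF _ _ hi]) (use n in auto)
    finally have "J m z - J n z = integral {-real m..-real n} h + integral {real n..real m} h"
      by (simp add: J_def h_def)
    also have "norm \<dots> \<le> (D / real n - D / real m) + (D / real n - D / real m)"
    proof (intro order_trans[OF norm_triangle_ineq] add_mono)
      show "norm (integral {-real m..-real n} h) \<le> D / real n - D / real m"
        unfolding integral_unique[OF integral_inverse_square(2)[OF n, of D], symmetric]
        by (rule integral_norm_bound_integral[OF hi has_integral_integrable[OF integral_inverse_square(2)[OF n]]])
           (unfold h_def, rule c_le[OF z], use n in auto)
      show "norm (integral {real n..real m} h) \<le> D / real n - D / real m"
        unfolding integral_unique[OF integral_inverse_square(1)[OF n, of D], symmetric]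
        by (rule integral_norm_bound_integral[OF hi has_integral_integrable[OF integral_inverse_square(1)[OF n]]])
           (unfold h_def, rule c_le[OF z], use n in auto)
    qed
    also have "\<dots> \<le> 2 * D / real n" using D0 by simp
    finally show ?thesis .
  qed
  show ?thesis
  proof (rule uniform_subspace_limit[OF V, of "\<lambda>n z. 1 / (2 * of_real pi * \<i>) * J (Suc n) z"])
    show "(\<lambda>z. 1 / (2 * of_real pi * \<i>) * J (Suc n) z) \<in> V" for n
      by (intro uniform_subspace_cmult[OF V] JV)
    show "(\<lambda>n. 2 * D / real (Suc n)) \<longlonglongrightarrow> 0" by real_asymp
    fix n z assume z: "z \<in> closure (epi_domain \<psi>)"
    have "g (Im z) < Re z" using epi_domain_le_of_closure[OF z] g_hi[of "Im z"] \<epsilon> by linarith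
    from Cauchy_integral_graph[OF F bnd g g_lip g_lo this]
    have lim: "(\<lambda>m. J m z) \<longlonglongrightarrow> 2 * of_real pi * \<i> * F z"
      by (simp add: J_def c_def \<gamma>_def)
    have "norm (2 * of_real pi * \<i> * F z - J (Suc n) z) \<le> 2 * D / real (Suc n)"
    proof (rule Lim_norm_ubound)
      show "(\<lambda>m. J m z - J (Suc n) z) \<longlonglongrightarrow> 2 * of_real pi * \<i> * F z - J (Suc n) z"
        by (intro tendsto_intros lim)
      show "\<forall>\<^sub>F m in sequentially. norm (J m z - J (Suc n) z) \<le> 2 * D / real (Suc n)"
        using eventually_ge_at_top[of "Suc n"] by eventually_elim (rule tail[OF z], auto)
    qed auto
    note le = this
    have eq: "F z - 1 / (2 * of_real pi * \<i>) * J (Suc n) z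
        = (1 / (2 * of_real pi * \<i>)) * (2 * of_real pi * \<i> * F z - J (Suc n) z)"
      by (simp add: field_simps)
    have "norm (1 / (2 * of_real pi * \<i>)) \<le> 1"
      using pi_gt3 by (simp add: norm_divide norm_mult)
    then have "norm (F z - 1 / (2 * of_real pi * \<i>) * J (Suc n) z)
      \<le> 1 * norm (2 * of_real pi * \<i> * F z - J (Suc n) z)"
      unfolding eq norm_mult by (intro mult_right_mono) (simp_all only: norm_mult norm_ge_zero)
    then show "norm (F z - 1 / (2 * of_real pi * \<i>) * J (Suc n) z) \<le> 2 * D / real (Suc n)"
      using le by linarith
  qed
qed

end

section \<open>Density in the disc algebra\<close>

text \<open>It has the quadratic decay that the Cauchy integral requires and tends to 1 locally
  uniformly as \<open>k\<close> grows.\<close>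

definition cutoff :: "real \<Rightarrow> real \<Rightarrow> complex \<Rightarrow> complex" where
  "cutoff M k z = (of_real k / (of_real k + (z + of_real M)))\<^sup>2"

text \<open>In the sector the squared denominator is at least
  \<open>k\<^sup>2 - k * norm \<zeta> + (norm \<zeta>)\<^sup>2\<close>; completing the square in one
  variable or the other bounds the denominator below by \<open>k / 2\<close> and by
  \<open>norm \<zeta> / 2\<close>.\<close>

lemma cutoff_bounds:
  fixes \<zeta> :: complex
  assumes k: "k > 0" and Re: "- (norm \<zeta> / 2) \<le> Re \<zeta>"
  shows "of_real k + \<zeta> \<noteq> 0"
    "norm ((of_real k / (of_real k + \<zeta>))\<^sup>2) * (norm \<zeta>)\<^sup>2 \<le> 4 * k\<^sup>2"
    "norm (1 - (of_real k / (of_real k + \<zeta>))\<^sup>2) \<le> 6"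
    "norm (1 - (of_real k / (of_real k + \<zeta>))\<^sup>2) \<le> 6 * norm \<zeta> / k"
proof -
  have eq: "(norm (of_real k + \<zeta>))\<^sup>2 = k\<^sup>2 + 2 * k * Re \<zeta> + (norm \<zeta>)\<^sup>2"
    unfolding cmod_power2 by (simp add: power2_eq_square algebra_simps)
  have "k * (- (norm \<zeta> / 2)) \<le> k * Re \<zeta>" using Re k by (intro mult_left_mono) auto
  then have lo: "k\<^sup>2 - k * norm \<zeta> + (norm \<zeta>)\<^sup>2 \<le> (norm (of_real k + \<zeta>))\<^sup>2"
    unfolding eq by simp
  have "(k / 2)\<^sup>2 \<le> (norm (of_real k + \<zeta>))\<^sup>2"
  proof -
    have "(norm \<zeta> - k / 2)\<^sup>2 = (norm \<zeta>)\<^sup>2 - k * norm \<zeta> + k\<^sup>2 / 4"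
      by (simp add: power2_eq_square algebra_simps)
    moreover have "0 \<le> (norm \<zeta> - k / 2)\<^sup>2" "0 \<le> k\<^sup>2" "(k / 2)\<^sup>2 = k\<^sup>2 / 4"
      by (auto simp: power_divide)
    ultimately show ?thesis using lo by linarith
  qed
  then have 1: "k / 2 \<le> norm (of_real k + \<zeta>)" by (rule power2_le_imp_le) auto
  have "(norm \<zeta> / 2)\<^sup>2 \<le> (norm (of_real k + \<zeta>))\<^sup>2"
  proof -
    have "(k - norm \<zeta> / 2)\<^sup>2 = k\<^sup>2 - k * norm \<zeta> + (norm \<zeta>)\<^sup>2 / 4"
      by (simp add: power2_eq_square algebra_simps)
    moreover have "0 \<le> (k - norm \<zeta> / 2)\<^sup>2" "0 \<le> (norm \<zeta>)\<^sup>2" "(norm \<zeta> / 2)\<^sup>2 = (norm \<zeta>)\<^sup>2 / 4"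
      by (auto simp: power_divide)
    ultimately show ?thesis using lo by linarith
  qed
  then have 2: "norm \<zeta> / 2 \<le> norm (of_real k + \<zeta>)" by (rule power2_le_imp_le) auto
  show nz: "of_real k + \<zeta> \<noteq> 0" using 1 k by auto
  then have pos: "norm (of_real k + \<zeta>) > 0" by simp
  define Q where "Q = of_real k / (of_real k + \<zeta>)"
  have Q2: "norm Q \<le> 2"
    using 1 pos k by (simp add: Q_def norm_divide divide_le_eq)
  have "norm Q * norm \<zeta> \<le> 2 * k"
  proof -
    have "k * norm \<zeta> \<le> k * (2 * norm (of_real k + \<zeta>))" using 2 k by (intro mult_left_mono) auto
    then show ?thesis using pos k by (simp add: Q_def norm_divide divide_le_eq mult_ac)
  qed
  then have "(norm Q * norm \<zeta>)\<^sup>2 \<le> (2 * k)\<^sup>2" by (intro power_mono) auto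
  then show "norm ((of_real k / (of_real k + \<zeta>))\<^sup>2) * (norm \<zeta>)\<^sup>2 \<le> 4 * k\<^sup>2"
    by (simp add: Q_def norm_power power_mult_distrib)
  have Q1: "1 - Q = \<zeta> / (of_real k + \<zeta>)" using nz by (simp add: Q_def field_simps)
  have a: "norm (1 - Q) \<le> 2" unfolding Q1 using 2 pos by (simp add: norm_divide divide_le_eq)
  have b: "norm (1 - Q) \<le> 2 * norm \<zeta> / k"
  proof -
    have "norm \<zeta> * k \<le> norm \<zeta> * (2 * norm (of_real k + \<zeta>))" using 1 by (intro mult_left_mono) auto
    then show ?thesis unfolding Q1 using pos k by (simp add: norm_divide field_simps)
  qed
  have c: "norm (1 + Q) \<le> 3" using Q2 norm_triangle_ineq[of 1 Q] by simp
  have eq: "1 - Q\<^sup>2 = (1 - Q) * (1 + Q)" by (simp add: power2_eq_square algebra_simps)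
  have "norm (1 - Q\<^sup>2) \<le> 2 * 3"
    unfolding eq norm_mult by (intro mult_mono a c) auto
  then show "norm (1 - (of_real k / (of_real k + \<zeta>))\<^sup>2) \<le> 6" by (simp add: Q_def)
  have "norm (1 - Q\<^sup>2) \<le> 2 * norm \<zeta> / k * 3"
    unfolding eq norm_mult using k by (intro mult_mono b c) auto
  then show "norm (1 - (of_real k / (of_real k + \<zeta>))\<^sup>2) \<le> 6 * norm \<zeta> / k" by (simp add: Q_def)
qed

context log_graph
begin

text \<open>At height 0, \<open>far_left\<close> asks for a shift by \<open>ln A + 4\<close>; one
  more unit makes its estimates valid on the domain enlarged to the left by up to 1, where the
  translated functions live.\<close>

definition offset :: real where "offset = ln A + 5"

lemma offset_ge: "5 \<le> offset"
  using A by (simp add: offset_def)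

lemma offset_far:
  assumes "\<psi> (Im z) - 1 \<le> Re z"
  shows "2 \<le> norm (z + of_real offset)" "- (norm (z + of_real offset) / 2) \<le> Re (z + of_real offset)"
    "norm z \<le> (1 + offset) * norm (z + of_real offset)"
    "exp (- Re z) \<le> exp offset * norm (z + of_real offset)"
proof -
  have eq: "(z + 1) + of_real (offset - 1) - \<i> * of_real 0 = z + of_real offset" by simp
  note far = far_left[of "z + 1" 0 "offset - 1", unfolded eq]
  show 1: "2 \<le> norm (z + of_real offset)" using far(1) assms by (simp add: offset_def)
  show "- (norm (z + of_real offset) / 2) \<le> Re (z + of_real offset)"
    using far(3) assms by (simp add: offset_def)
  have "norm z \<le> norm (z + of_real offset) + offset"
    using norm_triangle_ineq4[of "z + of_real offset" "of_real offset"] offset_ge by simp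
  also have "\<dots> \<le> norm (z + of_real offset) + offset * norm (z + of_real offset)"
    using 1 offset_ge by (intro add_left_mono) (simp add: mult_le_cancel_left1)
  finally show "norm z \<le> (1 + offset) * norm (z + of_real offset)" by (simp add: algebra_simps)
  have "exp (- Re (z + of_real offset)) \<le> norm (z + of_real offset) / 2"
    using far(2) assms by (simp add: offset_def)
  then have "exp (- Re z) / exp offset \<le> norm (z + of_real offset)"
    using norm_ge_zero[of "z + of_real offset"] by (simp add: exp_diff exp_minus divide_simps exp_add)
  then show "exp (- Re z) \<le> exp offset * norm (z + of_real offset)"
    by (simp add: divide_le_eq mult.commute)
qed

lemma cutoff_mult_in_uniform_subspace:
  assumes V: "uniform_subspace (closure (epi_domain \<psi>)) V"
    and base: "\<And>N w. N > 0 \<Longrightarrow> Re w \<le> - ln (A * (1 + \<bar>Im w\<bar>)) - 4 \<Longrightarrow> (\<lambda>z. laplace_beta N N (z - w)) \<in> V"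
    and \<epsilon>: "0 < \<epsilon>" "\<epsilon> \<le> 1" and k: "k > 0"
    and F: "F holomorphic_on epi_domain (\<lambda>y. \<psi> y - \<epsilon>)"
    and bnd: "\<And>\<zeta>. \<zeta> \<in> epi_domain (\<lambda>y. \<psi> y - \<epsilon>) \<Longrightarrow> norm (F \<zeta>) \<le> B"
  shows "(\<lambda>z. F z * cutoff offset k z) \<in> V"
proof (rule in_uniform_subspace[OF V base \<epsilon>(1), where C = "B * (4 * k\<^sup>2) * (1 + offset)\<^sup>2"])
  have far: "\<psi> (Im z) - 1 \<le> Re z" if "z \<in> epi_domain (\<lambda>y. \<psi> y - \<epsilon>)" for z
    using that \<epsilon> by (auto simp: epi_domain_def)
  show "(\<lambda>z. F z * cutoff offset k z) holomorphic_on epi_domain (\<lambda>y. \<psi> y - \<epsilon>)"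
    unfolding cutoff_def
    by (intro holomorphic_intros F) (use cutoff_bounds(1)[OF k offset_far(2)[OF far]] in auto)
  fix z assume z: "z \<in> epi_domain (\<lambda>y. \<psi> y - \<epsilon>)"
  define \<zeta> where "\<zeta> = z + of_real offset"
  have B: "0 \<le> B" using bnd[OF z] order_trans[OF norm_ge_zero] by blast
  have "norm (F z * cutoff offset k z) * (norm z)\<^sup>2
     \<le> norm (F z * cutoff offset k z) * ((1 + offset) * norm \<zeta>)\<^sup>2"
    using offset_far(3)[OF far[OF z]] by (intro mult_left_mono power_mono) (auto simp: \<zeta>_def)
  also have "\<dots> = norm (F z) * (norm (cutoff offset k z) * (norm \<zeta>)\<^sup>2) * (1 + offset)\<^sup>2"
    by (simp add: norm_mult power_mult_distrib)
  also have "\<dots> \<le> B * (4 * k\<^sup>2) * (1 + offset)\<^sup>2"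
  proof -
    have "norm (cutoff offset k z) * (norm \<zeta>)\<^sup>2 \<le> 4 * k\<^sup>2"
      using cutoff_bounds(2)[OF k offset_far(2)[OF far[OF z]]] by (simp add: cutoff_def \<zeta>_def)
    then show ?thesis using bnd[OF z] B by (intro mult_right_mono[OF mult_mono]) auto
  qed
  finally show "norm (F z * cutoff offset k z) * (norm z)\<^sup>2 \<le> B * (4 * k\<^sup>2) * (1 + offset)\<^sup>2" .
qed (use assms in auto)

lemma shift_in_epi_domain:
  assumes "z \<in> closure (epi_domain \<psi>)" "\<epsilon> > 0"
  shows "z + of_real \<epsilon> \<in> epi_domain \<psi>"
  using epi_domain_le_of_closure[OF assms(1)] assms(2) by (simp add: epi_domain_def)

lemma shift_holomorphic:
  assumes "f holomorphic_on epi_domain \<psi>"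
  shows "(\<lambda>z. f (z + of_real \<epsilon>)) holomorphic_on epi_domain (\<lambda>y. \<psi> y - \<epsilon>)"
proof -
  have "(f \<circ> (\<lambda>z. z + of_real \<epsilon>)) holomorphic_on epi_domain (\<lambda>y. \<psi> y - \<epsilon>)"
    by (rule holomorphic_on_compose_gen[OF _ assms]) (auto intro!: holomorphic_intros simp: epi_domain_def)
  then show ?thesis by (simp add: o_def)
qed

text \<open>Translation by \<open>\<epsilon>\<close> is uniformly harmless: on a large disc by
  uniform continuity, outside it because \<open>f\<close> is small. The cutoff is close to 1 on that
  disc and bounded outside, where the smallness of \<open>f\<close> is used again.\<close>

lemma vanishing_at_infinity_in_uniform_subspace:
  assumes V: "uniform_subspace (closure (epi_domain \<psi>)) V"
    and base: "\<And>N w. N > 0 \<Longrightarrow> Re w \<le> - ln (A * (1 + \<bar>Im w\<bar>)) - 4 \<Longrightarrow> (\<lambda>z. laplace_beta N N (z - w)) \<in> V"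
    and cont: "continuous_on (closure (epi_domain \<psi>)) f" and hol: "f holomorphic_on epi_domain \<psi>"
    and lim: "filterlim f (nhds 0) (inf at_infinity (principal (closure (epi_domain \<psi>))))"
  shows "f \<in> V"
proof -
  define S where "S = closure (epi_domain \<psi>)"
  have small: "\<exists>R>0. \<forall>z\<in>S. R \<le> norm z \<longrightarrow> norm (f z) < \<delta>" if "\<delta> > 0" for \<delta>
  proof -
    have "eventually (\<lambda>z. norm (f z) < \<delta>) (inf at_infinity (principal S))"
      using tendstoD[OF lim that] by (simp add: S_def)
    then obtain b where "\<forall>z. b \<le> norm z \<longrightarrow> z \<in> S \<longrightarrow> norm (f z) < \<delta>"
      by (auto simp: eventually_inf_principal eventually_at_infinity)
    then show ?thesis by (intro exI[of _ "max b 1"]) auto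
  qed
  have compact: "compact (S \<inter> cball 0 R)" for R
    by (simp add: S_def closed_Int_compact)
  have cont': "continuous_on (S \<inter> cball 0 R) f" for R
    using cont by (auto simp: S_def intro: continuous_on_subset)
  obtain B where B: "B > 0" "\<And>z. z \<in> S \<Longrightarrow> norm (f z) \<le> B"
  proof -
    obtain R where R: "\<forall>z\<in>S. R \<le> norm z \<longrightarrow> norm (f z) < 1" using small[of 1] by auto
    have "bounded (f ` (S \<inter> cball 0 R))"
      using compact cont' by (intro compact_imp_bounded compact_continuous_image)
    then obtain b where b: "\<And>z. z \<in> S \<Longrightarrow> norm z \<le> R \<Longrightarrow> norm (f z) \<le> b"
      by (fastforce simp: bounded_iff)
    show thesis
    proof (rule that[of "max b 1"])
      show "norm (f z) \<le> max b 1" if "z \<in> S" for z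
        using b[OF that] R that by (cases "norm z \<le> R") (auto simp: le_max_iff_disj not_le less_imp_le)
    qed auto
  qed
  have "\<exists>g\<in>V. \<forall>z\<in>S. norm (f z - g z) \<le> \<delta>" if \<delta>: "\<delta> > 0" for \<delta>
  proof -
    \<comment> \<open>The translation will cost \<open>2 * \<eta>\<close> and the cutoff
      \<open>6 * \<eta>\<close>.\<close>
    define \<eta> where "\<eta> = \<delta> / 8"
    have \<eta>: "\<eta> > 0" using \<delta> by (simp add: \<eta>_def)
    obtain R where R: "R > 0" "\<And>z. z \<in> S \<Longrightarrow> R \<le> norm z \<Longrightarrow> norm (f z) < \<eta>" using small[OF \<eta>] by auto
    have "uniformly_continuous_on (S \<inter> cball 0 (R + 2)) f"
      using compact cont' by (intro compact_uniformly_continuous)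
    then obtain e where e: "e > 0"
      "\<And>z w. \<lbrakk>z \<in> S \<inter> cball 0 (R + 2); w \<in> S \<inter> cball 0 (R + 2); dist w z < e\<rbrakk> \<Longrightarrow> dist (f w) (f z) < \<eta>"
      using \<eta> unfolding uniformly_continuous_on_def by meson
    define \<epsilon> where "\<epsilon> = min 1 (e / 2)"
    have \<epsilon>: "0 < \<epsilon>" "\<epsilon> \<le> 1" "\<epsilon> < e" using e by (auto simp: \<epsilon>_def)
    \<comment> \<open>Makes the cutoff error at most \<open>\<eta>\<close> for
      \<open>norm z \<le> R + 1\<close>.\<close>
    define k where "k = 6 * B * (R + 1 + offset) / \<eta>"
    have k: "k > 0" using B R offset_ge \<eta> by (simp add: k_def)
    define g where "g = (\<lambda>z. f (z + of_real \<epsilon>) * cutoff offset k z)"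
    have "g \<in> V"
      unfolding g_def
    proof (rule cutoff_mult_in_uniform_subspace[OF V base \<epsilon>(1,2) k shift_holomorphic[OF hol]])
      show "norm (f (z + of_real \<epsilon>)) \<le> B" if "z \<in> epi_domain (\<lambda>y. \<psi> y - \<epsilon>)" for z
      proof (rule B)
        have "z + of_real \<epsilon> \<in> epi_domain \<psi>" using that by (auto simp: epi_domain_def)
        then show "z + of_real \<epsilon> \<in> S" using closure_subset by (auto simp: S_def)
      qed
    qed auto
    moreover have "norm (f z - g z) \<le> \<delta>" if z: "z \<in> S" for z
    proof -
      define z' where "z' = z + of_real \<epsilon>"
      have z': "z' \<in> S" using shift_in_epi_domain[of z \<epsilon>] z \<epsilon> closure_subset by (auto simp: S_def z'_def)
      have nz': "norm z' \<le> norm z + 1" "norm z \<le> norm z' + 1"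
        using norm_triangle_ineq[of z "of_real \<epsilon>"] norm_triangle_ineq4[of z' "of_real \<epsilon>"] \<epsilon> by (auto simp: z'_def)
      have far: "\<psi> (Im z) - 1 \<le> Re z" using epi_domain_le_of_closure[of z] z by (simp add: S_def)
      note cb = cutoff_bounds[OF k offset_far(2)[OF far]]
      have "norm (f z - f z') \<le> 2 * \<eta>"
      proof (cases "norm z \<le> R + 1")
        case True
        have "dist (f z') (f z) < \<eta>"
        proof (rule e(2))
          show "dist z' z < e" using \<epsilon> by (simp add: z'_def dist_norm)
        qed (use z z' nz' True in auto)
        then show ?thesis using \<eta> by (simp add: dist_norm norm_minus_commute)
      next
        case False
        then have "norm (f z) < \<eta>" "norm (f z') < \<eta>" using R(2) z z' nz' by auto
        then show ?thesis using norm_triangle_ineq4[of "f z" "f z'"] by simp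
      qed
      moreover have "norm (f z') * norm (1 - cutoff offset k z) \<le> 6 * \<eta>"
      proof (cases "norm z \<le> R + 1")
        case True
        have "norm (z + of_real offset) \<le> R + 1 + offset"
          using norm_triangle_ineq[of z "of_real offset"] True offset_ge by simp
        then have "6 * norm (z + of_real offset) / k \<le> 6 * (R + 1 + offset) / k"
          using k by (intro divide_right_mono) auto
        then have "norm (1 - cutoff offset k z) \<le> 6 * (R + 1 + offset) / k"
          using cb(4) unfolding cutoff_def by linarith
        then have "norm (f z') * norm (1 - cutoff offset k z) \<le> B * (6 * (R + 1 + offset) / k)"
          using B(2)[OF z'] B(1) by (intro mult_mono) auto
        also have "\<dots> = \<eta>" using B R offset_ge \<eta> by (simp add: k_def)
        finally show ?thesis using \<eta> by simp
      next
        case False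
        then have "norm (f z') < \<eta>" using R(2) z' nz' by auto
        then have "norm (f z') * norm (1 - cutoff offset k z) \<le> \<eta> * 6"
          using cb(3) \<eta> by (intro mult_mono) (auto simp: cutoff_def)
        then show ?thesis by simp
      qed
      moreover have "norm (f z - g z) \<le> norm (f z - f z') + norm (f z') * norm (1 - cutoff offset k z)"
      proof -
        have "f z - g z = (f z - f z') + f z' * (1 - cutoff offset k z)"
          by (simp add: g_def z'_def algebra_simps)
        then show ?thesis by (metis norm_mult norm_triangle_ineq)
      qed
      ultimately show ?thesis by (simp add: \<eta>_def)
    qed
    ultimately show ?thesis by blast
  qed
  then show ?thesis using V by (auto simp: uniform_subspace_def S_def)
qed

end

section \<open>Laplace transforms of bounded densities\<close>

definition laplace_density :: "(complex \<Rightarrow> complex) set" where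
  "laplace_density = {g. \<exists>(h :: real \<Rightarrow> complex) T B. 0 \<le> T \<and> h \<in> borel_measurable borel \<and>
     (\<forall>s. norm (h s) \<le> B) \<and> (\<forall>s. s \<notin> {0<..T} \<longrightarrow> h s = 0) \<and>
     (\<forall>z. g z = integral\<^sup>L lborel (\<lambda>s. h s * exp (- complex_of_real s * z)))}"

lemma laplace_density_integrable:
  fixes h :: "real \<Rightarrow> complex"
  assumes "h \<in> borel_measurable borel" "\<And>s. norm (h s) \<le> B" "\<And>s. s \<notin> {0<..T} \<Longrightarrow> h s = 0"
  shows "integrable lborel (\<lambda>s. h s * exp (- complex_of_real s * z))"
proof (rule integrableI_bounded_set[where A = "{0<..T}" and B = "B * exp (T * norm z)"])
  have "norm (h s * exp (- complex_of_real s * z)) \<le> B * exp (T * norm z)" if "s \<in> {0<..T}" for s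
  proof -
    have "- s * Re z \<le> T * norm z"
    proof -
      have "- Re z \<le> norm z" using abs_Re_le_cmod[of z] by linarith
      then have "s * (- Re z) \<le> s * norm z" using that by (intro mult_left_mono) auto
      then have "- s * Re z \<le> s * norm z" by simp
      also have "\<dots> \<le> T * norm z" using that by (intro mult_right_mono) auto
      finally show ?thesis .
    qed
    then show ?thesis
      unfolding norm_mult using assms(2)[of s] order_trans[OF norm_ge_zero assms(2)]
      by (intro mult_mono) auto
  qed
  then show "AE s in lborel. s \<in> {0<..T} \<longrightarrow> norm (h s * exp (- complex_of_real s * z)) \<le> B * exp (T * norm z)"
    by auto
  show "(\<lambda>s. h s * exp (- complex_of_real s * z)) \<in> borel_measurable lborel"
    using assms(1) by measurable
  show "emeasure lborel {0<..T} < \<infinity>"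
    by (cases "0 \<le> T") (auto simp: emeasure_lborel_Ioc)
qed (use assms(3) in auto)

text \<open>With Lebesgue measure as common reference the densities simply add, whereas each element
  of \<open>LM\<close> comes with a measure of its own.\<close>

lemma laplace_density_add:
  assumes "f \<in> laplace_density" "g \<in> laplace_density"
  shows "(\<lambda>z. f z + g z) \<in> laplace_density"
proof -
  obtain h T B where h: "0 \<le> T" "h \<in> borel_measurable borel" "\<And>s. norm (h s) \<le> B" "\<And>s. s \<notin> {0<..T} \<Longrightarrow> h s = 0"
    "\<And>z. f z = integral\<^sup>L lborel (\<lambda>s. h s * exp (- complex_of_real s * z))"
    using assms(1) unfolding laplace_density_def by blast
  obtain h' T' B' where h': "0 \<le> T'" "h' \<in> borel_measurable borel" "\<And>s. norm (h' s) \<le> B'" "\<And>s. s \<notin> {0<..T'} \<Longrightarrow> h' s = 0"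
    "\<And>z. g z = integral\<^sup>L lborel (\<lambda>s. h' s * exp (- complex_of_real s * z))"
    using assms(2) unfolding laplace_density_def by blast
  show ?thesis
    unfolding laplace_density_def
  proof (intro CollectI exI conjI allI impI)
    show "0 \<le> max T T'" using h by simp
    show "(\<lambda>s. h s + h' s) \<in> borel_measurable borel" using h h' by measurable
    show "norm (h s + h' s) \<le> B + B'" for s
      by (intro order_trans[OF norm_triangle_ineq] add_mono h h')
    show "h s + h' s = 0" if "s \<notin> {0<..max T T'}" for s
      using that h(4)[of s] h'(4)[of s] by (auto simp: le_max_iff_disj)
    show "f z + g z = integral\<^sup>L lborel (\<lambda>s. (h s + h' s) * exp (- complex_of_real s * z))" for z
      unfolding h(5) h'(5) distrib_right
      by (rule Bochner_Integration.integral_add[symmetric, OF laplace_density_integrable[OF h(2-4)]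
            laplace_density_integrable[OF h'(2-4)]])
  qed
qed

lemma laplace_density_cmult:
  assumes "f \<in> laplace_density"
  shows "(\<lambda>z. c * f z) \<in> laplace_density"
proof -
  obtain h T B where h: "0 \<le> T" "h \<in> borel_measurable borel" "\<And>s. norm (h s) \<le> B" "\<And>s. s \<notin> {0<..T} \<Longrightarrow> h s = 0"
    "\<And>z. f z = integral\<^sup>L lborel (\<lambda>s. h s * exp (- complex_of_real s * z))"
    using assms unfolding laplace_density_def by blast
  show ?thesis
    unfolding laplace_density_def
  proof (intro CollectI exI conjI allI impI)
    show "(\<lambda>s. c * h s) \<in> borel_measurable borel" using h by measurable
    show "norm (c * h s) \<le> norm c * B" for s
      unfolding norm_mult by (intro mult_left_mono h) auto
    show "c * f z = integral\<^sup>L lborel (\<lambda>s. c * h s * exp (- complex_of_real s * z))" for z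
      unfolding h(5) mult.assoc by simp
  qed (use h in auto)
qed

text \<open>The map \<open>s \<mapsto> max 0 (s - 1)\<close> sends Lebesgue measure on \<open>[0, T + 1]\<close> to the sum of a unit point
  mass at 0 and Lebesgue measure on \<open>[0, T]\<close>; the atom produces the constant \<open>a\<close>.\<close>

lemma laplace_density_plus_const_in_LM:
  assumes "f \<in> laplace_density"
  shows "(\<lambda>z. f z + a) \<in> LM"
proof -
  obtain h T B where h: "0 \<le> T" "h \<in> borel_measurable borel" "\<And>s. norm (h s) \<le> B" "\<And>s. s \<notin> {0<..T} \<Longrightarrow> h s = 0"
    "\<And>z. f z = integral\<^sup>L lborel (\<lambda>s. h s * exp (- complex_of_real s * z))"
    using assms unfolding laplace_density_def by blast
  note [measurable] = h(2)
  define X where "X = (\<lambda>s::real. max 0 (s - 1))"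
  have [measurable]: "X \<in> borel_measurable borel" unfolding X_def by measurable
  define D where "D = density lborel (\<lambda>s. ennreal (indicator {0..T + 1} s))"
  define M where "M = distr D borel X"
  define h' where "h' = (\<lambda>s. if s = 0 then a else h s)"
  have [measurable]: "h' \<in> borel_measurable borel" unfolding h'_def by measurable
  have D_space: "emeasure D (space D) = ennreal (T + 1)"
  proof -
    have "emeasure D UNIV = emeasure lborel {0..T + 1}"
      unfolding D_def by (subst emeasure_density) (auto simp: nn_integral_indicator ennreal_indicator)
    then show ?thesis using h(1) by (simp add: D_def)
  qed
  show ?thesis
    unfolding LM_def
  proof (intro CollectI exI conjI allI)
    show "sets M = sets borel" by (simp add: M_def)
    have "finite_measure D" by (rule finite_measureI) (simp add: D_space)
    then show "finite_measure M"
      unfolding M_def by (rule finite_measure.finite_measure_distr) (simp add: D_def)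
    show "0 \<le> T" by (rule h)
    have "emeasure M (UNIV - {0..T}) = emeasure D (X -` (UNIV - {0..T}) \<inter> space D)"
      unfolding M_def by (rule emeasure_distr) (auto simp: D_def)
    also have "X -` (UNIV - {0..T}) \<inter> space D = {T + 1<..}"
      using h(1) by (auto simp: X_def D_def)
    also have "emeasure D {T + 1<..} = 0"
      proof -
      have "(\<lambda>x. ennreal (indicator {0..T + 1} x) * indicator {T + 1<..} x) = (\<lambda>_. 0)"
        by (auto simp: fun_eq_iff indicator_def)
      then show ?thesis unfolding D_def by (subst emeasure_density) auto
    qed
    finally show "emeasure M (UNIV - {0..T}) = 0" .
    show "h' \<in> borel_measurable borel" by measurable
    show "norm (h' s) \<le> max B (norm a)" for s using h(3) by (auto simp: h'_def le_max_iff_disj)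
    fix z
    define E where "E = (\<lambda>s. exp (- complex_of_real s * z))"
    have [measurable]: "E \<in> borel_measurable borel" unfolding E_def by measurable
    have int1: "integrable lborel (\<lambda>s. indicator {0..1::real} s *\<^sub>R a)" by simp
    have "integrable lborel (\<lambda>s. h s * E s)"
      unfolding E_def by (rule laplace_density_integrable[OF h(2-4)])
    from lborel_integrable_real_affine[OF this, of 1 "-1"]
    have int2: "integrable lborel (\<lambda>s. h (s - 1) * E (s - 1))" by simp
    have "integral\<^sup>L M (\<lambda>s. h' s * E s) = integral\<^sup>L D (\<lambda>s. h' (X s) * E (X s))"
      unfolding M_def by (rule integral_distr) (auto simp: D_def)
    also have "\<dots> = integral\<^sup>L lborel (\<lambda>s. indicator {0..T + 1} s *\<^sub>R (h' (X s) * E (X s)))"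
      unfolding D_def by (rule integral_density) auto
    \<comment> \<open>The shifted density vanishes for \<open>s \<le> 1\<close>, also at
      \<open>s = 1\<close> because 0 is excluded from the support of \<open>h\<close>; so the two
      summands do not overlap.\<close>
    also have "(\<lambda>s. indicator {0..T + 1} s *\<^sub>R (h' (X s) * E (X s)))
       = (\<lambda>s. indicator {0..1} s *\<^sub>R a + h (s - 1) * E (s - 1))"
      using h(1) h(4) by (auto simp: fun_eq_iff X_def h'_def E_def indicator_def max_def)
    also have "integral\<^sup>L lborel \<dots> = integral\<^sup>L lborel (\<lambda>s. indicator {0..1::real} s *\<^sub>R a)
       + integral\<^sup>L lborel (\<lambda>s. h (s - 1) * E (s - 1))"
      by (rule Bochner_Integration.integral_add[OF int1 int2])
    also have "integral\<^sup>L lborel (\<lambda>s. h (s - 1) * E (s - 1)) = f z"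
      using lborel_integral_real_affine[of 1 "\<lambda>s. h s * E s" "-1"] by (simp add: h(5) E_def)
    also have "integral\<^sup>L lborel (\<lambda>s. indicator {0..1::real} s *\<^sub>R a) = a" by simp
    finally show "f z + a = integral\<^sup>L M (\<lambda>s. h' s * exp (- complex_of_real s * z))"
      by (simp add: E_def)
  qed
qed

lemma laplace_beta_in_laplace_density:
  assumes N: "N > 0"
  shows "(\<lambda>z. laplace_beta N N (z - w)) \<in> laplace_density"
proof -
  define h where "h = (\<lambda>s. indicator {0<..real N} s *\<^sub>R (of_real ((1 - s / real N) ^ N) * exp (of_real s * w)))"
  show ?thesis
    unfolding laplace_density_def
  proof (intro CollectI exI conjI allI impI)
    show "0 \<le> real N" by simp
    show "h \<in> borel_measurable borel" unfolding h_def by measurable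
    show "norm (h s) \<le> exp (real N * norm w)" for s
    proof (cases "s \<in> {0<..real N}")
      case True
      have "(1 - s / real N) ^ N \<le> 1" "0 \<le> 1 - s / real N" using True N by (auto intro!: power_le_one)
      moreover have "s * Re w \<le> real N * norm w"
        using True complex_Re_le_cmod[of w]
        by (intro order_trans[OF mult_left_mono mult_right_mono]) auto
      moreover have "norm (h s) = \<bar>(1 - s / real N) ^ N\<bar> * exp (s * Re w)"
      proof -
        have "norm (h s) = norm (complex_of_real ((1 - s / real N) ^ N)) * norm (exp (of_real s * w))"
          using True unfolding h_def norm_mult [symmetric] by simp
        then show ?thesis unfolding norm_of_real by simp
      qed
      moreover have "0 \<le> (1 - s / real N) ^ N" using \<open>0 \<le> 1 - s / real N\<close> by simp
      ultimately show ?thesis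
        using mult_mono[of "(1 - s / real N) ^ N" 1 "exp (s * Re w)" "exp (real N * norm w)"] by simp
    qed (simp add: h_def)
    show "h s = 0" if "s \<notin> {0<..real N}" for s using that by (simp add: h_def)
    fix z
    define k where "k = (\<lambda>s. complex_of_real ((1 - s / real N) ^ N) * exp (- of_real s * (z - w)))"
    have "set_integrable lborel {0..real N} k"
      unfolding set_integrable_def
      by (rule borel_integrable_compact) (use N in \<open>auto simp: k_def intro!: continuous_intros\<close>)
    then have int: "set_integrable lborel {0<..real N} k"
      by (rule set_integrable_subset) auto
    have "laplace_beta N N (z - w) = integral {0..real N} k"
      by (simp add: laplace_beta_def k_def)
    \<comment> \<open>Dropping the endpoint costs nothing and keeps 0 free for the point mass that
      carries the constant.\<close>
    also have "\<dots> = integral {0<..real N} k"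
      by (rule integral_spike_set; rule negligible_subset[of "{0}"]) auto
    also have "\<dots> = (LINT s:{0<..real N}|lborel. k s)"
      using set_borel_integral_eq_integral(2)[OF int] by simp
    also have "\<dots> = integral\<^sup>L lborel (\<lambda>s. h s * exp (- complex_of_real s * z))"
      unfolding set_lebesgue_integral_def
      by (rule arg_cong[of _ _ "integral\<^sup>L lborel"])
         (auto simp: h_def k_def fun_eq_iff exp_diff exp_minus exp_add[symmetric] algebra_simps divide_inverse)
    finally show "laplace_beta N N (z - w) = integral\<^sup>L lborel (\<lambda>s. h s * exp (- complex_of_real s * z))" .
  qed
qed

text \<open>The recursion spares differentiation under the integral sign. It says nothing at 0,
  which is harmless: \<open>z - w\<close> has modulus at least 2 on the closed domain.\<close>

lemma laplace_beta_holomorphic: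
  assumes N: "N > 0"
  shows "laplace_beta N m holomorphic_on - {0}"
proof (induction m)
  case 0
  have "(\<lambda>z. (1 - exp (- of_nat N * z)) / z) holomorphic_on - {0}"
    by (intro holomorphic_intros) auto
  then show ?case
    by (rule holomorphic_transform) (use laplace_beta_0[OF N] in \<open>auto simp: field_simps\<close>)
next
  case (Suc m)
  have "(\<lambda>z. (1 - of_real (real (Suc m) / real N) * laplace_beta N m z) / z) holomorphic_on - {0}"
    by (intro holomorphic_intros Suc) auto
  then show ?case
  proof (rule holomorphic_transform)
    show "(1 - of_real (real (Suc m) / real N) * laplace_beta N m z) / z = laplace_beta N (Suc m) z"
      if "z \<in> - {0}" for z
      unfolding laplace_beta_Suc[OF N, symmetric] using that by simp
  qed
qed

lemma disc_alg_add:
  assumes "f \<in> disc_alg \<Omega>" "g \<in> disc_alg \<Omega>"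
  shows "(\<lambda>z. f z + g z) \<in> disc_alg \<Omega>"
proof -
  obtain l m where "(f \<longlongrightarrow> l) (inf at_infinity (principal (closure \<Omega>)))"
    "(g \<longlongrightarrow> m) (inf at_infinity (principal (closure \<Omega>)))"
    using assms by (auto simp: disc_alg_def)
  then have "((\<lambda>z. f z + g z) \<longlongrightarrow> l + m) (inf at_infinity (principal (closure \<Omega>)))"
    by (rule tendsto_add)
  then show ?thesis
    using assms unfolding disc_alg_def by (blast intro: continuous_on_add holomorphic_on_add)
qed

lemma disc_alg_const: "(\<lambda>z. c) \<in> disc_alg \<Omega>"
  unfolding disc_alg_def mem_Collect_eq
  by (intro conjI continuous_on_const holomorphic_on_const exI[of _ c] tendsto_const)

lemma disc_alg_cmult:
  assumes "f \<in> disc_alg \<Omega>"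
  shows "(\<lambda>z. c * f z) \<in> disc_alg \<Omega>"
proof -
  obtain l where "(f \<longlongrightarrow> l) (inf at_infinity (principal (closure \<Omega>)))"
    using assms by (auto simp: disc_alg_def)
  then have "((\<lambda>z. c * f z) \<longlongrightarrow> c * l) (inf at_infinity (principal (closure \<Omega>)))"
    by (rule tendsto_mult_left)
  then show ?thesis
    using assms by (auto simp: disc_alg_def intro!: continuous_intros holomorphic_intros exI[of _ "c * l"])
qed

context log_graph
begin

lemma laplace_beta_in_disc_alg:
  assumes N: "N > 0" and w: "Re w \<le> - ln (A * (1 + \<bar>Im w\<bar>)) - 4"
  shows "(\<lambda>z. laplace_beta N N (z - w)) \<in> disc_alg (epi_domain \<psi>)"
proof -
  have far: "2 \<le> norm (z - w)" "exp (- Re (z - w)) \<le> norm (z - w) / 2" if "z \<in> closure (epi_domain \<psi>)" for z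
  proof -
    have "z + of_real (- Re w) - \<i> * of_real (Im w) = z - w" by (simp add: complex_eq_iff)
    note eq = this
    have "ln (A * (1 + \<bar>Im w\<bar>)) + 4 \<le> - Re w" using w by simp
    from far_left(1,2)[OF epi_domain_le_of_closure[OF that] this, unfolded eq]
    show "2 \<le> norm (z - w)" "exp (- Re (z - w)) \<le> norm (z - w) / 2" .
  qed
  have "(laplace_beta N N \<circ> (\<lambda>z. z - w)) holomorphic_on - {w}"
    by (rule holomorphic_on_compose_gen[OF _ laplace_beta_holomorphic[OF N]]) (auto intro!: holomorphic_intros)
  then have hol: "(\<lambda>z. laplace_beta N N (z - w)) holomorphic_on - {w}" by (simp add: o_def)
  have sub: "closure (epi_domain \<psi>) \<subseteq> - {w}" using far(1) by force
  have "filterlim (\<lambda>z. laplace_beta N N (z - w)) (nhds 0) (inf at_infinity (principal (closure (epi_domain \<psi>))))"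
  proof (rule Lim_null_comparison)
    show "\<forall>\<^sub>F z in inf at_infinity (principal (closure (epi_domain \<psi>))). norm (laplace_beta N N (z - w)) \<le> norm (4 / (z - w))"
      unfolding eventually_inf_principal
      using norm_laplace_beta_le[OF N] far by (auto simp: norm_divide)
    have "filterlim (\<lambda>z. z + - w) at_infinity at_infinity"
      by (rule tendsto_add_filterlim_at_infinity'[OF filterlim_ident tendsto_const])
    then have "((\<lambda>z. 4 / (z - w)) \<longlongrightarrow> 0) at_infinity"
      by (intro tendsto_divide_0[OF tendsto_const]) simp
    then show "((\<lambda>z. norm (4 / (z - w))) \<longlongrightarrow> 0) (inf at_infinity (principal (closure (epi_domain \<psi>))))"
      by (intro tendsto_norm_zero tendsto_mono[OF inf_le1])
  qed
  moreover have "continuous_on (closure (epi_domain \<psi>)) (\<lambda>z. laplace_beta N N (z - w))"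
    using holomorphic_on_imp_continuous_on[OF hol] sub continuous_on_subset by blast
  moreover have "(\<lambda>z. laplace_beta N N (z - w)) holomorphic_on epi_domain \<psi>"
    using hol sub closure_subset holomorphic_on_subset by blast
  ultimately show ?thesis unfolding disc_alg_def by blast
qed

text \<open>The space \<open>V\<close> is the uniform closure of the density transforms lying in the
  disc algebra. Subtracting the limit \<open>l\<close> at infinity makes \<open>f\<close> vanish
  there; \<open>l\<close> is restored in the end as a point mass at 0.\<close>

lemma LM_dense_disc_alg:
  assumes f: "f \<in> disc_alg (epi_domain \<psi>)" and \<epsilon>: "\<epsilon> > 0"
  shows "\<exists>g\<in>LM \<inter> disc_alg (epi_domain \<psi>). \<forall>z\<in>closure (epi_domain \<psi>). norm (f z - g z) \<le> \<epsilon>"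
proof -
  define L where "L = laplace_density \<inter> disc_alg (epi_domain \<psi>)"
  define V where "V = {f. \<forall>\<epsilon>>0. \<exists>g\<in>L. \<forall>z\<in>closure (epi_domain \<psi>). norm (f z - g z) \<le> \<epsilon>}"
  have LV: "g \<in> V" if "g \<in> L" for g using that by (auto simp: V_def intro!: bexI[of _ g])
  have zero: "(\<lambda>z. 0) \<in> L"
    using laplace_density_cmult[OF laplace_beta_in_laplace_density[of 1], of 0] disc_alg_const[of 0]
    by (simp add: L_def)
  have V: "uniform_subspace (closure (epi_domain \<psi>)) V"
    unfolding uniform_subspace_def
  proof (intro conjI ballI allI impI)
    show "(\<lambda>z. 0) \<in> V" by (rule LV[OF zero])
    show "(\<lambda>z. f z + g z) \<in> V" if fg: "f \<in> V" "g \<in> V" for f g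
      unfolding V_def
    proof (intro CollectI allI impI)
      fix e :: real assume "e > 0"
      then have "e / 2 > 0" by simp
      then obtain f' g' where fg': "f' \<in> L" "g' \<in> L" "\<forall>z\<in>closure (epi_domain \<psi>). norm (f z - f' z) \<le> e / 2"
        "\<forall>z\<in>closure (epi_domain \<psi>). norm (g z - g' z) \<le> e / 2"
        using fg unfolding V_def by blast
      show "\<exists>g'\<in>L. \<forall>z\<in>closure (epi_domain \<psi>). norm (f z + g z - g' z) \<le> e"
      proof (intro bexI[of _ "\<lambda>z. f' z + g' z"] ballI)
        fix z assume "z \<in> closure (epi_domain \<psi>)"
        then show "norm (f z + g z - (f' z + g' z)) \<le> e"
          using fg'(3,4) norm_triangle_ineq[of "f z - f' z" "g z - g' z"] by (fastforce simp: add_diff_add)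
      next
        show "(\<lambda>z. f' z + g' z) \<in> L"
          using fg'(1,2) unfolding L_def by (blast intro: laplace_density_add disc_alg_add)
      qed
    qed
    show "(\<lambda>z. c * f z) \<in> V" if f: "f \<in> V" for f c
      unfolding V_def
    proof (intro CollectI allI impI)
      fix e :: real assume e: "e > 0"
      then have "e / (norm c + 1) > 0" by (simp add: add_nonneg_pos)
      then obtain f' where f': "f' \<in> L" "\<forall>z\<in>closure (epi_domain \<psi>). norm (f z - f' z) \<le> e / (norm c + 1)"
        using f unfolding V_def by blast
      have "norm (c * f z - c * f' z) \<le> e" if z: "z \<in> closure (epi_domain \<psi>)" for z
      proof -
        have "norm (c * f z - c * f' z) = norm c * norm (f z - f' z)"
          by (simp add: norm_mult flip: right_diff_distrib)
        also have "\<dots> \<le> (norm c + 1) * (e / (norm c + 1))"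
          using f' z by (intro mult_mono) auto
        also have "\<dots> = e" by (simp add: add_nonneg_eq_0_iff)
        finally show ?thesis .
      qed
      then show "\<exists>g\<in>L. \<forall>z\<in>closure (epi_domain \<psi>). norm (c * f z - g z) \<le> e"
        using f' by (intro bexI[of _ "\<lambda>z. c * f' z"]) (auto simp: L_def laplace_density_cmult disc_alg_cmult)
    qed
    show "f \<in> V" if f: "\<forall>\<epsilon>>0. \<exists>g\<in>V. \<forall>z\<in>closure (epi_domain \<psi>). norm (f z - g z) \<le> \<epsilon>" for f
      unfolding V_def
    proof (intro CollectI allI impI)
      fix e :: real assume "e > 0"
      then have e: "e / 2 > 0" by simp
      then obtain g where g: "g \<in> V" "\<forall>z\<in>closure (epi_domain \<psi>). norm (f z - g z) \<le> e / 2"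
        using f by blast
      then obtain g' where g': "g' \<in> L" "\<forall>z\<in>closure (epi_domain \<psi>). norm (g z - g' z) \<le> e / 2"
        using e unfolding V_def by blast
      have "norm (f z - g' z) \<le> e" if "z \<in> closure (epi_domain \<psi>)" for z
        using g(2) g'(2) that norm_triangle_ineq[of "f z - g z" "g z - g' z"] by fastforce
      then show "\<exists>g\<in>L. \<forall>z\<in>closure (epi_domain \<psi>). norm (f z - g z) \<le> e" using g' by blast
    qed
  qed
  obtain l where l: "filterlim f (nhds l) (inf at_infinity (principal (closure (epi_domain \<psi>))))"
    and cont: "continuous_on (closure (epi_domain \<psi>)) f" and hol: "f holomorphic_on epi_domain \<psi>"
    using f by (auto simp: disc_alg_def)
  have "(\<lambda>z. f z - l) \<in> V"
  proof (rule vanishing_at_infinity_in_uniform_subspace[OF V])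
    show "(\<lambda>z. laplace_beta N N (z - w)) \<in> V" if "N > 0" "Re w \<le> - ln (A * (1 + \<bar>Im w\<bar>)) - 4" for N w
      using laplace_beta_in_laplace_density[of N w] laplace_beta_in_disc_alg[of N w] that by (intro LV) (simp add: L_def)
    show "filterlim (\<lambda>z. f z - l) (nhds 0) (inf at_infinity (principal (closure (epi_domain \<psi>))))"
      using tendsto_diff[OF l tendsto_const[of l]] by simp
  qed (auto intro!: continuous_intros holomorphic_intros cont hol)
  then obtain g where g: "g \<in> L" "\<forall>z\<in>closure (epi_domain \<psi>). norm (f z - l - g z) \<le> \<epsilon>"
    using \<epsilon> unfolding V_def by blast
  show ?thesis
  proof (intro bexI[of _ "\<lambda>z. g z + l"] ballI)
    show "(\<lambda>z. g z + l) \<in> LM \<inter> disc_alg (epi_domain \<psi>)"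
      using g laplace_density_plus_const_in_LM[of g l] disc_alg_add[OF _ disc_alg_const] by (auto simp: L_def)
    show "norm (f z - (g z + l)) \<le> \<epsilon>" if "z \<in> closure (epi_domain \<psi>)" for z
      using g(2) that by (simp add: algebra_simps)
  qed
qed

end

section \<open>Approximation by exponentials\<close>

lemma harmonic_on_Re_holomorphic:
  assumes S: "open S" "simply_connected S" and u: "harmonic_on S u"
  obtains H where "H holomorphic_on S" "\<And>z. z \<in> S \<Longrightarrow> u z = Re (H z)"
proof -
  obtain r F where r: "\<And>z. z \<in> S \<Longrightarrow> r z > 0 \<and> ball z (r z) \<subseteq> S"
    and F: "\<And>z. z \<in> S \<Longrightarrow> F z holomorphic_on ball z (r z) \<and> (\<forall>w\<in>ball z (r z). u w = Re (F z w))"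
    using u unfolding harmonic_on_def by metis
  \<comment> \<open>A nonconstant holomorphic map is open, but the imaginary axis has empty
    interior. So two holomorphic functions with the same real part differ by a constant.\<close>
  have const: "\<exists>c. \<forall>w\<in>U. G w = c" if "G holomorphic_on U" "open U" "connected U" "\<And>w. w \<in> U \<Longrightarrow> Re (G w) = 0" for G U
  proof (cases "U = {}")
    case False
    have "G constant_on U"
    proof (rule ccontr)
      assume "\<not> G constant_on U"
      then have "open (G ` U)" using open_mapping_thm[OF that(1,2,3,2)] by auto
      moreover have "G ` U \<subseteq> {z. Re z = 0}" using that(4) by auto
      ultimately have "G ` U \<subseteq> interior {z. Re z = 0}" by (rule interior_maximal[rotated])
      moreover have "interior {z. Re z = 0} = {}"
      proof -
        have "{z. Re z = 0} = {z. (1::complex) \<bullet> z = 0}" by (auto simp: inner_complex_def)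
        then show ?thesis using interior_hyperplane[of "1::complex" 0] by simp
      qed
      ultimately show False using False by auto
    qed
    then show ?thesis by (auto simp: constant_on_def)
  qed auto
  \<comment> \<open>The local functions \<open>F z\<close> need not fit together, but their
    derivatives do; simple connectedness then supplies a primitive of the glued derivative.\<close>
  define d where "d = (\<lambda>z. deriv (F z) z)"
  have d_eq: "d w = deriv (F z) w" if zS: "z \<in> S" and w: "w \<in> ball z (r z)" for z w
  proof -
    have wS: "w \<in> S" using r zS w by blast
    define U where "U = ball z (r z) \<inter> ball w (r w)"
    have U: "open U" "connected U" "w \<in> U" using r[OF wS] w
      by (auto simp: U_def intro!: convex_connected convex_Int)
    have hol: "F w holomorphic_on U" "F z holomorphic_on U"
      using F[OF zS] F[OF wS] by (auto simp: U_def intro: holomorphic_on_subset)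
    have "\<exists>c. \<forall>v\<in>U. F w v - F z v = c"
    proof (rule const[OF _ U(1,2)])
      show "(\<lambda>v. F w v - F z v) holomorphic_on U" by (intro holomorphic_intros hol)
      fix v assume "v \<in> U"
      then have "u v = Re (F z v)" "u v = Re (F w v)"
        using F[OF zS] F[OF wS] unfolding U_def by blast+
      then show "Re (F w v - F z v) = 0" by simp
    qed
    then obtain c where "\<forall>v\<in>U. F w v - F z v = c" by blast
    then have "\<forall>\<^sub>F v in nhds w. F w v = F z v + c"
      using U(1,3) by (auto simp: eventually_nhds algebra_simps intro!: exI[of _ U])
    then have "deriv (F w) w = deriv (\<lambda>v. F z v + c) w"
      by (intro deriv_cong_ev) auto
    also have "\<dots> = deriv (F z) w"
    proof -
      have "F z field_differentiable at w"
        using F[OF zS] w holomorphic_on_imp_differentiable_at[of "F z" "ball z (r z)" w] by auto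
      then show ?thesis by simp
    qed
    finally show ?thesis by (simp add: d_def)
  qed
  have "d field_differentiable (at z within S)" if z: "z \<in> S" for z
  proof -
    have "deriv (F z) holomorphic_on ball z (r z)" using F[OF z] by (intro holomorphic_deriv) auto
    then have "d holomorphic_on ball z (r z)"
      by (rule holomorphic_transform) (use d_eq z in auto)
    then show ?thesis
      using r[OF z] holomorphic_on_imp_differentiable_at[of d "ball z (r z)" z]
      by (auto intro: field_differentiable_at_within)
  qed
  then have "d holomorphic_on S" by (simp add: holomorphic_on_def)
  then obtain H where H: "\<And>z. z \<in> S \<Longrightarrow> (H has_field_derivative d z) (at z)"
    using S simply_connected_eq_global_primitive[OF S(1)] by metis
  have H_hol: "H holomorphic_on S"
    using H by (meson holomorphic_onI has_field_derivative_at_within field_differentiable_def)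
  have loc: "\<exists>c. \<forall>w\<in>ball z (r z). u w - Re (H w) = c" if z: "z \<in> S" for z
  proof -
    have "\<exists>c. \<forall>w\<in>ball z (r z). F z w - H w = c"
    proof (rule has_field_derivative_zero_constant)
      fix w assume w: "w \<in> ball z (r z)"
      have "(F z has_field_derivative deriv (F z) w) (at w)"
        using F[OF z] w holomorphic_derivI[of "F z" "ball z (r z)" w] by auto
      moreover have "(H has_field_derivative deriv (F z) w) (at w)"
        using H[of w] r[OF z] w d_eq[OF z w] by auto
      ultimately show "((\<lambda>w. F z w - H w) has_field_derivative 0) (at w within ball z (r z))"
        using DERIV_diff has_field_derivative_at_within by fastforce
    qed auto
    then obtain c where "\<forall>w\<in>ball z (r z). F z w - H w = c" by blast
    then have "\<forall>w\<in>ball z (r z). u w - Re (H w) = Re c"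
      using F[OF z] by (metis minus_complex.simps(1))
    then show ?thesis by blast
  qed
  have "(\<lambda>w. u w - Re (H w)) constant_on S"
  proof (rule locally_constant_imp_constant)
    show "connected S" using S simply_connected_imp_connected by blast
    fix z assume z: "z \<in> S"
    obtain c where "\<forall>w\<in>ball z (r z). u w - Re (H w) = c" using loc[OF z] by blast
    then show "\<exists>T. openin (top_of_set S) T \<and> z \<in> T \<and> (\<forall>x\<in>T. u x - Re (H x) = u z - Re (H z))"
      using r[OF z] by (intro exI[of _ "ball z (r z)"]) (auto intro!: open_subset)
  qed
  then obtain c where c: "\<And>z. z \<in> S \<Longrightarrow> u z - Re (H z) = c" by (auto simp: constant_on_def)
  show thesis
  proof (rule that[of "\<lambda>z. H z + of_real c"])
    show "(\<lambda>z. H z + of_real c) holomorphic_on S" by (intro holomorphic_intros H_hol)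
    show "u z = Re (H z + of_real c)" if "z \<in> S" for z using c[OF that] by simp
  qed
qed

lemma Riemann_map_based:
  assumes "open S" "simply_connected S" "S \<noteq> UNIV" "a \<in> S"
  obtains h \<phi> where "h holomorphic_on S" "\<phi> holomorphic_on ball 0 1" "h a = 0"
    "\<And>z. z \<in> S \<Longrightarrow> h z \<in> ball 0 1 \<and> \<phi> (h z) = z"
    "\<And>w. w \<in> ball 0 1 \<Longrightarrow> \<phi> w \<in> S \<and> h (\<phi> w) = w"
proof -
  obtain f g where fg: "f holomorphic_on S" "g holomorphic_on ball 0 1"
    "\<And>z. z \<in> S \<Longrightarrow> f z \<in> ball 0 1 \<and> g (f z) = z" "\<And>z. z \<in> ball 0 1 \<Longrightarrow> g z \<in> S \<and> f (g z) = z"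
    using Riemann_mapping_theorem[of S] assms by blast
  obtain b c where bc: "b (f a) = 0" "b holomorphic_on ball 0 1" "b ` ball 0 1 \<subseteq> ball 0 1"
    "c holomorphic_on ball 0 1" "c ` ball 0 1 \<subseteq> ball 0 1"
    "\<And>z. z \<in> ball 0 1 \<Longrightarrow> b (c z) = z" "\<And>z. z \<in> ball 0 1 \<Longrightarrow> c (b z) = z"
    using ball_biholomorphism_exists[of "f a"] fg(3)[OF assms(4)] by metis
  have bc': "b z \<in> ball 0 1" "c z \<in> ball 0 1" if "z \<in> ball 0 1" for z
    using bc(3,5) that by blast+
  show thesis
  proof (rule that[of "b \<circ> f" "g \<circ> c"])
    show "b \<circ> f holomorphic_on S" by (rule holomorphic_on_compose_gen[OF fg(1) bc(2)]) (use fg in auto)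
    show "g \<circ> c holomorphic_on ball 0 1" by (rule holomorphic_on_compose_gen[OF bc(4) fg(2) bc(5)])
    show "(b \<circ> f) a = 0" by (simp add: bc)
    show "(b \<circ> f) z \<in> ball 0 1 \<and> (g \<circ> c) ((b \<circ> f) z) = z" if "z \<in> S" for z
      using fg(3)[OF that] bc'(1) bc(7) by (simp del: mem_ball)
    show "(g \<circ> c) w \<in> S \<and> (b \<circ> f) ((g \<circ> c) w) = w" if "w \<in> ball 0 1" for w
      using fg(4)[OF bc'(2)[OF that]] bc(6)[OF that] by simp
  qed
qed

text \<open>Stands in for the triangle inequality: \<open>p\<close>-th powers are kept throughout,
  since it is for them that majorants add.\<close>

lemma norm_add_powr_le:
  fixes a b :: "'a::real_normed_vector"
  assumes "p > 0"
  shows "norm (a + b) powr p \<le> 2 powr p * (norm a powr p + norm b powr p)"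
proof -
  define m where "m = max (norm a) (norm b)"
  have "norm (a + b) \<le> 2 * m" using norm_triangle_ineq[of a b] by (simp add: m_def)
  then have "norm (a + b) powr p \<le> (2 * m) powr p" using assms by (intro powr_mono2) auto
  also have "\<dots> = 2 powr p * m powr p" by (rule powr_mult)
  also have "m powr p \<le> norm a powr p + norm b powr p"
    by (cases "norm a \<le> norm b") (auto simp: m_def max_def)
  finally show ?thesis by simp
qed

section \<open>Functions approximable by exponential sums\<close>

lemma exp_span_zero: "(\<lambda>z. 0) \<in> exp_span"
  unfolding exp_span_def by (auto intro!: exI[of _ "0::nat"])

lemma exp_span_cmult:
  assumes "f \<in> exp_span"
  shows "(\<lambda>z. a * f z) \<in> exp_span"
proof -
  obtain n c l where "\<forall>k<n. l k \<le> 0" "f = (\<lambda>z. \<Sum>k<(n::nat). c k * exp (complex_of_real (l k) * z))"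
    using assms unfolding exp_span_def by blast
  then show ?thesis
    unfolding exp_span_def
    by (intro CollectI exI[of _ n] exI[of _ "\<lambda>k. a * c k"] exI[of _ l])
       (auto simp: sum_distrib_left mult.assoc)
qed

lemma exp_span_add:
  assumes "f \<in> exp_span" "g \<in> exp_span"
  shows "(\<lambda>z. f z + g z) \<in> exp_span"
proof -
  obtain n c l where f: "\<forall>k<n. l k \<le> 0" "f = (\<lambda>z. \<Sum>k<(n::nat). c k * exp (complex_of_real (l k) * z))"
    using assms(1) unfolding exp_span_def by blast
  obtain n' c' l' where g: "\<forall>k<n'. l' k \<le> 0" "g = (\<lambda>z. \<Sum>k<(n'::nat). c' k * exp (complex_of_real (l' k) * z))"
    using assms(2) unfolding exp_span_def by blast
  have split: "(\<Sum>k<n + m. q k) = (\<Sum>k<n. q k) + (\<Sum>k<m. q (n + k))" for m and q :: "nat \<Rightarrow> complex"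
    by (induction m) (auto simp: algebra_simps)
  show ?thesis
    unfolding exp_span_def
    by (intro CollectI exI[of _ "n + n'"] exI[of _ "\<lambda>k. if k < n then c k else c' (k - n)"]
          exI[of _ "\<lambda>k. if k < n then l k else l' (k - n)"])
       (use f g in \<open>auto simp: split\<close>)
qed

lemma exp_span_sum:
  assumes "\<And>j. j < (n::nat) \<Longrightarrow> l j \<le> 0"
  shows "(\<lambda>z. \<Sum>j<n. c j * exp (complex_of_real (l j) * z)) \<in> exp_span"
  unfolding exp_span_def using assms by blast

definition exp_approximable :: "complex set \<Rightarrow> complex \<Rightarrow> real \<Rightarrow> (complex \<Rightarrow> complex) set" where
  "exp_approximable S a p =
     {f. \<forall>\<delta>>0. \<exists>g\<in>exp_span. majorized S a (\<lambda>z. norm (f z - g z) powr p) \<delta>}"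

lemma exp_approximable_trans:
  assumes p: "p > 0"
    and f: "\<And>\<delta>. \<delta> > 0 \<Longrightarrow> \<exists>f'\<in>exp_approximable S a p. majorized S a (\<lambda>z. norm (f z - f' z) powr p) \<delta>"
  shows "f \<in> exp_approximable S a p"
  unfolding exp_approximable_def
proof (intro CollectI allI impI)
  fix \<delta> :: real assume "\<delta> > 0"
  define \<eta> where "\<eta> = \<delta> / (2 * 2 powr p)"
  have \<eta>: "\<eta> > 0" "2 powr p * (\<eta> + \<eta>) = \<delta>" using \<open>\<delta> > 0\<close> by (auto simp: \<eta>_def field_simps)
  obtain f' where f': "f' \<in> exp_approximable S a p" "majorized S a (\<lambda>z. norm (f z - f' z) powr p) \<eta>"
    using f[OF \<eta>(1)] by blast
  obtain g where g: "g \<in> exp_span" "majorized S a (\<lambda>z. norm (f' z - g z) powr p) \<eta>"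
    using f'(1) \<eta> by (auto simp: exp_approximable_def)
  have "majorized S a (\<lambda>z. 2 powr p * (norm (f z - f' z) powr p + norm (f' z - g z) powr p)) (2 powr p * (\<eta> + \<eta>))"
    by (intro majorized_cmult majorized_add f' g) auto
  then have "majorized S a (\<lambda>z. norm (f z - g z) powr p) \<delta>"
    using norm_add_powr_le[OF p, of "f z - f' z" "f' z - g z" for z] \<eta>(2)
    by (elim majorized_mono) auto
  then show "\<exists>g\<in>exp_span. majorized S a (\<lambda>z. norm (f z - g z) powr p) \<delta>" using g by blast
qed

lemma exp_approximable_exp_span: "f \<in> exp_span \<Longrightarrow> f \<in> exp_approximable S a p"
  by (auto simp: exp_approximable_def intro!: bexI[of _ f] majorized_const)

text \<open>A uniform error \<open>c\<close> has the constant \<open>c powr p\<close> as majorant,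
  so uniform limits stay approximable. Hence the argument for uniformly closed spaces applies to the
  Hardy space too.\<close>

lemma uniform_subspace_exp_approximable:
  assumes p: "p > 0"
  shows "uniform_subspace (closure S) (exp_approximable S a p)"
  unfolding uniform_subspace_def
proof (intro conjI ballI allI impI)
  show "(\<lambda>_. 0) \<in> exp_approximable S a p"
    by (intro exp_approximable_exp_span exp_span_zero)
  show "(\<lambda>z. f z + g z) \<in> exp_approximable S a p" if fg: "f \<in> exp_approximable S a p" "g \<in> exp_approximable S a p" for f g
    unfolding exp_approximable_def
  proof (intro CollectI allI impI)
    fix \<delta> :: real assume "\<delta> > 0"
    define \<eta> where "\<eta> = \<delta> / (2 * 2 powr p)"
    have \<eta>: "\<eta> > 0" "2 powr p * (\<eta> + \<eta>) = \<delta>" using \<open>\<delta> > 0\<close> by (auto simp: \<eta>_def field_simps)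
    obtain f' where f': "f' \<in> exp_span" "majorized S a (\<lambda>z. norm (f z - f' z) powr p) \<eta>"
      using fg(1) \<eta> by (auto simp: exp_approximable_def)
    obtain g' where g': "g' \<in> exp_span" "majorized S a (\<lambda>z. norm (g z - g' z) powr p) \<eta>"
      using fg(2) \<eta> by (auto simp: exp_approximable_def)
    have "majorized S a (\<lambda>z. 2 powr p * (norm (f z - f' z) powr p + norm (g z - g' z) powr p)) (2 powr p * (\<eta> + \<eta>))"
      by (intro majorized_cmult majorized_add f' g') auto
    then have "majorized S a (\<lambda>z. norm (f z + g z - (f' z + g' z)) powr p) \<delta>"
      using norm_add_powr_le[OF p, of "f z - f' z" "g z - g' z" for z] \<eta>(2)
      by (elim majorized_mono) (auto simp: add_diff_add)
    then show "\<exists>h\<in>exp_span. majorized S a (\<lambda>z. norm (f z + g z - h z) powr p) \<delta>"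
      by (intro bexI[of _ "\<lambda>z. f' z + g' z"] exp_span_add[OF f'(1) g'(1)])
  qed
  show "(\<lambda>z. c * f z) \<in> exp_approximable S a p" if f: "f \<in> exp_approximable S a p" for f c
    unfolding exp_approximable_def
  proof (intro CollectI allI impI)
    fix \<delta> :: real assume \<delta>: "\<delta> > 0"
    define C where "C = norm c powr p + 1"
    have C: "C > 0" by (simp add: C_def add_nonneg_pos)
    obtain f' where f': "f' \<in> exp_span" "majorized S a (\<lambda>z. norm (f z - f' z) powr p) (\<delta> / C)"
    proof -
      have "\<delta> / C > 0" using \<delta> C by simp
      then show thesis using that f unfolding exp_approximable_def by blast
    qed
    have "majorized S a (\<lambda>z. C * norm (f z - f' z) powr p) (C * (\<delta> / C))"
      by (intro majorized_cmult f') (use C in auto)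
    then have "majorized S a (\<lambda>z. norm (c * f z - c * f' z) powr p) \<delta>"
    proof (rule majorized_mono)
      show "norm (c * f z - c * f' z) powr p \<le> C * norm (f z - f' z) powr p" for z
      proof -
        have "norm (c * f z - c * f' z) = norm c * norm (f z - f' z)"
          by (simp add: norm_mult flip: right_diff_distrib)
        then show ?thesis by (simp add: powr_mult C_def mult_right_mono)
      qed
    qed (use C in auto)
    then show "\<exists>g\<in>exp_span. majorized S a (\<lambda>z. norm (c * f z - g z) powr p) \<delta>"
      by (intro bexI[of _ "\<lambda>z. c * f' z"] exp_span_cmult[OF f'(1)])
  qed
  show "f \<in> exp_approximable S a p"
    if f: "\<forall>\<epsilon>>0. \<exists>g\<in>exp_approximable S a p. \<forall>z\<in>closure S. norm (f z - g z) \<le> \<epsilon>" for f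
  proof (rule exp_approximable_trans[OF p])
    fix \<delta> :: real assume \<delta>: "\<delta> > 0"
    then obtain g where g: "g \<in> exp_approximable S a p" "\<forall>z\<in>closure S. norm (f z - g z) \<le> \<delta> powr (1 / p)"
      using f by (metis powr_gt_zero less_irrefl)
    have "majorized S a (\<lambda>z. norm (f z - g z) powr p) \<delta>"
    proof (rule majorized_mono[OF majorized_const[OF order_refl]])
      show "norm (f z - g z) powr p \<le> \<delta>" if "z \<in> S" for z
      proof -
        have "norm (f z - g z) powr p \<le> (\<delta> powr (1 / p)) powr p"
          using g(2) closure_subset that p by (intro powr_mono2) auto
        also have "\<dots> = \<delta>" using \<delta> p by (simp add: powr_powr)
        finally show ?thesis .
      qed
    qed auto
    then show "\<exists>f'\<in>exp_approximable S a p. majorized S a (\<lambda>z. norm (f z - f' z) powr p) \<delta>" using g by blast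
  qed
qed

section \<open>From Laplace transforms to exponential sums\<close>

lemma Re_csqrt_ge:
  assumes "- (norm \<zeta> / 2) \<le> Re \<zeta>"
  shows "norm \<zeta> powr (1/2) \<le> 2 * Re (csqrt \<zeta>)"
proof -
  have "sqrt (norm \<zeta> / 4) \<le> sqrt ((norm \<zeta> + Re \<zeta>) / 2)"
    using assms by (intro real_sqrt_le_mono) auto
  moreover have "sqrt (norm \<zeta> / 4) = norm \<zeta> powr (1/2) / 2"
    by (simp add: powr_half_sqrt real_sqrt_divide)
  moreover have "Re (csqrt \<zeta>) = sqrt ((norm \<zeta> + Re \<zeta>) / 2)" by simp
  ultimately show ?thesis by linarith
qed

lemma norm_one_minus_exp_le:
  fixes \<zeta> :: complex
  shows "norm (1 - exp (- \<zeta>)) \<le> norm \<zeta> * (1 + exp (- Re \<zeta>))"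
proof -
  have "norm (exp 0 - exp (- \<zeta>)) \<le> (1 + exp (- Re \<zeta>)) * norm (0 - (- \<zeta>))"
  proof (rule field_differentiable_bound)
    show "convex {w. Re w \<le> max 0 (- Re \<zeta>)}" by (rule convex_halfspace_Re_le)
    show "(exp has_field_derivative exp w) (at w within {w. Re w \<le> max 0 (- Re \<zeta>)})" for w
      by (auto intro: DERIV_subset DERIV_exp)
    show "norm (exp w) \<le> 1 + exp (- Re \<zeta>)" if "w \<in> {w. Re w \<le> max 0 (- Re \<zeta>)}" for w
    proof -
      have "exp (Re w) \<le> exp (max 0 (- Re \<zeta>))" using that by simp
      also have "\<dots> \<le> 1 + exp (- Re \<zeta>)" by (cases "0 \<le> - Re \<zeta>") (auto simp: max_def)
      finally show ?thesis by simp
    qed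
  qed auto
  then show ?thesis by (simp add: mult.commute)
qed

lemma exp_neg_mult_le:
  fixes x t T :: real
  assumes "0 \<le> t" "t \<le> T"
  shows "exp (- t * x) \<le> 1 + exp (- T * x)"
proof (cases "x \<ge> 0")
  case True
  then have "exp (- t * x) \<le> 1" using assms by simp
  then show ?thesis by (simp add: add_increasing2)
next
  case False
  then have "- t * x \<le> - T * x" using assms by (simp add: mult_right_mono_neg)
  then have "exp (- t * x) \<le> exp (- T * x)" by (subst exp_le_cancel_iff)
  then show ?thesis by linarith
qed

context log_graph
begin

text \<open>\<open>z + offset\<close> stays in the sector of half-angle 2 pi / 3, so its principal
  root has argument at most pi / 3 and real part at least half its modulus. This is the explicit
  unbounded majorant that pays for errors near infinity.\<close>

lemma majorized_sqrt:
  "majorized (epi_domain \<psi>) a (\<lambda>z. norm (z + of_real offset) powr (1/2)) (2 * Re (csqrt (a + of_real offset)))"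
proof (rule majorizedI)
  have far: "\<psi> (Im z) - 1 \<le> Re z" if "z \<in> epi_domain \<psi>" for z using that by (simp add: epi_domain_def)
  have "z + of_real offset \<notin> \<real>\<^sub>\<le>\<^sub>0" if "z \<in> epi_domain \<psi>" for z
  proof
    assume "z + of_real offset \<in> \<real>\<^sub>\<le>\<^sub>0"
    then have "Im (z + of_real offset) = 0" "Re (z + of_real offset) \<le> 0" 
      by (auto simp: complex_nonpos_Reals_iff)
    then have "norm (z + of_real offset) = - Re (z + of_real offset)"
      by (simp add: cmod_def)
    then show False using offset_far(1,2)[OF far[OF that]] by linarith
  qed
  then show "(\<lambda>z. 2 * csqrt (z + of_real offset)) holomorphic_on epi_domain \<psi>"
    by (intro holomorphic_intros) auto
  show "norm (z + of_real offset) powr (1/2) \<le> Re (2 * csqrt (z + of_real offset))" if "z \<in> epi_domain \<psi>" for z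
    using Re_csqrt_ge[OF offset_far(2)[OF far[OF that]]] by simp
qed simp

text \<open>The exponents are arranged to sum to 1/2. The condition
  \<open>\<delta> \<le> 1 / (8 * p)\<close> lets the growth of the exponentials cost only
  \<open>X powr (1/4)\<close>, with \<open>X = norm (z + offset)\<close>; the factor of order
  \<open>\<delta> * X\<close> costs another \<open>X powr (1/4)\<close>. Their product is covered by
  \<open>majorized_sqrt\<close>, and \<open>\<delta> powr (1/4)\<close> is left over as the small
  factor.\<close>

lemma one_minus_exp_powr_le:
  fixes p \<delta> r :: real
  assumes z: "z \<in> epi_domain \<psi>" and p: "1 \<le> p" and r: "0 \<le> r" "r \<le> \<delta>" and \<delta>: "\<delta> \<le> 1 / (8 * p)"
  shows "norm (1 - exp (- of_real r * z)) powr (2 * p)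
    \<le> 2 powr (4 * p) * (\<delta> * (1 + offset) * exp offset) powr (1/4) * norm (z + of_real offset) powr (1/2)"
proof -
  define X where "X = norm (z + of_real offset)"
  have far: "\<psi> (Im z) - 1 \<le> Re z" using z by (simp add: epi_domain_def)
  note X = offset_far(1,3,4)[OF far, folded X_def]
  have \<delta>0: "0 \<le> \<delta>" using r by linarith
  define E where "E = 1 + exp (- \<delta> * Re z)"
  have E: "1 \<le> E" by (simp add: E_def)
  have rE: "1 + exp (- Re (of_real r * z)) \<le> 2 * E"
  proof -
    have "exp (- Re (of_real r * z)) \<le> E" using exp_neg_mult_le[OF r, of "Re z"] by (simp add: E_def)
    then show ?thesis using E by linarith
  qed
  have b1: "norm (1 - exp (- of_real r * z)) \<le> 2 * E"
    using norm_triangle_ineq4[of 1 "exp (- of_real r * z)"] rE by simp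
  have b2: "norm (1 - exp (- of_real r * z)) \<le> \<delta> * norm z * (2 * E)"
  proof -
    have "norm (1 - exp (- (of_real r * z))) \<le> norm (of_real r * z) * (1 + exp (- Re (of_real r * z)))"
      by (rule norm_one_minus_exp_le)
    also have "\<dots> \<le> (\<delta> * norm z) * (2 * E)"
      using rE r by (intro mult_mono) (auto simp: norm_mult mult_right_mono add_nonneg_nonneg)
    finally show ?thesis by simp
  qed
  \<comment> \<open>Both bounds \<open>b1\<close> and \<open>b2\<close> are kept: as
    \<open>m \<le> 1\<close>, its exponent \<open>2 * p\<close> can be lowered to 1/4.\<close>
  define m where "m = min 1 (\<delta> * norm z)"
  have m: "0 \<le> m" "m \<le> 1" "m \<le> \<delta> * norm z" using \<delta>0 by (auto simp: m_def)
  have "norm (1 - exp (- of_real r * z)) \<le> 2 * E * m"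
    using b1 b2 by (simp add: m_def min_def mult.commute)
  then have le: "norm (1 - exp (- of_real r * z)) powr (2 * p) \<le> (2 * E * m) powr (2 * p)"
    using p by (intro powr_mono2) auto
  have m_le: "m powr (2 * p) \<le> (\<delta> * (1 + offset) * X) powr (1/4)"
  proof -
    have "m powr (2 * p) \<le> m powr (1/4)"
      using m p by (intro powr_mono') auto
    also have "\<dots> \<le> (\<delta> * (1 + offset) * X) powr (1/4)"
    proof (rule powr_mono2)
      have "\<delta> * norm z \<le> \<delta> * ((1 + offset) * X)" using X \<delta>0 by (intro mult_left_mono) auto
      then show "m \<le> \<delta> * (1 + offset) * X" using m by (simp add: mult.assoc)
    qed (use m in auto)
    finally show ?thesis .
  qed
  have E_le: "(2 * E) powr (2 * p) \<le> 2 powr (4 * p) * (exp offset * X) powr (1/4)"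
  proof -
    have eX: "1 \<le> exp offset * X"
      using X offset_ge mult_mono[of 1 "exp offset" 1 X] by simp
    have "exp (- \<delta> * Re z) = exp (- Re z) powr \<delta>" by (simp add: powr_def)
    also have "\<dots> \<le> (exp offset * X) powr \<delta>" using X \<delta>0 by (intro powr_mono2) auto
    finally have "E \<le> 2 * (exp offset * X) powr \<delta>"
      using ge_one_powr_ge_zero[OF eX \<delta>0] by (simp add: E_def)
    then have "(2 * E) powr (2 * p) \<le> (4 * (exp offset * X) powr \<delta>) powr (2 * p)"
      using p E by (intro powr_mono2) auto
    also have "\<dots> = 4 powr (2 * p) * (exp offset * X) powr (\<delta> * (2 * p))"
      by (simp add: powr_mult powr_powr)
    also have "(exp offset * X) powr (\<delta> * (2 * p)) \<le> (exp offset * X) powr (1/4)"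
    proof (rule powr_mono[OF _ eX])
      have "\<delta> * (2 * p) \<le> 1 / (8 * p) * (2 * p)" using \<delta> p by (intro mult_right_mono) auto
      then show "\<delta> * (2 * p) \<le> 1 / 4" using p by simp
    qed
    also have "4 powr (2 * p) = 2 powr (4 * p)"
    proof -
      have "(4::real) = 2 powr 2" by simp
      then have "4 powr (2 * p) = (2 powr 2) powr (2 * p)" by simp
      then show ?thesis unfolding powr_powr by simp
    qed
    finally show ?thesis by simp
  qed
  have "norm (1 - exp (- of_real r * z)) powr (2 * p)
    \<le> (2 powr (4 * p) * (exp offset * X) powr (1/4)) * (\<delta> * (1 + offset) * X) powr (1/4)"
    using le unfolding powr_mult[of "2 * E"]
    by (rule order_trans) (intro mult_mono E_le m_le mult_nonneg_nonneg powr_ge_zero)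
  also have "\<dots> = 2 powr (4 * p) * ((exp offset * X) powr (1/4) * (\<delta> * (1 + offset) * X) powr (1/4))"
    by (rule mult.assoc)
  also have "(exp offset * X) powr (1/4) * (\<delta> * (1 + offset) * X) powr (1/4)
     = (\<delta> * (1 + offset) * exp offset) powr (1/4) * X powr (1/2)"
  proof -
    have "X powr (1/2) = X powr (1/4) * X powr (1/4)" by (simp add: powr_add [symmetric])
    then show ?thesis using \<delta>0 offset_ge X by (simp add: powr_mult)
  qed
  finally show ?thesis by (simp add: X_def mult.assoc)
qed

text \<open>Riemann sums. The error is at most a constant times \<open>Q * U\<close>, where \<open>Q = 1 + exp (- N * Re z)\<close> is handled by the
  hypothesis on exponentials and \<open>U\<close> is small because of the harmonic majorant \<open>Re (csqrt (z + offset))\<close>;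
  the two factors are separated by \<open>x * y \<le> \<eta> * x\<^sup>2 + y\<^sup>2 / \<eta>\<close>.\<close>

lemma laplace_beta_exp_approximable:
  assumes expH: "\<And>s. s \<ge> 0 \<Longrightarrow> \<exists>m. majorized (epi_domain \<psi>) a (\<lambda>z. exp (- s * Re z)) m"
    and N: "N > 0" and p: "1 \<le> p"
  shows "(\<lambda>z. laplace_beta N N (z - w)) \<in> exp_approximable (epi_domain \<psi>) a p"
proof -
  define c where "c = (\<lambda>s. complex_of_real ((1 - s / real N) ^ N) * exp (of_real s * w))"
  have c_cont: "continuous_on T c" for T
    unfolding c_def using N by (intro continuous_intros) auto
  have "bounded (c ` {0..real N})" by (intro compact_imp_bounded compact_continuous_image c_cont) auto
  then obtain B0 where B0: "\<And>s. s \<in> {0..real N} \<Longrightarrow> norm (c s) \<le> B0" by (fastforce simp: bounded_iff)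
  define B where "B = max B0 1"
  have B: "B > 0" "\<And>s. s \<in> {0..real N} \<Longrightarrow> norm (c s) \<le> B" using B0 by (force simp: B_def le_max_iff_disj)+
  \<comment> \<open>The exponent \<open>2 * p\<close> arises because the \<open>p\<close>-th power
    of \<open>Q\<close> gets squared when it is separated from \<open>U\<close>.\<close>
  obtain m where m: "majorized (epi_domain \<psi>) a (\<lambda>z. exp (- (real N * (2 * p)) * Re z)) m"
    using expH[of "real N * (2 * p)"] p by auto
  define t where "t = (\<lambda>n. grid 0 (real N) (Suc n))"
  define G where "G = (\<lambda>n z. \<Sum>j<Suc n. integral {t n j..t n (Suc j)} c * exp (complex_of_real (- t n j) * z))"
  have ends: "t n 0 = 0" "t n (Suc n) = real N" "mono (t n)" for n
    using grid_props[of 0 "real N" "Suc n"] by (auto simp: t_def)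
  have mem: "t n j \<in> {0..real N}" if "j \<le> Suc n" for n j
    using grid_props(5)[of 0 "real N" "Suc n" j] that by (auto simp: t_def)
  have G_span: "G n \<in> exp_span" for n
    unfolding G_def by (rule exp_span_sum) (use mem[of _ n] in auto)
  define C where "C = 2 powr (4 * p) * ((1 + offset) * exp offset) powr (1/4)"
  define Q where "Q = (\<lambda>z::complex. 1 + exp (- real N * Re z))"
  \<comment> \<open>The root of order \<open>2 * p\<close> of the bound in
    \<open>one_minus_exp_powr_le\<close>, taken at the mesh
    \<open>real N / real (Suc n)\<close>.\<close>
  define U where "U = (\<lambda>n z::complex. (C * (real N / real (Suc n)) powr (1/4) * norm (z + of_real offset) powr (1/2)) powr (1 / (2 * p)))"
  have C0: "C \<ge> 0" by (simp add: C_def)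
  have err: "norm (laplace_beta N N (z - w) - G n z) \<le> B * real N * (Q z * U n z)"
    if z: "z \<in> epi_domain \<psi>" and n: "real N / real (Suc n) \<le> 1 / (8 * p)" for n z
  proof -
    have lb: "laplace_beta N N (z - w) = integral {t n 0..t n (Suc n)} (\<lambda>s. c s * exp (- of_real s * z))"
      unfolding laplace_beta_def ends c_def
      by (intro arg_cong[of _ _ "integral {0..real N}"])
         (auto simp: fun_eq_iff mult.assoc exp_add [symmetric] algebra_simps)
    have "norm (laplace_beta N N (z - w) - (\<Sum>j<Suc n. integral {t n j..t n (Suc j)} c * exp (- of_real (t n j) * z)))
      \<le> B * (t n (Suc n) - t n 0) * (Q z * U n z)"
      unfolding lb
    proof (rule weighted_riemann_sum[OF ends(3) c_cont])
      show "continuous_on {t n 0..t n (Suc n)} (\<lambda>s. exp (- complex_of_real s * z))" by (intro continuous_intros)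
      show "norm (c y) \<le> B" if "y \<in> {t n 0..t n (Suc n)}" for y using B that by (simp add: ends)
      fix j y assume j: "j < Suc n" and y: "y \<in> {t n j..t n (Suc j)}"
      have d: "t n (Suc j) - t n j = real N / real (Suc n)"
        using grid_props(4)[of 0 "real N" "Suc n" j] by (simp add: t_def)
      define r where "r = y - t n j"
      have r: "0 \<le> r" "r \<le> real N / real (Suc n)" using y d by (auto simp: r_def)
      have "exp (- of_real y * z) - exp (- of_real (t n j) * z) = - (exp (- of_real (t n j) * z) * (1 - exp (- of_real r * z)))"
        by (simp add: r_def algebra_simps flip: exp_add)
      then have "norm (exp (- of_real y * z) - exp (- of_real (t n j) * z))
         = exp (- t n j * Re z) * norm (1 - exp (- of_real r * z))"
        by (simp add: norm_mult)
      also have "\<dots> \<le> Q z * U n z"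
      proof (rule mult_mono)
        show "exp (- t n j * Re z) \<le> Q z"
          unfolding Q_def using mem[of j n] j by (intro exp_neg_mult_le) auto
        have "norm (1 - exp (- of_real r * z)) powr (2 * p)
          \<le> 2 powr (4 * p) * (real N / real (Suc n) * (1 + offset) * exp offset) powr (1/4) * norm (z + of_real offset) powr (1/2)"
          by (rule one_minus_exp_powr_le[OF z p r n])
        also have "\<dots> = C * (real N / real (Suc n)) powr (1/4) * norm (z + of_real offset) powr (1/2)"
          using offset_ge unfolding C_def mult.assoc[of "real N / real (Suc n)"] by (subst powr_mult) (auto simp: mult_ac)
        finally have "(norm (1 - exp (- of_real r * z)) powr (2 * p)) powr (1 / (2 * p)) \<le> U n z"
          unfolding U_def using p by (intro powr_mono2) auto
        then show "norm (1 - exp (- of_real r * z)) \<le> U n z"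
          using p by (simp add: powr_powr)
      qed (auto simp: Q_def add_nonneg_nonneg)
      finally show "norm (exp (- complex_of_real y * z) - exp (- complex_of_real (t n j) * z)) \<le> Q z * U n z" .
    qed
    then show ?thesis by (simp add: G_def ends)
  qed
  show ?thesis
    unfolding exp_approximable_def
  proof (intro CollectI allI impI)
    fix \<delta> :: real assume \<delta>: "\<delta> > 0"
    define D where "D = (B * real N) powr p"
    have D: "D > 0" using B N by (simp add: D_def)
    define M where "M = 2 powr (2 * p) * (1 + max m 0)"
    have M: "M > 0" by (simp add: M_def add_pos_nonneg)
    \<comment> \<open>\<open>\<eta>\<close> is fixed before \<open>n\<close>: it makes the
      \<open>Q\<close> part at most \<open>\<delta> / 2\<close>, and a fine enough grid then absorbs
      the factor \<open>1 / \<eta>\<close> of the \<open>U\<close> part.\<close>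
    define \<eta> where "\<eta> = \<delta> / (2 * D * M)"
    have \<eta>: "\<eta> > 0" "D * (\<eta> * M) = \<delta> / 2" using \<delta> D M by (auto simp: \<eta>_def)
    define S where "S = 2 * Re (csqrt (a + of_real offset))"
    have "(\<lambda>n. D * (1 / \<eta> * (C * (real N / real (Suc n)) powr (1/4) * S))) \<longlonglongrightarrow> 0"
    proof -
      have "(\<lambda>n. (real N / real (Suc n)) powr (1/4)) \<longlonglongrightarrow> 0" using N by real_asymp
      then have "(\<lambda>n. D * (1 / \<eta> * (C * (real N / real (Suc n)) powr (1/4) * S))) \<longlonglongrightarrow> D * (1 / \<eta> * (C * 0 * S))"
        by (intro tendsto_mult tendsto_const)
      then show ?thesis by simp
    qed
    then have "\<forall>\<^sub>F n in sequentially. D * (1 / \<eta> * (C * (real N / real (Suc n)) powr (1/4) * S)) < \<delta> / 2"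
      using \<delta> by (intro order_tendstoD(2)) auto
    moreover have "(\<lambda>n. real N / real (Suc n)) \<longlonglongrightarrow> 0" by real_asymp
    then have "\<forall>\<^sub>F n in sequentially. real N / real (Suc n) < 1 / (8 * p)"
      using p by (intro order_tendstoD(2)) auto
    ultimately have "\<forall>\<^sub>F n in sequentially. D * (1 / \<eta> * (C * (real N / real (Suc n)) powr (1/4) * S)) < \<delta> / 2 \<and>
       real N / real (Suc n) < 1 / (8 * p)"
      by (rule eventually_conj)
    then obtain n where n: "D * (1 / \<eta> * (C * (real N / real (Suc n)) powr (1/4) * S)) < \<delta> / 2"
      "real N / real (Suc n) < 1 / (8 * p)"
      using eventually_happens by force
    have "majorized (epi_domain \<psi>) a (\<lambda>z. D * (\<eta> * (2 powr (2 * p) * (1 + exp (- (real N * (2 * p)) * Re z)))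
         + 1 / \<eta> * (C * (real N / real (Suc n)) powr (1/4) * norm (z + of_real offset) powr (1/2))))
       (D * (\<eta> * (2 powr (2 * p) * (1 + m)) + 1 / \<eta> * (C * (real N / real (Suc n)) powr (1/4) * S)))"
      unfolding S_def
      by (intro majorized_cmult majorized_add majorized_const m majorized_sqrt) (use D \<eta> C0 in auto)
    then have "majorized (epi_domain \<psi>) a (\<lambda>z. norm (laplace_beta N N (z - w) - G n z) powr p) \<delta>"
    proof (rule majorized_mono)
      fix z assume z: "z \<in> epi_domain \<psi>"
      have sq: "(v powr p)\<^sup>2 = v powr (2 * p)" for v :: real
        by (simp only: power2_eq_square mult_2 powr_add)
      define x where "x = Q z powr p"
      define y where "y = U n z powr p"
      have Q0: "Q z \<ge> 0" "U n z \<ge> 0" by (auto simp: Q_def U_def add_nonneg_nonneg)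
      have "norm (laplace_beta N N (z - w) - G n z) powr p \<le> (B * real N * (Q z * U n z)) powr p"
        using err[OF z, of n] n(2) p by (intro powr_mono2) auto
      also have "\<dots> = D * (x * y)"
        using Q0 B by (simp add: D_def x_def y_def powr_mult)
      also have "x * y \<le> \<eta> * x\<^sup>2 + 1 / \<eta> * y\<^sup>2"
      proof -
        have "0 \<le> (\<eta> * x - y)\<^sup>2" by simp
        then have "2 * \<eta> * (x * y) \<le> \<eta> * (\<eta> * x\<^sup>2 + 1 / \<eta> * y\<^sup>2)"
          using \<eta>(1) by (simp add: power2_eq_square algebra_simps)
        then have "2 * (x * y) \<le> \<eta> * x\<^sup>2 + 1 / \<eta> * y\<^sup>2" using \<eta>(1)
          by (metis (no_types, opaque_lifting) mult.assoc mult.left_commute mult_le_cancel_left_pos)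
        moreover have "0 \<le> x * y" by (simp add: x_def y_def)
        ultimately show ?thesis by linarith
      qed
      also have "x\<^sup>2 \<le> 2 powr (2 * p) * (1 + exp (- (real N * (2 * p)) * Re z))"
      proof -
        have "x\<^sup>2 = norm (1 + exp (- real N * Re z)) powr (2 * p)"
          unfolding x_def Q_def by (simp add: sq abs_of_nonneg add_nonneg_nonneg)
        also have "\<dots> \<le> 2 powr (2 * p) * (norm (1::real) powr (2 * p) + norm (exp (- real N * Re z)) powr (2 * p))"
          by (rule norm_add_powr_le) (use p in auto)
        also have "norm (exp (- real N * Re z)) powr (2 * p) = exp (- (real N * (2 * p)) * Re z)"
          by (simp add: powr_def mult_ac)
        finally show ?thesis by simp
      qed
      also have "y\<^sup>2 = C * (real N / real (Suc n)) powr (1/4) * norm (z + of_real offset) powr (1/2)"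
      proof -
        have "y\<^sup>2 = U n z powr (2 * p)" unfolding y_def by (rule sq)
        also have "\<dots> = C * (real N / real (Suc n)) powr (1/4) * norm (z + of_real offset) powr (1/2)"
          unfolding U_def powr_powr using p C0 by simp
        finally show ?thesis .
      qed
      finally show "norm (laplace_beta N N (z - w) - G n z) powr p \<le>
         D * (\<eta> * (2 powr (2 * p) * (1 + exp (- (real N * (2 * p)) * Re z)))
         + 1 / \<eta> * (C * (real N / real (Suc n)) powr (1/4) * norm (z + of_real offset) powr (1/2)))"
        using D \<eta> by simp
    next
      have "D * (\<eta> * (2 powr (2 * p) * (1 + m))) \<le> D * (\<eta> * M)"
        unfolding M_def using D \<eta> by (intro mult_left_mono) auto
      then show "D * (\<eta> * (2 powr (2 * p) * (1 + m)) + 1 / \<eta> * (C * (real N / real (Suc n)) powr (1/4) * S)) \<le> \<delta>"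
        using n(1) \<eta>(2) unfolding distrib_left[of D] by linarith
    qed
    then show "\<exists>g\<in>exp_span. majorized (epi_domain \<psi>) a (\<lambda>z. norm (laplace_beta N N (z - w) - g z) powr p) \<delta>"
      by (intro bexI[of _ "G n"] G_span)
  qed
qed

end

section \<open>Approximation of bounded functions in the Hardy space\<close>

context log_graph
begin

text \<open>With \<open>X = norm (z + offset)\<close>, the cutoff error is at most
  \<open>6 * b * min 1 (X / k)\<close>. The minimum being at most 1, its exponent \<open>p\<close>
  can be lowered to 1/2, which leaves \<open>k powr (- (1/2))\<close> times the function treated in
  \<open>majorized_sqrt\<close>.\<close>

lemma bounded_extendable_exp_approximable:
  assumes expH: "\<And>s. s \<ge> 0 \<Longrightarrow> \<exists>m. majorized (epi_domain \<psi>) a (\<lambda>z. exp (- s * Re z)) m"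
    and p: "1 \<le> p" and \<epsilon>: "0 < \<epsilon>" "\<epsilon> \<le> 1"
    and F: "F holomorphic_on epi_domain (\<lambda>y. \<psi> y - \<epsilon>)"
    and bnd: "\<And>\<zeta>. \<zeta> \<in> epi_domain (\<lambda>y. \<psi> y - \<epsilon>) \<Longrightarrow> norm (F \<zeta>) \<le> B"
  shows "F \<in> exp_approximable (epi_domain \<psi>) a p"
proof (rule exp_approximable_trans)
  show "p > 0" using p by simp
  have V: "uniform_subspace (closure (epi_domain \<psi>)) (exp_approximable (epi_domain \<psi>) a p)"
    by (rule uniform_subspace_exp_approximable) (use p in auto)
  fix \<delta> :: real assume \<delta>: "\<delta> > 0"
  define b where "b = max B 1"
  have b: "b > 0" "\<And>\<zeta>. \<zeta> \<in> epi_domain (\<lambda>y. \<psi> y - \<epsilon>) \<Longrightarrow> norm (F \<zeta>) \<le> b"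
    using bnd by (force simp: b_def le_max_iff_disj)+
  define S where "S = 2 * Re (csqrt (a + of_real offset))"
  have "(\<lambda>k::nat. real (Suc k) powr (- (1/2))) \<longlonglongrightarrow> 0" by real_asymp
  then have "(\<lambda>k::nat. (6 * b) powr p * (real (Suc k) powr (- (1/2)) * S)) \<longlonglongrightarrow> (6 * b) powr p * (0 * S)"
    by (intro tendsto_mult tendsto_const)
  then have "\<forall>\<^sub>F k in sequentially. (6 * b) powr p * (real (Suc k) powr (- (1/2)) * S) < \<delta>"
    using \<delta> by (intro order_tendstoD(2)) auto
  then obtain n where n: "(6 * b) powr p * (real (Suc n) powr (- (1/2)) * S) < \<delta>"
    using eventually_happens by force
  define k where "k = real (Suc n)"
  have k: "k > 0" by (simp add: k_def)
  have "(\<lambda>z. F z * cutoff offset k z) \<in> exp_approximable (epi_domain \<psi>) a p"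
    by (rule cutoff_mult_in_uniform_subspace[OF V laplace_beta_exp_approximable[OF expH _ p] \<epsilon> k F bnd])
  moreover have "majorized (epi_domain \<psi>) a (\<lambda>z. norm (F z - F z * cutoff offset k z) powr p) \<delta>"
  proof -
    have "majorized (epi_domain \<psi>) a (\<lambda>z. (6 * b) powr p * (k powr (- (1/2)) * norm (z + of_real offset) powr (1/2)))
       ((6 * b) powr p * (k powr (- (1/2)) * S))"
      unfolding S_def by (intro majorized_cmult majorized_sqrt) auto
    then show ?thesis
    proof (rule majorized_mono)
      fix z assume z: "z \<in> epi_domain \<psi>"
      define X where "X = norm (z + of_real offset)"
      have z': "z \<in> epi_domain (\<lambda>y. \<psi> y - \<epsilon>)" and far: "\<psi> (Im z) - 1 \<le> Re z"
        using z \<epsilon> by (auto simp: epi_domain_def)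
      note cb = cutoff_bounds(3,4)[OF k offset_far(2)[OF far], folded cutoff_def X_def]
      have X0: "X \<ge> 0" by (simp add: X_def)
      have "norm (F z - F z * cutoff offset k z) = norm (F z) * norm (1 - cutoff offset k z)"
        by (simp add: algebra_simps flip: norm_mult)
      also have "\<dots> \<le> b * (6 * min 1 (X / k))"
        using cb b(2)[OF z'] b(1) by (intro mult_mono) (auto simp: min_def)
      finally have "norm (F z - F z * cutoff offset k z) powr p \<le> (6 * b * min 1 (X / k)) powr p"
        using p by (intro powr_mono2) auto
      also have "\<dots> = (6 * b) powr p * min 1 (X / k) powr p" by (rule powr_mult)
      also have "min 1 (X / k) powr p \<le> min 1 (X / k) powr (1/2)"
        using X0 k p by (intro powr_mono') auto
      also have "\<dots> \<le> (X / k) powr (1/2)" using X0 k by (intro powr_mono2) auto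
      also have "\<dots> = k powr (- (1/2)) * X powr (1/2)"
        unfolding powr_minus_divide[of k] using X0 k by (subst powr_divide) auto
      finally show "norm (F z - F z * cutoff offset k z) powr p \<le> (6 * b) powr p * (k powr (- (1/2)) * norm (z + of_real offset) powr (1/2))"
        using b by (simp add: X_def mult_left_mono)
    qed (use n k_def in auto)
  qed
  ultimately show "\<exists>f'\<in>exp_approximable (epi_domain \<psi>) a p. majorized (epi_domain \<psi>) a (\<lambda>z. norm (F z - f' z) powr p) \<delta>"
    by (intro bexI[of _ "\<lambda>z. F z * cutoff offset k z"])
qed

end

text \<open>Write \<open>\<tau> z = \<tau> 0 + z * \<sigma> z\<close>. By the Schwarz lemma \<open>\<bar>\<sigma>\<bar> \<le> 1 + \<bar>\<tau> 0\<bar>\<close>, so \<open>\<bar>\<sigma> - 1\<bar>\<^sup>2\<close> lies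
  below the harmonic function \<open>(1 + \<bar>\<tau> 0\<bar>)\<^sup>2 + 1 - 2 Re \<sigma>\<close>.\<close>

lemma self_map_near_identity:
  assumes \<tau>: "\<tau> holomorphic_on ball 0 1" "\<And>z. z \<in> ball 0 1 \<Longrightarrow> norm (\<tau> z) < 1"
  shows "majorized (ball 0 1) 0 (\<lambda>z. (norm (\<tau> z - z))\<^sup>2)
    (2 * ((norm (\<tau> 0))\<^sup>2 + ((1 + norm (\<tau> 0))\<^sup>2 + 1 - 2 * Re (deriv \<tau> 0))))"
proof -
  define t where "t = norm (\<tau> 0)"
  define \<sigma> where "\<sigma> = (\<lambda>z. if z = 0 then deriv \<tau> 0 else (\<tau> z - \<tau> 0) / (z - 0))"
  have \<sigma>: "\<sigma> holomorphic_on ball 0 1"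
    unfolding \<sigma>_def by (rule pole_lemma_open[OF \<tau>(1)]) auto
  have \<tau>\<sigma>: "\<tau> z = \<tau> 0 + z * \<sigma> z" for z by (simp add: \<sigma>_def)
  have t1: "1 + t > 0" by (simp add: t_def add_pos_nonneg)
  define f where "f = (\<lambda>z. (\<tau> z - \<tau> 0) / of_real (1 + t))"
  have f: "f holomorphic_on ball 0 1" "f 0 = 0" "norm (f z) < 1" if "norm z < 1" for z
  proof -
    show "f holomorphic_on ball 0 1" unfolding f_def
      by (intro holomorphic_intros \<tau>) (use t1 in \<open>auto simp del: of_real_add\<close>)
    have "norm (\<tau> z - \<tau> 0) < 1 + t"
      using norm_triangle_ineq4[of "\<tau> z" "\<tau> 0"] \<tau>(2)[of z] that by (simp add: t_def)
    then show "norm (f z) < 1" using t1 unfolding f_def norm_divide norm_of_real by simp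
  qed (simp add: f_def)
  have \<sigma>_le: "norm (\<sigma> z) \<le> 1 + t" if z: "norm z < 1" for z
  proof (cases "z = 0")
    case False
    have "norm (f z) \<le> norm z"
      by (rule Schwarz_Lemma(1)[OF f(1) f(2) f(3) z]) (use z in auto)
    then have "norm (\<tau> z - \<tau> 0) \<le> (1 + t) * norm z"
      using t1 unfolding f_def norm_divide norm_of_real by (simp add: divide_le_eq mult.commute)
    then show ?thesis using False by (simp add: \<sigma>_def norm_divide divide_le_eq)
  next
    case True
    have "norm (deriv f 0) \<le> 1"
      by (rule Schwarz_Lemma(2)[OF f(1) f(2) f(3) z]) (use z in auto)
    moreover have "deriv f 0 = deriv \<tau> 0 / of_real (1 + t)"
    proof -
      have "(\<tau> has_field_derivative deriv \<tau> 0) (at 0)"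
        using holomorphic_derivI[OF \<tau>(1), of 0] by auto
      from DERIV_cdivide[OF DERIV_diff[OF this DERIV_const[of "\<tau> 0"]], of "of_real (1 + t)"]
      have "(f has_field_derivative deriv \<tau> 0 / of_real (1 + t)) (at 0)" by (simp add: f_def)
      then show ?thesis by (rule DERIV_imp_deriv)
    qed
    ultimately have "norm (deriv \<tau> 0) / \<bar>1 + t\<bar> \<le> 1"
      by (metis norm_divide norm_of_real)
    then have "norm (deriv \<tau> 0) \<le> 1 + t"
      using t1 by (simp add: divide_le_eq)
    then show ?thesis using True by (simp add: \<sigma>_def)
  qed
  show ?thesis
  proof (rule majorizedI[of "\<lambda>z. 2 * (of_real (t\<^sup>2) + (of_real ((1 + t)\<^sup>2) + 1 - 2 * \<sigma> z))"])
    show "(\<lambda>z. 2 * (of_real (t\<^sup>2) + (of_real ((1 + t)\<^sup>2) + 1 - 2 * \<sigma> z))) holomorphic_on ball 0 1"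
      by (intro holomorphic_intros \<sigma>)
    show "Re (2 * (of_real (t\<^sup>2) + (of_real ((1 + t)\<^sup>2) + 1 - 2 * \<sigma> 0)))
       \<le> 2 * ((norm (\<tau> 0))\<^sup>2 + ((1 + norm (\<tau> 0))\<^sup>2 + 1 - 2 * Re (deriv \<tau> 0)))"
      by (simp add: t_def \<sigma>_def)
    fix z :: complex assume z: "z \<in> ball 0 1"
    have "norm (\<tau> z - z) \<le> t + norm (\<sigma> z - 1)"
    proof -
      have "\<tau> z - z = \<tau> 0 + z * (\<sigma> z - 1)" using \<tau>\<sigma>[of z] by (simp add: algebra_simps)
      also have "norm \<dots> \<le> t + norm z * norm (\<sigma> z - 1)"
        unfolding t_def by (intro order_trans[OF norm_triangle_ineq]) (simp add: norm_mult)
      also have "norm z * norm (\<sigma> z - 1) \<le> norm (\<sigma> z - 1)"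
        using z by (intro mult_left_le_one_le) auto
      finally show ?thesis by simp
    qed
    then have "(norm (\<tau> z - z))\<^sup>2 \<le> (t + norm (\<sigma> z - 1))\<^sup>2" by (intro power_mono) auto
    also have "\<dots> \<le> 2 * (t\<^sup>2 + (norm (\<sigma> z - 1))\<^sup>2)"
      using zero_le_power2[of "t - norm (\<sigma> z - 1)"] by (simp add: power2_eq_square algebra_simps)
    also have "(norm (\<sigma> z - 1))\<^sup>2 = (norm (\<sigma> z))\<^sup>2 + 1 - 2 * Re (\<sigma> z)"
      unfolding cmod_power2 by (simp add: power2_eq_square algebra_simps)
    also have "(norm (\<sigma> z))\<^sup>2 \<le> (1 + t)\<^sup>2" using \<sigma>_le[of z] z by (intro power_mono) auto
    finally show "(norm (\<tau> z - z))\<^sup>2 \<le> Re (2 * (of_real (t\<^sup>2) + (of_real ((1 + t)\<^sup>2) + 1 - 2 * \<sigma> z)))"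
      by simp
  qed
qed

context log_graph
begin

text \<open>Conjugated by the Riemann map, the translation becomes a self-map \<open>\<tau>\<close>
  of the disc. As \<open>\<epsilon>\<close> tends to 0, \<open>\<tau> 0\<close> tends to 0 and
  \<open>deriv \<tau> 0\<close> to 1, so the bound of \<open>self_map_near_identity\<close>, here
  \<open>E \<epsilon>\<close>, tends to 0.\<close>

lemma Riemann_map_translation:
  assumes a: "a \<in> epi_domain \<psi>"
    and h: "h holomorphic_on epi_domain \<psi>" "\<phi> holomorphic_on ball 0 1" "h a = 0"
      "\<And>z. z \<in> epi_domain \<psi> \<Longrightarrow> h z \<in> ball 0 1 \<and> \<phi> (h z) = z"
      "\<And>w. w \<in> ball 0 1 \<Longrightarrow> \<phi> w \<in> epi_domain \<psi> \<and> h (\<phi> w) = w"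
    and \<delta>: "\<delta> > 0"
  obtains \<epsilon> where "0 < \<epsilon>" "\<epsilon> \<le> 1"
    "majorized (epi_domain \<psi>) a (\<lambda>z. (norm (h (z + of_real \<epsilon>) - h z))\<^sup>2) \<delta>"
proof -
  define S where "S = epi_domain \<psi>"
  have S: "open S" unfolding S_def by (rule open_epi_domain)
  have shift: "z + of_real \<epsilon> \<in> S" if "z \<in> S" "\<epsilon> \<ge> 0" for z \<epsilon>
    using that by (simp add: S_def epi_domain_def)
  have \<phi>0: "\<phi> 0 = a" using h(3) h(4)[OF a] by simp
  define E where "E = (\<lambda>\<epsilon>::real. 2 * ((norm (h (a + of_real \<epsilon>)))\<^sup>2 + ((1 + norm (h (a + of_real \<epsilon>)))\<^sup>2 + 1
      - 2 * Re (deriv h (a + of_real \<epsilon>) * deriv \<phi> 0))))"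
  have \<phi>': "(\<phi> has_field_derivative deriv \<phi> 0) (at 0)"
    using holomorphic_derivI[OF h(2), of 0] by auto
  have h': "(h has_field_derivative deriv h z) (at z)" if "z \<in> S" for z
    using holomorphic_derivI[OF h(1)[folded S_def] S that] .
  have d1: "deriv h a * deriv \<phi> 0 = 1"
  proof -
    have "((\<lambda>w. h (\<phi> w)) has_field_derivative deriv h a * deriv \<phi> 0) (at 0)"
      using DERIV_chain2[of h "deriv h a" \<phi> 0 "deriv \<phi> 0"] h'[of a] a \<phi>' \<phi>0 by (simp add: S_def)
    moreover have "((\<lambda>w. h (\<phi> w)) has_field_derivative 1) (at 0)"
      by (rule has_field_derivative_transform_within_open[OF DERIV_ident, of "ball 0 1"]) (use h(5) in auto)
    ultimately show ?thesis by (rule DERIV_unique)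
  qed
  have "(E \<longlongrightarrow> 2 * ((norm (h a))\<^sup>2 + ((1 + norm (h a))\<^sup>2 + 1 - 2 * Re (deriv h a * deriv \<phi> 0)))) (at_right 0)"
  proof -
    have lim: "((\<lambda>\<epsilon>. a + of_real \<epsilon>) \<longlongrightarrow> a) (at_right 0)"
      by (auto intro!: tendsto_eq_intros)
    have "isCont h a" using h'[of a] a by (auto simp: S_def intro: DERIV_isCont)
    then have 1: "((\<lambda>\<epsilon>. h (a + of_real \<epsilon>)) \<longlongrightarrow> h a) (at_right 0)"
      using lim by (rule isCont_tendsto_compose)
    have "deriv h holomorphic_on S" using h(1) S by (auto simp: S_def intro: holomorphic_deriv)
    then have "isCont (deriv h) a"
      using S a holomorphic_on_imp_continuous_on continuous_on_eq_continuous_at by (metis S_def)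
    then have 2: "((\<lambda>\<epsilon>. deriv h (a + of_real \<epsilon>)) \<longlongrightarrow> deriv h a) (at_right 0)"
      using lim by (rule isCont_tendsto_compose)
    show ?thesis unfolding E_def by (intro tendsto_intros 1 2)
  qed
  then have "(E \<longlongrightarrow> 0) (at_right 0)" by (simp add: d1 h(3))
  then have "\<forall>\<^sub>F \<epsilon> in at_right 0. E \<epsilon> < \<delta>" using \<delta> by (rule order_tendstoD(2))
  moreover have "\<forall>\<^sub>F \<epsilon> in at_right 0. \<epsilon> \<in> {0<..<(1::real)}"
    by (rule eventually_at_rightI[of 0 1]) auto
  ultimately have "\<forall>\<^sub>F \<epsilon> in at_right 0. E \<epsilon> < \<delta> \<and> \<epsilon> \<in> {0<..<(1::real)}"
    by (rule eventually_conj)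
  then obtain \<epsilon> where \<epsilon>: "E \<epsilon> < \<delta>" "0 < \<epsilon>" "\<epsilon> < 1"
    using eventually_happens[of _ "at_right (0::real)"] by auto
  define \<tau> where "\<tau> = (\<lambda>w. h (\<phi> w + of_real \<epsilon>))"
  have \<phi>S: "\<phi> w + of_real \<epsilon> \<in> S" if "w \<in> ball 0 1" for w
    using h(5)[OF that] \<epsilon> by (intro shift) (auto simp: S_def)
  have \<tau>_hol: "\<tau> holomorphic_on ball 0 1"
  proof -
    have "(h \<circ> (\<lambda>w. \<phi> w + of_real \<epsilon>)) holomorphic_on ball 0 1"
      by (rule holomorphic_on_compose_gen[OF _ h(1)[folded S_def]])
         (use \<phi>S in \<open>auto intro!: holomorphic_intros h(2)\<close>)
    then show ?thesis by (simp add: o_def \<tau>_def)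
  qed
  have \<tau>1: "norm (\<tau> w) < 1" if "w \<in> ball 0 1" for w
    using h(4)[OF \<phi>S[OF that, unfolded S_def]] by (simp add: \<tau>_def)
  have \<tau>': "deriv \<tau> 0 = deriv h (a + of_real \<epsilon>) * deriv \<phi> 0"
  proof (rule DERIV_imp_deriv)
    have "((\<lambda>w. \<phi> w + of_real \<epsilon>) has_field_derivative deriv \<phi> 0) (at 0)"
      using DERIV_add[OF \<phi>' DERIV_const[of "of_real \<epsilon>"]] by simp
    moreover have "(h has_field_derivative deriv h (a + of_real \<epsilon>)) (at (\<phi> 0 + of_real \<epsilon>))"
      using h'[of "a + of_real \<epsilon>"] shift[of a \<epsilon>] a \<epsilon> by (simp add: S_def \<phi>0)
    ultimately show "(\<tau> has_field_derivative deriv h (a + of_real \<epsilon>) * deriv \<phi> 0) (at 0)"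
      unfolding \<tau>_def by (intro DERIV_chain2)
  qed
  have "majorized (ball 0 1) 0 (\<lambda>z. (norm (\<tau> z - z))\<^sup>2) (E \<epsilon>)"
    using self_map_near_identity[OF \<tau>_hol \<tau>1] unfolding E_def \<tau>' by (simp add: \<tau>_def \<phi>0)
  then have "majorized (ball 0 1) (h a) (\<lambda>z. (norm (\<tau> z - z))\<^sup>2) (E \<epsilon>)" by (simp add: h(3))
  then have "majorized S a (\<lambda>z. (norm (\<tau> (h z) - h z))\<^sup>2) (E \<epsilon>)"
    by (rule majorized_compose) (use h in \<open>auto simp: S_def\<close>)
  then have "majorized S a (\<lambda>z. (norm (h (z + of_real \<epsilon>) - h z))\<^sup>2) \<delta>"
    by (rule majorized_mono) (use h(4) \<epsilon> in \<open>auto simp: \<tau>_def S_def\<close>)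
  then show thesis using that[of \<epsilon>] \<epsilon> by (simp add: S_def)
qed

end

lemma holomorphic_dilation_bounds:
  assumes F: "F holomorphic_on ball 0 1" and R: "0 < R" "R < 1"
  obtains L where "L > 0" "\<And>w. w \<in> ball 0 1 \<Longrightarrow> norm (F (of_real R * w)) \<le> L"
    "\<And>w w'. w \<in> ball 0 1 \<Longrightarrow> w' \<in> ball 0 1 \<Longrightarrow> norm (F (of_real R * w) - F (of_real R * w')) \<le> L * norm (w - w')"
proof -
  have sub: "cball 0 R \<subseteq> ball (0::complex) 1" using R by auto
  have mem: "of_real R * w \<in> cball 0 R" if "w \<in> ball 0 1" for w :: complex
    using that R by (simp add: norm_mult)
  have "deriv F holomorphic_on ball 0 1" by (intro holomorphic_deriv F) auto
  then have "bounded (F ` cball 0 R)" "bounded (deriv F ` cball 0 R)"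
    using F sub
    by (auto intro!: compact_imp_bounded compact_continuous_image holomorphic_on_imp_continuous_on
        intro: holomorphic_on_subset)
  then obtain B B' where B: "\<And>w. w \<in> cball 0 R \<Longrightarrow> norm (F w) \<le> B" "\<And>w. w \<in> cball 0 R \<Longrightarrow> norm (deriv F w) \<le> B'"
    unfolding bounded_iff by blast
  define L where "L = max 1 (max B B')"
  have L: "1 \<le> L" "B \<le> L" "B' \<le> L" by (auto simp: L_def)
  show thesis
  proof (rule that[of L])
    show "L > 0" using L by simp
    show "norm (F (of_real R * w)) \<le> L" if "w \<in> ball 0 1" for w
      using B(1)[OF mem[OF that]] L by simp
    fix w w' :: complex assume w: "w \<in> ball 0 1" "w' \<in> ball 0 1"
    have "norm (F (of_real R * w) - F (of_real R * w')) \<le> L * norm (of_real R * w - of_real R * w')"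
    proof (rule field_differentiable_bound[of "cball 0 R" F "deriv F"])
      show "(F has_field_derivative deriv F u) (at u within cball 0 R)" if "u \<in> cball 0 R" for u
        using holomorphic_derivI[OF F, of u] sub that by (auto intro: has_field_derivative_at_within)
      show "norm (deriv F u) \<le> L" if "u \<in> cball 0 R" for u using B(2)[OF that] L by simp
    qed (use mem w in auto)
    also have "norm (of_real R * w - of_real R * w') = R * norm (w - w')"
      using R by (simp add: norm_mult flip: right_diff_distrib)
    also have "L * (R * norm (w - w')) \<le> L * norm (w - w')"
      using R L by (intro mult_left_mono mult_left_le_one_le) auto
    finally show "norm (F (of_real R * w) - F (of_real R * w')) \<le> L * norm (w - w')" .
  qed
qed

context log_graph
begin

lemma Riemann_map:
  assumes "a \<in> epi_domain \<psi>"
  obtains h \<phi> where "h holomorphic_on epi_domain \<psi>" "\<phi> holomorphic_on ball 0 1" "h a = 0"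
    "\<And>z. z \<in> epi_domain \<psi> \<Longrightarrow> h z \<in> ball 0 1 \<and> \<phi> (h z) = z"
    "\<And>w. w \<in> ball 0 1 \<Longrightarrow> \<phi> w \<in> epi_domain \<psi> \<and> h (\<phi> w) = w"
proof -
  have "Complex (\<psi> 0 - 1) 0 \<notin> epi_domain \<psi>" by (simp add: epi_domain_def)
  then have "epi_domain \<psi> \<noteq> UNIV" by blast
  then show thesis
    using Riemann_map_based[OF open_epi_domain simply_connected_epi_domain _ assms] that by metis
qed

text \<open>Transplanted to the disc, \<open>f\<close> need not be Lipschitz, but its dilation is;
  so after dilation the translation error is at most \<open>L\<close> times
  \<open>norm (h (z + \<epsilon>) - h z)\<close>, which is small in square mean. Both errors are
  bounded by \<open>2 * B\<close>, which turns square means into \<open>p\<close>-th means.\<close>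

lemma bounded_exp_approximable:
  assumes expH: "\<And>s. s \<ge> 0 \<Longrightarrow> \<exists>m. majorized (epi_domain \<psi>) a (\<lambda>z. exp (- s * Re z)) m"
    and a: "a \<in> epi_domain \<psi>" and p: "1 \<le> p"
    and f: "f holomorphic_on epi_domain \<psi>" "\<And>z. z \<in> epi_domain \<psi> \<Longrightarrow> norm (f z) \<le> B"
  shows "f \<in> exp_approximable (epi_domain \<psi>) a p"
proof (rule exp_approximable_trans)
  show p0: "p > 0" using p by simp
  fix \<delta> :: real assume \<delta>: "\<delta> > 0"
  obtain h \<phi> where h: "h holomorphic_on epi_domain \<psi>" "\<phi> holomorphic_on ball 0 1" "h a = 0"
    "\<And>z. z \<in> epi_domain \<psi> \<Longrightarrow> h z \<in> ball 0 1 \<and> \<phi> (h z) = z"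
    "\<And>w. w \<in> ball 0 1 \<Longrightarrow> \<phi> w \<in> epi_domain \<psi> \<and> h (\<phi> w) = w"
    using Riemann_map[OF a] by metis
  define F where "F = (\<lambda>w. f (\<phi> w))"
  have F: "F holomorphic_on ball 0 1"
  proof -
    have "(f \<circ> \<phi>) holomorphic_on ball 0 1"
      by (rule holomorphic_on_compose_gen[OF h(2) f(1)]) (use h(5) in auto)
    then show ?thesis by (simp add: F_def o_def)
  qed
  have FB: "norm (F w) \<le> B" if "w \<in> ball 0 1" for w using f(2) h(5)[OF that] by (simp add: F_def)
  have Ff: "F (h z) = f z" if "z \<in> epi_domain \<psi>" for z using h(4)[OF that] by (simp add: F_def)
  obtain \<delta>' where \<delta>': "\<delta>' > 0"
    "\<And>S a v. majorized S a (\<lambda>z. (v z)\<^sup>2) \<delta>' \<Longrightarrow> (\<And>z. z \<in> S \<Longrightarrow> 0 \<le> v z \<and> v z \<le> 2 * B) \<Longrightarrow>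
       majorized S a (\<lambda>z. v z powr p) \<delta>"
    using majorized_powr_of_square[OF \<delta> p0, of "2 * B"] by metis
  have "majorized (ball 0 1) 0 (\<lambda>w. (norm (F w))\<^sup>2) (B\<^sup>2)"
    by (rule majorized_mono[OF majorized_const[OF order_refl]]) (use FB in \<open>auto intro!: power_mono\<close>)
  then obtain R where R: "0 < R" "R < 1"
    "majorized (ball 0 1) 0 (\<lambda>w. (norm (F w - F (of_real R * w)))\<^sup>2) \<delta>'"
    using square_majorized_dilation[OF F _ \<delta>'(1)] by metis
  obtain L where L: "L > 0"
    "\<And>w w'. w \<in> ball 0 1 \<Longrightarrow> w' \<in> ball 0 1 \<Longrightarrow> norm (F (of_real R * w) - F (of_real R * w')) \<le> L * norm (w - w')"
    using holomorphic_dilation_bounds[OF F R(1,2)] by metis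
  have mem: "of_real R * w \<in> ball 0 1" if "w \<in> ball 0 1" for w :: complex
    using that R mult_left_le_one_le[of "norm w" R] by (simp add: norm_mult)
  define g where "g = (\<lambda>z. F (of_real R * h z))"
  have gB: "norm (g z) \<le> B" if "z \<in> epi_domain \<psi>" for z
    unfolding g_def using FB mem h(4)[OF that] by blast
  have g_hol: "g holomorphic_on epi_domain \<psi>"
  proof -
    have "(F \<circ> (\<lambda>z. of_real R * h z)) holomorphic_on epi_domain \<psi>"
      by (rule holomorphic_on_compose_gen[OF _ F]) (use mem h(4) in \<open>auto intro!: holomorphic_intros h(1)\<close>)
    then show ?thesis by (simp add: g_def o_def)
  qed
  have "g \<in> exp_approximable (epi_domain \<psi>) a p"
  proof (rule exp_approximable_trans[OF p0])
    fix \<eta> :: real assume \<eta>: "\<eta> > 0"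
    obtain \<eta>' where \<eta>': "\<eta>' > 0"
      "\<And>S a v. majorized S a (\<lambda>z. (v z)\<^sup>2) \<eta>' \<Longrightarrow> (\<And>z. z \<in> S \<Longrightarrow> 0 \<le> v z \<and> v z \<le> 2 * B) \<Longrightarrow>
         majorized S a (\<lambda>z. v z powr p) \<eta>"
      using majorized_powr_of_square[OF \<eta> p0, of "2 * B"] by metis
    have "\<eta>' / L\<^sup>2 > 0" using \<eta>' L by simp
    then obtain \<epsilon> where \<epsilon>: "0 < \<epsilon>" "\<epsilon> \<le> 1"
      "majorized (epi_domain \<psi>) a (\<lambda>z. (norm (h (z + of_real \<epsilon>) - h z))\<^sup>2) (\<eta>' / L\<^sup>2)"
      using Riemann_map_translation[OF a h] by metis
    have shift: "z + of_real \<epsilon> \<in> epi_domain \<psi>" if "z \<in> epi_domain \<psi>" for z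
      using that \<epsilon> by (simp add: epi_domain_def)
    have shift': "z + of_real \<epsilon> \<in> epi_domain \<psi>" if "z \<in> epi_domain (\<lambda>y. \<psi> y - \<epsilon>)" for z
      using that by (simp add: epi_domain_def)
    have "majorized (epi_domain \<psi>) a (\<lambda>z. L\<^sup>2 * (norm (h (z + of_real \<epsilon>) - h z))\<^sup>2) (L\<^sup>2 * (\<eta>' / L\<^sup>2))"
      by (intro majorized_cmult \<epsilon>) auto
    then have "majorized (epi_domain \<psi>) a (\<lambda>z. (norm (g z - g (z + of_real \<epsilon>)))\<^sup>2) \<eta>'"
    proof (rule majorized_mono)
      fix z assume z: "z \<in> epi_domain \<psi>"
      have "norm (g z - g (z + of_real \<epsilon>)) \<le> L * norm (h z - h (z + of_real \<epsilon>))"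
        unfolding g_def using h(4)[OF z] h(4)[OF shift[OF z]] by (intro L) auto
      then have "(norm (g z - g (z + of_real \<epsilon>)))\<^sup>2 \<le> (L * norm (h z - h (z + of_real \<epsilon>)))\<^sup>2"
        by (intro power_mono) auto
      then show "(norm (g z - g (z + of_real \<epsilon>)))\<^sup>2 \<le> L\<^sup>2 * (norm (h (z + of_real \<epsilon>) - h z))\<^sup>2"
        by (simp add: power_mult_distrib norm_minus_commute)
    qed (use L in auto)
    then have "majorized (epi_domain \<psi>) a (\<lambda>z. norm (g z - g (z + of_real \<epsilon>)) powr p) \<eta>"
    proof (rule \<eta>'(2))
      fix z assume z: "z \<in> epi_domain \<psi>"
      show "0 \<le> norm (g z - g (z + of_real \<epsilon>)) \<and> norm (g z - g (z + of_real \<epsilon>)) \<le> 2 * B"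
        using norm_triangle_ineq4[of "g z" "g (z + of_real \<epsilon>)"] gB[OF z] gB[OF shift[OF z]] by simp
    qed
    moreover have "(\<lambda>z. g (z + of_real \<epsilon>)) \<in> exp_approximable (epi_domain \<psi>) a p"
      by (rule bounded_extendable_exp_approximable[OF expH p \<epsilon>(1,2) shift_holomorphic[OF g_hol]])
         (use gB shift' in auto)
    ultimately show "\<exists>f'\<in>exp_approximable (epi_domain \<psi>) a p. majorized (epi_domain \<psi>) a (\<lambda>z. norm (g z - f' z) powr p) \<eta>"
      by (intro bexI[of _ "\<lambda>z. g (z + of_real \<epsilon>)"])
  qed
  moreover have "majorized (epi_domain \<psi>) a (\<lambda>z. norm (f z - g z) powr p) \<delta>"
  proof (rule \<delta>'(2))
    have "majorized (ball 0 1) (h a) (\<lambda>w. (norm (F w - F (of_real R * w)))\<^sup>2) \<delta>'" using R(3) h(3) by simp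
    then have "majorized (epi_domain \<psi>) a (\<lambda>z. (norm (F (h z) - F (of_real R * h z)))\<^sup>2) \<delta>'"
      by (rule majorized_compose) (use h in auto)
    then show "majorized (epi_domain \<psi>) a (\<lambda>z. (norm (f z - g z))\<^sup>2) \<delta>'"
      by (rule majorized_mono) (auto simp: g_def Ff)
    show "0 \<le> norm (f z - g z) \<and> norm (f z - g z) \<le> 2 * B" if "z \<in> epi_domain \<psi>" for z
      using norm_triangle_ineq4[of "f z" "g z"] f(2)[OF that] gB[OF that] by simp
  qed
  ultimately show "\<exists>f'\<in>exp_approximable (epi_domain \<psi>) a p. majorized (epi_domain \<psi>) a (\<lambda>z. norm (f z - f' z) powr p) \<delta>"
    by blast
qed

text \<open>\<open>f\<close> is truncated to \<open>f * Q\<close> with \<open>Q = n / (n + 1 + H)\<close>, where \<open>Re H\<close> majorizes \<open>\<bar>f\<bar> powr p\<close>. The error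
  \<open>\<bar>f\<bar> powr p * \<bar>1 - Q\<bar> powr p\<close> is small because \<open>\<bar>f\<bar> powr p\<close> is dominated by \<open>\<bar>G\<bar>\<^sup>2\<close> with \<open>G\<close> close to a bounded
  function (uniform integrability), and \<open>\<bar>1 - Q\<bar>\<^sup>2 \<le> 2 - 2 Re Q\<close>.\<close>

lemma majorized_powr_exp_approximable:
  assumes expH: "\<And>s. s \<ge> 0 \<Longrightarrow> \<exists>m. majorized (epi_domain \<psi>) a (\<lambda>z. exp (- s * Re z)) m"
    and a: "a \<in> epi_domain \<psi>" and p: "1 \<le> p"
    and f: "f holomorphic_on epi_domain \<psi>" "majorized (epi_domain \<psi>) a (\<lambda>z. norm (f z) powr p) m"
  shows "f \<in> exp_approximable (epi_domain \<psi>) a p"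
proof (rule exp_approximable_trans)
  show p0: "p > 0" using p by simp
  fix \<delta> :: real assume \<delta>: "\<delta> > 0"
  define S where "S = epi_domain \<psi>"
  obtain h \<phi> where h: "h holomorphic_on epi_domain \<psi>" "\<phi> holomorphic_on ball 0 1" "h a = 0"
    "\<And>z. z \<in> epi_domain \<psi> \<Longrightarrow> h z \<in> ball 0 1 \<and> \<phi> (h z) = z"
    "\<And>w. w \<in> ball 0 1 \<Longrightarrow> \<phi> w \<in> epi_domain \<psi> \<and> h (\<phi> w) = w"
    using Riemann_map[OF a] by metis
  obtain H where H: "H holomorphic_on S" "\<And>z. z \<in> S \<Longrightarrow> norm (f z) powr p \<le> Re (H z)" "Im (H a) = 0"
    using majorizedE[OF f(2)] unfolding S_def by metis
  have H0: "0 \<le> Re (H z)" if "z \<in> S" for z using H(2)[OF that] powr_ge_zero order_trans by blast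
  \<comment> \<open>Here \<open>p \<ge> 1\<close> enters: \<open>1 + Re H\<close> dominates
    \<open>norm (f z)\<close> itself, not only its \<open>p\<close>-th power, so
    \<open>f * Q\<close> is bounded by \<open>n\<close>.\<close>
  have fH: "norm (f z) \<le> 1 + Re (H z)" if "z \<in> S" for z
  proof (cases "norm (f z) \<le> 1")
    case False
    then have "norm (f z) powr 1 \<le> norm (f z) powr p" using p by (intro powr_mono) auto
    then show ?thesis using H(2)[OF that] False by simp
  qed (use H0[OF that] in simp)
  obtain G where G: "G holomorphic_on ball 0 1"
    "\<And>w. w \<in> ball 0 1 \<Longrightarrow> norm (f (\<phi> w)) powr p \<le> (norm (G w))\<^sup>2"
    "majorized (ball 0 1) 0 (\<lambda>w. (norm (G w))\<^sup>2) m"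
  proof (rule power_dominated_by_square[OF _ p0, of "\<lambda>w. f (\<phi> w)" m])
    have "(f \<circ> \<phi>) holomorphic_on ball 0 1"
      by (rule holomorphic_on_compose_gen[OF h(2) f(1)]) (use h(5) in auto)
    then show "(\<lambda>w. f (\<phi> w)) holomorphic_on ball 0 1" by (simp add: o_def)
    have "\<phi> 0 = a" using h(3) h(4)[OF a] by simp
    then have "majorized S (\<phi> 0) (\<lambda>z. norm (f z) powr p) m" using f(2) by (simp add: S_def)
    then show "majorized (ball 0 1) 0 (\<lambda>w. norm (f (\<phi> w)) powr p) m"
      by (rule majorized_compose[OF _ h(2)]) (use h(5) in \<open>auto simp: S_def\<close>)
  qed auto
  \<comment> \<open>\<open>\<eta>\<close> is matched to the bound \<open>2 powr p\<close> on the
    factor \<open>norm (1 - Q z) powr p\<close>, and \<open>\<epsilon>\<close> below to the bound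
    \<open>L\<close> on the dilated \<open>G\<close>; each part contributes
    \<open>\<delta> / 2\<close>.\<close>
  define \<eta> where "\<eta> = \<delta> / (4 * 2 powr p)"
  have \<eta>: "\<eta> > 0" "2 powr p * (2 * \<eta>) = \<delta> / 2" using \<delta> by (auto simp: \<eta>_def)
  obtain R where R: "0 < R" "R < 1"
    "majorized (ball 0 1) 0 (\<lambda>w. (norm (G w - G (of_real R * w)))\<^sup>2) \<eta>"
    using square_majorized_dilation[OF G(1,3) \<eta>(1)] by metis
  obtain L where L: "L > 0" "\<And>w. w \<in> ball 0 1 \<Longrightarrow> norm (G (of_real R * w)) \<le> L"
    using holomorphic_dilation_bounds[OF G(1) R(1,2)] by metis
  define \<epsilon> where "\<epsilon> = \<delta> / (4 * L\<^sup>2)"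
  have \<epsilon>: "\<epsilon> > 0" "2 * L\<^sup>2 * \<epsilon> = \<delta> / 2" using \<delta> L by (auto simp: \<epsilon>_def)
  obtain \<delta>' where \<delta>': "\<delta>' > 0"
    "\<And>S a v. majorized S a (\<lambda>z. (v z)\<^sup>2) \<delta>' \<Longrightarrow> (\<And>z. z \<in> S \<Longrightarrow> 0 \<le> v z \<and> v z \<le> 2) \<Longrightarrow>
       majorized S a (\<lambda>z. v z powr p) \<epsilon>"
    using majorized_powr_of_square[OF \<epsilon>(1) p0, of 2] by metis
  define q where "q = 1 + Re (H a)"
  have q: "q \<ge> 1" using H0[of a] a by (simp add: q_def S_def)
  \<comment> \<open>Because \<open>H a\<close> is real, \<open>Q a\<close> is
    \<open>n / (n + q)\<close>, and this is the value at \<open>a\<close> of the majorant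
    \<open>2 - 2 * Re Q\<close>.\<close>
  have "(\<lambda>n. 2 - 2 * (real n / (real n + q))) \<longlonglongrightarrow> 0" by real_asymp
  then have "\<forall>\<^sub>F n in sequentially. 2 - 2 * (real n / (real n + q)) < \<delta>'"
    using \<delta>'(1) by (rule order_tendstoD(2))
  then obtain n :: nat where n: "2 - 2 * (real n / (real n + q)) < \<delta>'"
    using eventually_happens by force
  define Q where "Q = (\<lambda>z. of_nat n / (of_nat n + 1 + H z))"
  have den: "real n + (1 + Re (H z)) \<le> norm (of_nat n + 1 + H z)" for z
    using complex_Re_le_cmod[of "of_nat n + 1 + H z"] by simp
  have pos: "0 < real n + (1 + Re (H z))" if "z \<in> S" for z using H0[OF that] by simp
  have ne: "of_nat n + 1 + H z \<noteq> 0" if "z \<in> S" for z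
  proof -
    have "0 < norm (of_nat n + 1 + H z)" using den[of z] pos[OF that] by linarith
    then show ?thesis by simp
  qed
  have Q_hol: "Q holomorphic_on S" unfolding Q_def by (intro holomorphic_intros H) (use ne in auto)
  have Q_le: "norm (Q z) \<le> real n / (real n + (1 + Re (H z)))" if "z \<in> S" for z
    unfolding Q_def norm_divide norm_of_nat using den[of z] pos[OF that] ne[OF that]
    by (intro divide_left_mono mult_pos_pos) auto
  have Q1: "norm (Q z) \<le> 1" if "z \<in> S" for z
    using pos[OF that] H0[OF that] by (intro order_trans[OF Q_le[OF that]]) (auto simp: divide_le_eq_1)
  have fQ: "norm (f z * Q z) \<le> real n" if "z \<in> S" for z
  proof -
    have "norm (f z * Q z) \<le> (1 + Re (H z)) * (real n / (real n + (1 + Re (H z))))"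
      unfolding norm_mult using fH[OF that] Q_le[OF that] H0[OF that] by (intro mult_mono) auto
    also have "\<dots> = real n * ((1 + Re (H z)) / (real n + (1 + Re (H z))))" by simp
    also have "\<dots> \<le> real n * 1"
      using H0[OF that] by (intro mult_left_mono) (auto simp: divide_le_eq_1)
    finally show ?thesis by simp
  qed
  have "majorized S a (\<lambda>z. (norm (1 - Q z))\<^sup>2) \<delta>'"
  proof (rule majorizedI[of "\<lambda>z. 2 - 2 * Q z"])
    show "(\<lambda>z. 2 - 2 * Q z) holomorphic_on S" by (intro holomorphic_intros Q_hol)
    show "(norm (1 - Q z))\<^sup>2 \<le> Re (2 - 2 * Q z)" if "z \<in> S" for z
    proof -
      have "(norm (1 - Q z))\<^sup>2 = 1 - 2 * Re (Q z) + (norm (Q z))\<^sup>2"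
        unfolding cmod_power2 by (simp add: power2_eq_square algebra_simps)
      also have "(norm (Q z))\<^sup>2 \<le> 1" using power_mono[OF Q1[OF that], of 2] by simp
      finally show ?thesis by simp
    qed
    have "Q a = of_real (real n / (real n + q))"
    proof -
      have "of_nat n + 1 + H a = of_real (real n + q)" using H(3) by (simp add: q_def complex_eq_iff)
      then show ?thesis by (simp add: Q_def)
    qed
    then show "Re (2 - 2 * Q a) \<le> \<delta>'" using n by simp
  qed
  then have 1: "majorized S a (\<lambda>z. norm (1 - Q z) powr p) \<epsilon>"
  proof (rule \<delta>'(2))
    show "0 \<le> norm (1 - Q z) \<and> norm (1 - Q z) \<le> 2" if "z \<in> S" for z
      using norm_triangle_ineq4[of 1 "Q z"] Q1[OF that] by simp
  qed
  have "majorized (ball 0 1) (h a) (\<lambda>w. (norm (G w - G (of_real R * w)))\<^sup>2) \<eta>" using R(3) h(3) by simp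
  then have 2: "majorized S a (\<lambda>z. (norm (G (h z) - G (of_real R * h z)))\<^sup>2) \<eta>"
    by (rule majorized_compose) (use h in \<open>auto simp: S_def\<close>)
  have "majorized S a (\<lambda>z. (2 * L\<^sup>2) * norm (1 - Q z) powr p + 2 powr p * (2 * (norm (G (h z) - G (of_real R * h z)))\<^sup>2))
     (2 * L\<^sup>2 * \<epsilon> + 2 powr p * (2 * \<eta>))"
    by (intro majorized_add majorized_cmult 1 2) auto
  then have "majorized S a (\<lambda>z. norm (f z - f z * Q z) powr p) \<delta>"
  proof (rule majorized_mono)
    fix z assume z: "z \<in> S"
    have hz: "h z \<in> ball 0 1" "\<phi> (h z) = z" using h(4) z by (auto simp: S_def)
    define u where "u = norm (G (of_real R * h z))"
    define v where "v = norm (G (h z) - G (of_real R * h z))"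
    define y where "y = norm (1 - Q z) powr p"
    have y: "0 \<le> y" "y \<le> 2 powr p"
      unfolding y_def using norm_triangle_ineq4[of 1 "Q z"] Q1[OF z] p by (auto intro!: powr_mono2)
    have "norm (f z - f z * Q z) = norm (f z) * norm (1 - Q z)"
      by (simp add: algebra_simps flip: norm_mult)
    then have "norm (f z - f z * Q z) powr p = norm (f z) powr p * y"
      by (simp add: y_def powr_mult)
    also have "\<dots> \<le> (norm (G (h z)))\<^sup>2 * y"
      using G(2)[OF hz(1)] y hz by (intro mult_right_mono) auto
    \<comment> \<open>\<open>G\<close> is split into its bounded dilation and a small rest: the
      bounded part is paired with the smallness of \<open>y\<close> in mean, the small part with
      \<open>y \<le> 2 powr p\<close>.\<close>
    also have "\<dots> \<le> (2 * u\<^sup>2 + 2 * v\<^sup>2) * y"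
    proof (rule mult_right_mono[OF _ y(1)])
      have "norm (G (h z)) \<le> u + v"
        using norm_triangle_ineq[of "G (of_real R * h z)" "G (h z) - G (of_real R * h z)"] by (simp add: u_def v_def)
      then have "(norm (G (h z)))\<^sup>2 \<le> (u + v)\<^sup>2" by (intro power_mono) auto
      also have "\<dots> \<le> 2 * u\<^sup>2 + 2 * v\<^sup>2"
        using zero_le_power2[of "u - v"] by (simp add: power2_eq_square algebra_simps)
      finally show "(norm (G (h z)))\<^sup>2 \<le> 2 * u\<^sup>2 + 2 * v\<^sup>2" .
    qed
    also have "\<dots> = 2 * u\<^sup>2 * y + 2 * v\<^sup>2 * y" by (simp add: distrib_right)
    also have "\<dots> \<le> 2 * L\<^sup>2 * y + 2 * v\<^sup>2 * 2 powr p"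
      using y L(2)[OF hz(1)] by (intro add_mono mult_right_mono mult_left_mono power_mono) (auto simp: u_def)
    finally show "norm (f z - f z * Q z) powr p \<le>
       (2 * L\<^sup>2) * norm (1 - Q z) powr p + 2 powr p * (2 * (norm (G (h z) - G (of_real R * h z)))\<^sup>2)"
      by (simp add: y_def v_def mult_ac)
  next
    show "2 * L\<^sup>2 * \<epsilon> + 2 powr p * (2 * \<eta>) \<le> \<delta>" unfolding \<eta>(2) \<epsilon>(2) by simp
  qed
  moreover have "(\<lambda>z. f z * Q z) \<in> exp_approximable (epi_domain \<psi>) a p"
  proof (rule bounded_exp_approximable[OF expH a p])
    show "(\<lambda>z. f z * Q z) holomorphic_on epi_domain \<psi>"
      using Q_hol f(1) by (auto simp: S_def intro!: holomorphic_intros)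
  qed (use fQ in \<open>auto simp: S_def\<close>)
  ultimately show "\<exists>f'\<in>exp_approximable (epi_domain \<psi>) a p. majorized (epi_domain \<psi>) a (\<lambda>z. norm (f z - f' z) powr p) \<delta>"
    unfolding S_def by (intro bexI[of _ "\<lambda>z. f z * Q z"])
qed

end

section \<open>Translation between the definitions of the statement and the tools above\<close>

lemma log_starlike_fun_imp_log_graph:
  assumes "log_starlike_fun \<psi>"
  obtains K A where "log_graph \<psi> K A"
proof -
  obtain K where K: "K > 0" "\<And>y. \<exists>d. (\<psi> has_real_derivative d) (at y) \<and> \<bar>d\<bar> \<le> K"
    using assms by (auto simp: log_starlike_fun_def)
  obtain R a where R: "R > 0" "0 < a" "a < 1" "\<And>y. \<bar>y\<bar> \<ge> R \<Longrightarrow> \<psi> y \<ge> - a * ln \<bar>y\<bar>"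
    using assms by (auto simp: log_starlike_fun_def)
  obtain d where d: "\<And>y. (\<psi> has_real_derivative d y) (at y)" "\<And>y. \<bar>d y\<bar> \<le> K"
    using K(2) by metis
  have lip: "\<bar>\<psi> x - \<psi> y\<bar> \<le> K * \<bar>x - y\<bar>" for x y
    using field_differentiable_bound[of UNIV \<psi> d K x y] d by simp
  \<comment> \<open>Large enough for \<open>\<bar>y\<bar> < R\<close> by the Lipschitz bound. For
    larger \<open>\<bar>y\<bar>\<close> the logarithmic bound gives
    \<open>\<bar>y\<bar> powr a\<close>, which \<open>a < 1\<close> keeps below
    \<open>1 + \<bar>y\<bar>\<close>.\<close>
  define A where "A = exp (\<bar>\<psi> 0\<bar> + K * R)"
  have A: "1 \<le> A" using K R by (simp add: A_def)
  have "exp (- \<psi> y) \<le> A * (1 + \<bar>y\<bar>)" for y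
  proof (cases "\<bar>y\<bar> \<ge> R")
    case True
    then have y: "\<bar>y\<bar> > 0" using R by linarith
    have "exp (- \<psi> y) \<le> exp (a * ln \<bar>y\<bar>)" using R(4)[OF True] by simp
    also have "\<dots> = \<bar>y\<bar> powr a" using y by (simp add: powr_def)
    also have "\<dots> \<le> (1 + \<bar>y\<bar>) powr a" using R by (intro powr_mono2) auto
    also have "\<dots> \<le> (1 + \<bar>y\<bar>) powr 1" using R by (intro powr_mono) auto
    also have "\<dots> \<le> A * (1 + \<bar>y\<bar>)" using A mult_right_mono[OF A, of "1 + \<bar>y\<bar>"] by simp
    finally show ?thesis .
  next
    case False
    have "K * \<bar>y\<bar> \<le> K * R" using False K by (intro mult_left_mono) auto
    then have "exp (- \<psi> y) \<le> A" using lip[of 0 y] by (simp add: A_def)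
    also have "\<dots> \<le> A * (1 + \<bar>y\<bar>)" using A by simp
    finally show ?thesis .
  qed
  then show thesis using that[of K A] lip K A by (simp add: log_graph_def lipschitz_graph_def log_graph_axioms_def)
qed

lemma norm_exp_powr: "norm (exp (complex_of_real l * z)) powr p = exp (p * l * Re z)"
  by (simp add: powr_def mult.assoc)

text \<open>From left to right a global holomorphic function with the given harmonic real part is
  needed, hence simple connectedness; the converse is local.\<close>

lemma majorized_iff_harm_majorants:
  assumes S: "open S" "simply_connected S" and a: "a \<in> S"
  shows "(\<exists>u\<in>harm_majorants S p f. u a \<le> d) \<longleftrightarrow> majorized S a (\<lambda>z. norm (f z) powr p) d"
proof
  assume "\<exists>u\<in>harm_majorants S p f. u a \<le> d"
  then obtain u where u: "harmonic_on S u" "\<forall>z\<in>S. norm (f z) powr p \<le> u z" "u a \<le> d"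
    by (auto simp: harm_majorants_def)
  obtain H where H: "H holomorphic_on S" "\<And>z. z \<in> S \<Longrightarrow> u z = Re (H z)"
    using harmonic_on_Re_holomorphic[OF S u(1)] by metis
  show "majorized S a (\<lambda>z. norm (f z) powr p) d"
    by (rule majorizedI[OF H(1)]) (use u H a in auto)
next
  assume "majorized S a (\<lambda>z. norm (f z) powr p) d"
  then obtain H where H: "H holomorphic_on S" "\<And>z. z \<in> S \<Longrightarrow> norm (f z) powr p \<le> Re (H z)" "Re (H a) \<le> d"
    by (auto simp: majorized_def)
  have "harmonic_on S (\<lambda>z. Re (H z))"
    unfolding harmonic_on_def
  proof
    fix z assume "z \<in> S"
    then obtain r where r: "r > 0" "ball z r \<subseteq> S" using S(1) by (meson openE)
    then show "\<exists>r>0. ball z r \<subseteq> S \<and> (\<exists>F. F holomorphic_on ball z r \<and> (\<forall>w\<in>ball z r. Re (H w) = Re (F w)))"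
      using H(1) holomorphic_on_subset by blast
  qed
  then show "\<exists>u\<in>harm_majorants S p f. u a \<le> d"
    using H by (intro bexI[of _ "\<lambda>z. Re (H z)"]) (auto simp: harm_majorants_def)
qed

theorem theorem4p6:
  fixes \<psi> :: "real \<Rightarrow> real" and p0 :: real
  assumes "log_starlike_fun \<psi>"
    and "p0 \<ge> 1"
    and "\<forall>l::real. l \<le> 0 \<longrightarrow> (\<lambda>z. exp (complex_of_real l * z)) \<in> Hardy (epi_domain \<psi>) p0"
  shows "(\<forall>f\<in>disc_alg (epi_domain \<psi>). \<forall>\<epsilon>>0. \<exists>g\<in>LM \<inter> disc_alg (epi_domain \<psi>).
            \<forall>z\<in>closure (epi_domain \<psi>). norm (f z - g z) \<le> \<epsilon>)
       \<and> (\<forall>l::real. \<forall>p::real. l \<le> 0 \<longrightarrow> p \<ge> 1 \<longrightarrow>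
            (\<lambda>z. exp (complex_of_real l * z)) \<in> Hardy (epi_domain \<psi>) p)
       \<and> (\<forall>p::real. p \<ge> 1 \<longrightarrow> (\<forall>f\<in>Hardy (epi_domain \<psi>) p. \<forall>z0\<in>epi_domain \<psi>. \<forall>\<epsilon>>0.
            \<exists>g\<in>exp_span. Hardy_norm (epi_domain \<psi>) p z0 (\<lambda>z. f z - g z) < \<epsilon>))"
proof -
  define \<Omega> where "\<Omega> = epi_domain \<psi>"
  obtain K A where "log_graph \<psi> K A"
    using log_starlike_fun_imp_log_graph[OF assms(1)] by metis
  then interpret log_graph \<psi> K A .
  have \<Omega>: "open \<Omega>" "simply_connected \<Omega>"
    unfolding \<Omega>_def by (rule open_epi_domain simply_connected_epi_domain)+
  have p0: "p0 > 0" using assms(2) by simp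
  have exp_Hardy: "(\<lambda>z. exp (complex_of_real l * z)) \<in> Hardy \<Omega> p" if "l \<le> 0" "p \<ge> 1" for l p
  proof -
    \<comment> \<open>The \<open>p\<close>-th power for rate \<open>l\<close> and the
      \<open>p0\<close>-th power for rate \<open>p * l / p0\<close> are the same function
      \<open>exp (p * l * Re z)\<close>, with the same majorants.\<close>
    have "p * l / p0 \<le> 0" using that p0 by (simp add: divide_nonpos_pos mult_nonneg_nonpos)
    then have "(\<lambda>z. exp (complex_of_real (p * l / p0) * z)) \<in> Hardy \<Omega> p0"
      using assms(3) \<Omega>_def by blast
    then have "harm_majorants \<Omega> p0 (\<lambda>z. exp (complex_of_real (p * l / p0) * z)) \<noteq> {}"
      by (simp add: Hardy_def)
    moreover have "harm_majorants \<Omega> p0 (\<lambda>z. exp (complex_of_real (p * l / p0) * z))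
        = harm_majorants \<Omega> p (\<lambda>z. exp (complex_of_real l * z))"
      unfolding harm_majorants_def norm_exp_powr using p0 by simp
    ultimately show ?thesis by (simp add: Hardy_def holomorphic_intros)
  qed
  have dense: "\<exists>g\<in>exp_span. Hardy_norm \<Omega> p z0 (\<lambda>z. f z - g z) < \<epsilon>"
    if p: "p \<ge> 1" and f: "f \<in> Hardy \<Omega> p" and z0: "z0 \<in> \<Omega>" and \<epsilon>: "\<epsilon> > 0" for p f z0 \<epsilon>
  proof -
    note maj = majorized_iff_harm_majorants[OF \<Omega> z0]
    have Hardy_maj: "\<exists>m. majorized \<Omega> z0 (\<lambda>z. norm (g z) powr q) m" if g: "g \<in> Hardy \<Omega> q" for g q
    proof -
      obtain u where "u \<in> harm_majorants \<Omega> q g" using g by (auto simp: Hardy_def)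
      then show ?thesis using maj[of q g "u z0"] by blast
    qed
    have expH: "\<exists>m. majorized \<Omega> z0 (\<lambda>z. exp (- s * Re z)) m" if "s \<ge> 0" for s
      using Hardy_maj[OF exp_Hardy[of "- s" 1]] that unfolding norm_exp_powr by simp
    obtain m where "majorized \<Omega> z0 (\<lambda>z. norm (f z) powr p) m" using Hardy_maj[OF f] by blast
    then have "f \<in> exp_approximable \<Omega> z0 p"
      using majorized_powr_exp_approximable[of z0 p f m] expH z0 p f by (simp add: Hardy_def \<Omega>_def)
    moreover have "(\<epsilon> / 2) powr p > 0" using \<epsilon> by simp
    ultimately obtain g where g: "g \<in> exp_span"
      "majorized \<Omega> z0 (\<lambda>z. norm (f z - g z) powr p) ((\<epsilon> / 2) powr p)"
      unfolding exp_approximable_def by blast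
    define U where "U = (\<lambda>u. u z0) ` harm_majorants \<Omega> p (\<lambda>z. f z - g z)"
    obtain u where u: "u \<in> harm_majorants \<Omega> p (\<lambda>z. f z - g z)" "u z0 \<le> (\<epsilon> / 2) powr p"
      using g(2) maj by blast
    \<comment> \<open>The lower bound 0 makes \<open>Inf U\<close> a genuine infimum and lets the
      root of order \<open>p\<close> be applied monotonically.\<close>
    have nonneg: "0 \<le> x" if "x \<in> U" for x
      using that z0 unfolding U_def harm_majorants_def by (auto intro: order_trans[OF powr_ge_zero])
    have uU: "u z0 \<in> U" using u(1) by (auto simp: U_def)
    have "Inf U \<le> (\<epsilon> / 2) powr p"
      using cInf_lower[OF uU] nonneg u(2) by (meson bdd_belowI order_trans)
    moreover have "0 \<le> Inf U" using uU nonneg by (intro cInf_greatest) auto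
    ultimately have "Inf U powr (1 / p) \<le> ((\<epsilon> / 2) powr p) powr (1 / p)"
      using p by (intro powr_mono2) auto
    also have "\<dots> = \<epsilon> / 2" using p \<epsilon> by (simp add: powr_powr)
    finally show ?thesis using g(1) \<epsilon> unfolding Hardy_norm_def U_def by force
  qed
  show ?thesis
    using LM_dense_disc_alg exp_Hardy dense unfolding \<Omega>_def by blast
qed

end
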